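(* Let $(X,\|\cdot\|_X,\tau_X)$ be a sequentially complete C-sequential Saks space, $(U,\|\cdot\|_U,\tau_U)$ a Saks space, $(S_t)_{t\geq 0}$ a locally $\tau_X$-bi-continuous semigroup on $X$ with generator $(-A,D(A))$, $B\in\mathcal{L}(U;X)$ such that $B$ is also $\tau_U$-$\tau_X$-continuous on $\|\cdot\|_U$-bounded sets, and $T>0$. Then the following assertions are equivalent: (a) The control system $\dot x(t)=-Ax(t)+Bu(t)$ $(t>0)$, $x(0)=x_0\in X$, is cost-uniform approximately $\tau_X$-null-controllable in time $T$ via $C_{\tau,b}([0,T];U)$. (b) The dual observation system $\dot x(t)=-A^\circ x(t)$ $(t>0)$, $y(t)=B^\circ x(t)$ $(t\geq 0)$, $x(0)=x_0\in X^\circ$, satisfies a final state observability estimate in $(C_{\tau,b}([0,T];U),\gamma_\infty)'$. If additionally $\tau_U$ is the $\|\cdot\|_U$-topology, then each of the preceding assertions is equivalent to: (c) There exists $C_{\mathrm{obs}}\geq 0$ such that $$\forall x^\circ\in X^\circ:\quad \|S_T^\circ x^\circ\|_{X^\circ}\leq C_{\mathrm{obs}}\,\|B^\circ S_{(\cdot)}^\circ x^\circ\odot\lambda\|_{var}.$$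
   Context: All vector spaces are over $\mathbb{K}=\mathbb{R}$ or $\mathbb{C}$. $\mathcal{L}(X;Y)$ denotes the norm-continuous linear operators between Banach spaces, $\mathcal{L}(X):=\mathcal{L}(X;X)$, $X'$ the norm dual. Saks spaces. A triple $(X,\|\cdot\|_X,\tau_X)$, with $(X,\|\cdot\|_X)$ a normed space and $\tau_X$ a Hausdorff locally convex topology on $X$, is a Saks space if $(X,\|\cdot\|_X)$ is a Banach space, $\tau_X$ is coarser than (or equal to) the $\|\cdot\|_X$-topology, and $(X,\tau_X)'$ is norming for $X$, i.e. $\|x\|_X=\sup\{|\langle x',x\rangle| : x'\in(X,\tau_X)',\ \|x'\|_{X'}\leq 1\}$. The mixed topology $\gamma_X$ is the finest linear topology on $X$ that coincides with $\tau_X$ on $\|\cdot\|_X$-bounded sets and lies between $\tau_X$ and the $\|\cdot\|_X$-topology; it is Hausdorff locally convex. The Saks space is sequentially complete if $(X,\gamma_X)$ is sequentially complete, and C-sequential if every convex sequentially open subset of $(X,\gamma_X)$ is open. Semigroups. A semigroup $(S_t)_{t\geq 0}$ in $\mathcal{L}(X)$ ($S_0=I$, $S_{t+s}=S_tS_s$) is locally $\tau_X$-bi-continuous if (i) there are $M\geq 1$, $\omega\in\mathbb{R}$ with $\|S_t\|\leq Me^{\omega t}$ for all $t\ge 0$; (ii) $t\mapsto S_tx\in(X,\tau_X)$ is continuous on $[0,\infty)$ for all $x\in X$; (iii) for every $\|\cdot\|_X$-bounded sequence $(x_n)$ that $\tau_X$-converges to $x\in X$, $\tau_X\text{-}\lim_n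 S_t(x_n-x)=0$ locally uniformly for $t\in[0,\infty)$. Its generator is $-Ax:=\tau_X\text{-}\lim_{t\to 0+}\frac{S_tx-x}{t}$ on the set $D(A)$ of all $x\in X$ for which this limit exists in $X$ and $\sup_{t\in(0,1]}\|S_tx-x\|_X/t<\infty$. Function space. $C_{\tau,b}([0,T];U)$ is the space of all continuous $u:[0,T]\to(U,\tau_U)$ with $\|u\|_\infty:=\sup_{t\in[0,T]}\|u(t)\|_U<\infty$; it equals $C([0,T];(U,\gamma_U))$ and is a Banach space under $\|\cdot\|_\infty$. The locally convex topology $\gamma_\infty$ on it is generated by the seminorms $u\mapsto\sup_{t\in[0,T]}p(u(t))$, $p$ running through a directed system of seminorms inducing $\gamma_U$. For $y'\in(C_{\tau,b}([0,T];U),\gamma_\infty)'$ put $\|y'\|_{(C_{\tau,b}([0,T];U),\gamma_\infty)'}:=\sup\{|y'(u)| : \|u\|_\infty\leq 1\}$. Controllability. For $u\in C_{\tau,b}([0,T];U)$ the mild solution of the control system is $x(t)=S_tx_0+\int_0^tS_{t-r}Bu(r)\,\mathrm{d}r$, $t\in[0,T]$ (integral in the Pettis sense w.r.t. $\tau_X$). Let $\mathcal{P}_{\tau_X}$ be a directed system of seminorms inducing $\tau_X$. The control system is cost-uniform approximately $\tau_X$-null-controllable in time $T$ via $C_{\tau,b}([0,T];U)$ if there is $C\geq 0$ such that for all $x_0\in X$, $\varepsilon>0$ and $p\in\mathcal{P}_{\tau_X}$ there is $u\in C_{\tau,b}([0,T];U)$ with $\|u\|_\infty\leq C\|x_0\|_X$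 and $p(x(T))\leq\varepsilon$ (this does not depend on the choice of $\mathcal{P}_{\tau_X}$). Duality. $X^\circ:=\{x'\in X' : x' \text{ is } \tau_X\text{-sequentially continuous on } \|\cdot\|_X\text{-bounded sets}\}$, a closed subspace of $X'$ with the norm of $X'$; similarly $U^\circ$. $S_t^\circ:=S_t'|_{X^\circ}\in\mathcal{L}(X^\circ)$, $B^\circ:=B'|_{X^\circ}\in\mathcal{L}(X^\circ;U^\circ)$ where $'$ denotes the dual operator; $-A^\circ$ is the generator of $(S_t^\circ)_{t\ge0}$, defined by $-A^\circ x^\circ=\lim_{t\to0+}(S_t^\circ x^\circ-x^\circ)/t$ in the topology of uniform convergence on $\|\cdot\|_X$-compact subsets of $X$, with domain those $x^\circ\in X^\circ$ for which the limit exists in $X^\circ$. Let $\mathcal{B}^T:C_{\tau,b}([0,T];U)\to X$, $\mathcal{B}^Tu:=\int_0^TS_{T-t}Bu(t)\,\mathrm{d}t$, and ${\mathcal{B}^T}^\circ x^\circ:=x^\circ\circ\mathcal{B}^T\in(C_{\tau,b}([0,T];U),\gamma_\infty)'$ for $x^\circ\in X^\circ$. The dual observation system satisfies a final state observability estimate in $(C_{\tau,b}([0,T];U),\gamma_\infty)'$ if there is $C_{\mathrm{obs}}\geq 0$ with $\|S_T^\circ x^\circ\|_{X^\circ}\leq C_{\mathrm{obs}}\|{\mathcal{B}^T}^\circ x^\circ\|_{(C_{\tau,b}([0,T];U),\gamma_\infty)'}$ for all $x^\circ\in X^\circ$. Vector measure. $\lambda$ is Lebesgue measure, and $B^\circ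 S_{(\cdot)}^\circ x^\circ\odot\lambda$ is the $U'$-valued finitely additive vector measure on the Borel sets $N\subseteq[0,T]$ given by $(B^\circ S_{(\cdot)}^\circ x^\circ\odot\lambda)(N)u:=\int_N\langle B^\circ S_t^\circ x^\circ,u\rangle\,\mathrm{d}t$, $u\in U$. For a finitely additive $U'$-valued vector measure $\nu$, the semivariation norm is $\|\nu\|_{var}:=\sup|\sum_{i=1}^n\nu(N_i)u_i|$, the supremum being over all finite partitions $\{N_1,\dots,N_n\}$ of $[0,T]$ into disjoint Borel sets and all $u_1,\dots,u_n\in U$ with $\|u_i\|_U\leq 1$. *)

theory Defs
  imports "HOL-Analysis.Analysis"
begin

section \<open>The scalar field\<close>

text \<open>Up to an isometric isomorphism the members of this class are exactly the fields of real and
  of complex numbers.\<close>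

class real_or_complex = real_normed_field + banach + second_countable_topology +
  assumes real_or_complex_embedding:
    "\<exists>h :: 'a \<Rightarrow> complex.
       (\<forall>a b. h (a + b) = h a + h b) \<and> (\<forall>a b. h (a * b) = h a * h b) \<and>
       (\<forall>r. h (r *\<^sub>R 1) = of_real r) \<and> (\<forall>a. norm (h a) = norm a) \<and>
       (range h = \<real> \<or> range h = UNIV)"

instance real :: real_or_complex
proof
  have "range complex_of_real = \<real>"
    by (simp add: Reals_def)
  then show "\<exists>h :: real \<Rightarrow> complex.
       (\<forall>a b. h (a + b) = h a + h b) \<and> (\<forall>a b. h (a * b) = h a * h b) \<and>
       (\<forall>r. h (r *\<^sub>R 1) = of_real r) \<and> (\<forall>a. norm (h a) = norm a) \<and>
       (range h = \<real> \<or> range h = UNIV)"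
    by (intro exI[of _ complex_of_real]) (simp del: of_real_eq_id)
qed

instance complex :: real_or_complex
proof
  show "\<exists>h :: complex \<Rightarrow> complex.
       (\<forall>a b. h (a + b) = h a + h b) \<and> (\<forall>a b. h (a * b) = h a * h b) \<and>
       (\<forall>r. h (r *\<^sub>R 1) = of_real r) \<and> (\<forall>a. norm (h a) = norm a) \<and>
       (range h = \<real> \<or> range h = UNIV)"
    by (intro exI[of _ "\<lambda>z. z"]) (simp add: of_real_def)
qed

text \<open>A normed space over \<open>'k\<close> is a type of class \<^class>\<open>real_normed_vector\<close> together with a
  scalar multiplication by elements of \<open>'k\<close> that extends the real one.\<close>

locale normed_space_over = vector_space smul
  for smul :: "'k::real_or_complex \<Rightarrow> 'x::real_normed_vector \<Rightarrow> 'x" +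
  assumes smul_of_real: "smul (of_real r) x = r *\<^sub>R x"
    and norm_smul: "norm (smul a x) = norm a * norm x"


section \<open>Linear topologies and dual spaces\<close>

definition linear_topology ::
  "('k::real_or_complex \<Rightarrow> 'x::real_normed_vector \<Rightarrow> 'x) \<Rightarrow> 'x topology \<Rightarrow> bool" where
  "linear_topology smul \<tau> \<longleftrightarrow>
     topspace \<tau> = UNIV \<and>
     continuous_map (prod_topology \<tau> \<tau>) \<tau> (\<lambda>(x, y). x + y) \<and>
     continuous_map (prod_topology euclidean \<tau>) \<tau> (\<lambda>(a, x). smul a x)"

definition locally_convex_topology ::
  "('k::real_or_complex \<Rightarrow> 'x::real_normed_vector \<Rightarrow> 'x) \<Rightarrow> 'x topology \<Rightarrow> bool" where
  "locally_convex_topology smul \<tau> \<longleftrightarrow>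
     linear_topology smul \<tau> \<and>
     (\<forall>V. openin \<tau> V \<and> 0 \<in> V \<longrightarrow> (\<exists>W. openin \<tau> W \<and> 0 \<in> W \<and> convex W \<and> W \<subseteq> V))"

definition coarser_than :: "'x topology \<Rightarrow> 'x topology \<Rightarrow> bool" where
  "coarser_than \<sigma> \<tau> \<longleftrightarrow> (\<forall>V. openin \<sigma> V \<longrightarrow> openin \<tau> V)"

text \<open>\<^term>\<open>top_dual smul \<tau>\<close> is the dual of \<open>(X, \<tau>)\<close>; the norm dual is
  \<^term>\<open>top_dual smul euclidean\<close>, since \<^const>\<open>euclidean\<close> is the norm topology of the type.
  The dual norm is \<^const>\<open>onorm\<close>.\<close>

definition top_dual ::
  "('k::real_or_complex \<Rightarrow> 'x::real_normed_vector \<Rightarrow> 'x) \<Rightarrow> 'x topology \<Rightarrow> ('x \<Rightarrow> 'k) set" where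
  "top_dual smul \<tau> =
     {f. Vector_Spaces.linear smul (*) f \<and> continuous_map \<tau> euclidean f}"

definition bounded_ops ::
  "('k::real_or_complex \<Rightarrow> 'x::real_normed_vector \<Rightarrow> 'x) \<Rightarrow>
   ('k \<Rightarrow> 'y::real_normed_vector \<Rightarrow> 'y) \<Rightarrow> ('x \<Rightarrow> 'y) set" where
  "bounded_ops scaleX scaleY = {F. Vector_Spaces.linear scaleX scaleY F \<and> continuous_on UNIV F}"

definition seminorm_on ::
  "('k::real_or_complex \<Rightarrow> 'x::real_normed_vector \<Rightarrow> 'x) \<Rightarrow> ('x \<Rightarrow> real) \<Rightarrow> bool" where
  "seminorm_on smul p \<longleftrightarrow>
     (\<forall>x y. p (x + y) \<le> p x + p y) \<and> (\<forall>a x. p (smul a x) = norm a * p x)"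

definition directed_seminorms_inducing ::
  "('k::real_or_complex \<Rightarrow> 'x::real_normed_vector \<Rightarrow> 'x) \<Rightarrow> ('x \<Rightarrow> real) set \<Rightarrow> 'x topology \<Rightarrow> bool"
  where
  "directed_seminorms_inducing smul P \<tau> \<longleftrightarrow>
     P \<noteq> {} \<and> (\<forall>p\<in>P. seminorm_on smul p) \<and>
     (\<forall>p\<in>P. \<forall>q\<in>P. \<exists>r\<in>P. \<exists>C\<ge>0. \<forall>x. max (p x) (q x) \<le> C * r x) \<and>
     (\<forall>V. openin \<tau> V \<longleftrightarrow> (\<forall>x\<in>V. \<exists>p\<in>P. \<exists>e>0. {y. p (y - x) < e} \<subseteq> V))"


section \<open>Saks spaces\<close>

definition saks_space ::
  "('k::real_or_complex \<Rightarrow> 'x::banach \<Rightarrow> 'x) \<Rightarrow> 'x topology \<Rightarrow> bool" where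
  "saks_space smul \<tau> \<longleftrightarrow>
     normed_space_over smul \<and>
     locally_convex_topology smul \<tau> \<and> Hausdorff_space \<tau> \<and>
     coarser_than \<tau> euclidean \<and>
     (\<forall>x. norm x = (SUP f\<in>{f \<in> top_dual smul \<tau>. onorm f \<le> 1}. norm (f x)))"

definition mixed_candidate ::
  "('k::real_or_complex \<Rightarrow> 'x::banach \<Rightarrow> 'x) \<Rightarrow> 'x topology \<Rightarrow> 'x topology \<Rightarrow> bool" where
  "mixed_candidate smul \<tau> \<gamma> \<longleftrightarrow>
     linear_topology smul \<gamma> \<and>
     (\<forall>N. bounded N \<longrightarrow> subtopology \<gamma> N = subtopology \<tau> N) \<and>
     coarser_than \<tau> \<gamma> \<and> coarser_than \<gamma> euclidean"

definition mixed_topology ::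
  "('k::real_or_complex \<Rightarrow> 'x::banach \<Rightarrow> 'x) \<Rightarrow> 'x topology \<Rightarrow> 'x topology" where
  "mixed_topology smul \<tau> =
     (THE \<gamma>. mixed_candidate smul \<tau> \<gamma> \<and>
        (\<forall>\<sigma>. mixed_candidate smul \<tau> \<sigma> \<longrightarrow> coarser_than \<sigma> \<gamma>))"

lemma mixed_topology_unique_existence:
  fixes smul :: "'k::real_or_complex \<Rightarrow> 'x::banach \<Rightarrow> 'x"
  assumes "linear_topology smul \<tau>" "coarser_than \<tau> euclidean"
  shows "\<exists>!\<gamma>. mixed_candidate smul \<tau> \<gamma> \<and>
           (\<forall>\<sigma>. mixed_candidate smul \<tau> \<sigma> \<longrightarrow> coarser_than \<sigma> \<gamma>)"
proof -
  define \<S> where "\<S> = {V. \<exists>\<sigma>. mixed_candidate smul \<tau> \<sigma> \<and> openin \<sigma> V}"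
  define \<gamma> where "\<gamma> = topology_generated_by \<S>"
  have \<tau>: "mixed_candidate smul \<tau> \<tau>"
    using assms by (simp add: mixed_candidate_def coarser_than_def)
  have top: "topspace \<sigma> = UNIV" if "mixed_candidate smul \<tau> \<sigma>" for \<sigma>
    using that by (simp add: mixed_candidate_def linear_topology_def)
  have finer: "openin \<gamma> V" if "mixed_candidate smul \<tau> \<sigma>" "openin \<sigma> V" for \<sigma> V
    unfolding \<gamma>_def by (rule topology_generated_by_Basis) (use that in \<open>auto simp: \<S>_def\<close>)
  have "UNIV \<in> \<S>"
    using \<tau> openin_topspace[of \<tau>] top[OF \<tau>] unfolding \<S>_def by auto
  then have top\<S>: "\<Union>\<S> = UNIV" by blast
  then have top\<gamma>: "topspace \<gamma> = UNIV" by (simp add: \<gamma>_def)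
  have id: "continuous_map \<gamma> \<sigma> id" if "mixed_candidate smul \<tau> \<sigma>" for \<sigma>
    using topology_finer_continuous_id[of \<sigma> \<gamma>] finer[OF that] top[OF that] top\<gamma> by auto
  have into: "continuous_map Z \<gamma> f"
    if "\<And>\<sigma>. mixed_candidate smul \<tau> \<sigma> \<Longrightarrow> continuous_map Z \<sigma> f" for Z :: "'z topology" and f
    unfolding \<gamma>_def
  proof (rule continuous_on_generated_topo)
    fix V assume "V \<in> \<S>"
    then obtain \<sigma> where "mixed_candidate smul \<tau> \<sigma>" "openin \<sigma> V" by (auto simp: \<S>_def)
    then show "openin Z (f -` V \<inter> topspace Z)"
      using that[of \<sigma>] unfolding continuous_map_alt by blast
  qed (simp add: top\<S>)
  have lin: "linear_topology smul \<gamma>"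
    unfolding linear_topology_def
  proof (intro conjI into)
    fix \<sigma> assume \<sigma>: "mixed_candidate smul \<tau> \<sigma>"
    then have *: "continuous_map (prod_topology \<sigma> \<sigma>) \<sigma> (\<lambda>(x, y). x + y)"
      "continuous_map (prod_topology euclidean \<sigma>) \<sigma> (\<lambda>(a, x). smul a x)"
      by (auto simp: mixed_candidate_def linear_topology_def)
    have "continuous_map (prod_topology \<gamma> \<gamma>) (prod_topology \<sigma> \<sigma>) (\<lambda>(x, y). (id x, id y))"
      unfolding continuous_map_prod_top using id[OF \<sigma>] by blast
    from continuous_map_compose[OF this *(1)]
    show "continuous_map (prod_topology \<gamma> \<gamma>) \<sigma> (\<lambda>(x, y). x + y)"
      by (simp add: o_def split_def)
    have "continuous_map (prod_topology (euclidean :: 'k topology) \<gamma>) (prod_topology euclidean \<sigma>)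
        (\<lambda>(a, x). (id a, id x))"
      unfolding continuous_map_prod_top using id[OF \<sigma>] by (simp add: id_def)
    from continuous_map_compose[OF this *(2)]
    show "continuous_map (prod_topology euclidean \<gamma>) \<sigma> (\<lambda>(a, x). smul a x)"
      by (simp add: o_def split_def)
  qed (rule top\<gamma>)
  have "subtopology \<gamma> N = subtopology \<tau> N" if N: "bounded N" for N
  proof -
    have "continuous_map (subtopology \<tau> N) \<gamma> id"
    proof (rule into)
      fix \<sigma> assume "mixed_candidate smul \<tau> \<sigma>"
      then have "subtopology \<sigma> N = subtopology \<tau> N"
        using N by (simp add: mixed_candidate_def)
      then show "continuous_map (subtopology \<tau> N) \<sigma> id"
        using continuous_map_from_subtopology[OF continuous_map_id, of \<sigma> N] by simp
    qed
    then have 1: "continuous_map (subtopology \<tau> N) (subtopology \<gamma> N) id"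
      by (simp add: continuous_map_in_subtopology)
    have 2: "continuous_map (subtopology \<gamma> N) (subtopology \<tau> N) id"
      using id[OF \<tau>] by (simp add: continuous_map_in_subtopology continuous_map_from_subtopology)
    have "topspace (subtopology \<gamma> N) = topspace (subtopology \<tau> N)"
      by (simp add: top\<gamma> top[OF \<tau>])
    note top_eq = this
    show ?thesis
      using topology_finer_continuous_id[OF top_eq] topology_finer_continuous_id[OF top_eq[symmetric]]
        1 2 unfolding topology_eq by blast
  qed
  moreover have "coarser_than \<gamma> euclidean"
  proof -
    have "continuous_map euclidean \<gamma> id"
    proof (rule into)
      fix \<sigma> assume \<sigma>: "mixed_candidate smul \<tau> \<sigma>"
      then have "\<forall>S. openin \<sigma> S \<longrightarrow> openin euclidean S"
        by (simp add: mixed_candidate_def coarser_than_def)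
      then show "continuous_map euclidean \<sigma> id"
        using topology_finer_continuous_id[of \<sigma> euclidean] top[OF \<sigma>] by auto
    qed
    then show ?thesis
      using topology_finer_continuous_id[of \<gamma> euclidean] top\<gamma> by (auto simp: coarser_than_def)
  qed
  ultimately have "mixed_candidate smul \<tau> \<gamma>"
    using lin finer[OF \<tau>] by (simp add: mixed_candidate_def coarser_than_def)
  then show ?thesis
    using finer by (intro ex1I[of _ \<gamma>]) (auto simp: coarser_than_def topology_eq)
qed

definition sequentially_complete ::
  "'x::real_normed_vector topology \<Rightarrow> bool" where
  "sequentially_complete \<gamma> \<longleftrightarrow>
     (\<forall>s :: nat \<Rightarrow> 'x.
        (\<forall>V. openin \<gamma> V \<and> 0 \<in> V \<longrightarrow> (\<exists>N. \<forall>m\<ge>N. \<forall>n\<ge>N. s m - s n \<in> V)) \<longrightarrow>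
        (\<exists>x. limitin \<gamma> s x sequentially))"

definition sequentially_open :: "'x topology \<Rightarrow> 'x set \<Rightarrow> bool" where
  "sequentially_open \<gamma> V \<longleftrightarrow>
     (\<forall>x\<in>V. \<forall>s :: nat \<Rightarrow> 'x. limitin \<gamma> s x sequentially \<longrightarrow> (\<forall>\<^sub>F n in sequentially. s n \<in> V))"

definition C_sequential :: "'x::real_normed_vector topology \<Rightarrow> bool" where
  "C_sequential \<gamma> \<longleftrightarrow> (\<forall>V. convex V \<and> sequentially_open \<gamma> V \<longrightarrow> openin \<gamma> V)"


section \<open>Bi-continuous semigroups\<close>

text \<open>Only the values \<open>S t\<close> with \<open>t \<ge> 0\<close> matter.\<close>

definition semigroup_ops ::
  "('k::real_or_complex \<Rightarrow> 'x::banach \<Rightarrow> 'x) \<Rightarrow> (real \<Rightarrow> 'x \<Rightarrow> 'x) \<Rightarrow> bool" where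
  "semigroup_ops smul S \<longleftrightarrow>
     (\<forall>t\<ge>0. S t \<in> bounded_ops smul smul) \<and> S 0 = id \<and>
     (\<forall>t\<ge>0. \<forall>s\<ge>0. S (t + s) = S t \<circ> S s)"

definition locally_bicontinuous ::
  "('k::real_or_complex \<Rightarrow> 'x::banach \<Rightarrow> 'x) \<Rightarrow> 'x topology \<Rightarrow> (real \<Rightarrow> 'x \<Rightarrow> 'x) \<Rightarrow> bool" where
  "locally_bicontinuous smul \<tau> S \<longleftrightarrow>
     semigroup_ops smul S \<and>
     (\<exists>M\<ge>1. \<exists>\<omega>. \<forall>t\<ge>0. onorm (S t) \<le> M * exp (\<omega> * t)) \<and>
     (\<forall>x. continuous_map (top_of_set {0..}) \<tau> (\<lambda>t. S t x)) \<and>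
     (\<forall>(s :: nat \<Rightarrow> 'x) x. bounded (range s) \<and> limitin \<tau> s x sequentially \<longrightarrow>
        (\<forall>t\<^sub>0\<ge>0. \<forall>V. openin \<tau> V \<and> 0 \<in> V \<longrightarrow>
           (\<forall>\<^sub>F n in sequentially. \<forall>t\<in>{0..t\<^sub>0}. S t (s n - x) \<in> V)))"

text \<open>\<open>(-A, D)\<close> is the generator of \<open>S\<close>; the values of \<open>A\<close> outside \<open>D\<close> are irrelevant.\<close>

definition has_generator ::
  "'x::banach topology \<Rightarrow> (real \<Rightarrow> 'x \<Rightarrow> 'x) \<Rightarrow> ('x \<Rightarrow> 'x) \<Rightarrow> 'x set \<Rightarrow> bool" where
  "has_generator \<tau> S A D \<longleftrightarrow>
     D = {x. (\<exists>y. limitin \<tau> (\<lambda>t. (S t x - x) /\<^sub>R t) y (at_right 0)) \<and>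
             bdd_above ((\<lambda>t. norm (S t x - x) / t) ` {0<..1})} \<and>
     (\<forall>x\<in>D. limitin \<tau> (\<lambda>t. (S t x - x) /\<^sub>R t) (- A x) (at_right 0))"


section \<open>Duality\<close>

text \<open>The norm on the following space is \<^const>\<open>onorm\<close>. The operators dual to \<open>S t\<close> and \<open>B\<close> act on
  it by \<open>f \<mapsto> f \<circ> S t\<close> and \<open>f \<mapsto> f \<circ> B\<close>.\<close>

definition circ_dual ::
  "('k::real_or_complex \<Rightarrow> 'x::banach \<Rightarrow> 'x) \<Rightarrow> 'x topology \<Rightarrow> ('x \<Rightarrow> 'k) set" where
  "circ_dual smul \<tau> =
     {f \<in> top_dual smul euclidean.
        \<forall>N. bounded N \<longrightarrow>
          (\<forall>(s :: nat \<Rightarrow> 'x) x. range s \<subseteq> N \<and> x \<in> N \<and> limitin \<tau> s x sequentially \<longrightarrow>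
             (\<lambda>n. f (s n)) \<longlonglongrightarrow> f x)}"

definition circ_op :: "('x \<Rightarrow> 'y) \<Rightarrow> ('y \<Rightarrow> 'k) \<Rightarrow> 'x \<Rightarrow> 'k" where
  "circ_op F f = f \<circ> F"

definition dual_difference_limit ::
  "(real \<Rightarrow> 'x::banach \<Rightarrow> 'x) \<Rightarrow> ('x \<Rightarrow> 'k::real_or_complex) \<Rightarrow> ('x \<Rightarrow> 'k) \<Rightarrow> bool" where
  "dual_difference_limit S f g \<longleftrightarrow>
     (\<forall>K. compact K \<longrightarrow>
        uniform_limit K (\<lambda>t x. (circ_op (S t) f x - f x) /\<^sub>R t) g (at_right 0))"

definition has_dual_generator ::
  "('k::real_or_complex \<Rightarrow> 'x::banach \<Rightarrow> 'x) \<Rightarrow> 'x topology \<Rightarrow> (real \<Rightarrow> 'x \<Rightarrow> 'x) \<Rightarrow>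
   (('x \<Rightarrow> 'k) \<Rightarrow> 'x \<Rightarrow> 'k) \<Rightarrow> ('x \<Rightarrow> 'k) set \<Rightarrow> bool" where
  "has_dual_generator smul \<tau> S A' D' \<longleftrightarrow>
     D' = {f \<in> circ_dual smul \<tau>. \<exists>g \<in> circ_dual smul \<tau>. dual_difference_limit S f g} \<and>
     (\<forall>f\<in>D'. (\<lambda>x. - A' f x) \<in> circ_dual smul \<tau> \<and> dual_difference_limit S f (\<lambda>x. - A' f x))"


section \<open>Control and observation systems\<close>

text \<open>A control on \<open>[0, T]\<close> is represented by a function on the whole real line; its values outside
  \<open>[0, T]\<close> never matter.\<close>

definition controls :: "'u::banach topology \<Rightarrow> real \<Rightarrow> (real \<Rightarrow> 'u) set" where
  "controls \<tau> T = {u. continuous_map (top_of_set {0..T}) \<tau> u \<and> bounded (u ` {0..T})}"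

definition control_norm :: "real \<Rightarrow> (real \<Rightarrow> 'u::banach) \<Rightarrow> real" where
  "control_norm T u = (SUP t\<in>{0..T}. norm (u t))"

definition has_pettis_integral ::
  "('k::real_or_complex \<Rightarrow> 'x::banach \<Rightarrow> 'x) \<Rightarrow> 'x topology \<Rightarrow> real set \<Rightarrow> (real \<Rightarrow> 'x) \<Rightarrow> 'x \<Rightarrow> bool"
  where
  "has_pettis_integral smul \<tau> \<Omega> g x \<longleftrightarrow>
     (\<forall>f \<in> top_dual smul \<tau>.
        set_integrable lborel \<Omega> (\<lambda>t. f (g t)) \<and> f x = (LINT t:\<Omega>|lborel. f (g t)))"

definition pettis_integral ::
  "('k::real_or_complex \<Rightarrow> 'x::banach \<Rightarrow> 'x) \<Rightarrow> 'x topology \<Rightarrow> real set \<Rightarrow> (real \<Rightarrow> 'x) \<Rightarrow> 'x" where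
  "pettis_integral smul \<tau> \<Omega> g = (THE x. has_pettis_integral smul \<tau> \<Omega> g x)"

definition mild_solution ::
  "('k::real_or_complex \<Rightarrow> 'x::banach \<Rightarrow> 'x) \<Rightarrow> 'x topology \<Rightarrow> (real \<Rightarrow> 'x \<Rightarrow> 'x) \<Rightarrow>
   ('u::banach \<Rightarrow> 'x) \<Rightarrow> 'x \<Rightarrow> (real \<Rightarrow> 'u) \<Rightarrow> real \<Rightarrow> 'x" where
  "mild_solution smul \<tau> S B x\<^sub>0 u t =
     S t x\<^sub>0 + pettis_integral smul \<tau> {0..t} (\<lambda>r. S (t - r) (B (u r)))"

definition input_map ::
  "('k::real_or_complex \<Rightarrow> 'x::banach \<Rightarrow> 'x) \<Rightarrow> 'x topology \<Rightarrow> (real \<Rightarrow> 'x \<Rightarrow> 'x) \<Rightarrow>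
   ('u::banach \<Rightarrow> 'x) \<Rightarrow> real \<Rightarrow> (real \<Rightarrow> 'u) \<Rightarrow> 'x" where
  "input_map smul \<tau> S B T u = pettis_integral smul \<tau> {0..T} (\<lambda>t. S (T - t) (B (u t)))"

definition cost_uniform_approx_null_controllable ::
  "('k::real_or_complex \<Rightarrow> 'x::banach \<Rightarrow> 'x) \<Rightarrow> 'x topology \<Rightarrow> ('x \<Rightarrow> real) set \<Rightarrow>
   'u::banach topology \<Rightarrow> (real \<Rightarrow> 'x \<Rightarrow> 'x) \<Rightarrow> ('u \<Rightarrow> 'x) \<Rightarrow> real \<Rightarrow> bool" where
  "cost_uniform_approx_null_controllable smul \<tau>X P \<tau>U S B T \<longleftrightarrow>
     (\<exists>C\<ge>0. \<forall>x\<^sub>0. \<forall>\<epsilon>>0. \<forall>p\<in>P. \<exists>u\<in>controls \<tau>U T.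
        control_norm T u \<le> C * norm x\<^sub>0 \<and> p (mild_solution smul \<tau>X S B x\<^sub>0 u T) \<le> \<epsilon>)"

text \<open>The norm on the dual of the control space with the topology \<open>\<gamma>\<^sub>\<infinity>\<close> only involves the unit ball of the
  supremum norm. As the supremum is not known to be finite in advance, it is taken in
  \<^typ>\<open>ennreal\<close>.\<close>

definition control_dual_norm ::
  "'u::banach topology \<Rightarrow> real \<Rightarrow> ((real \<Rightarrow> 'u) \<Rightarrow> 'k::real_or_complex) \<Rightarrow> ennreal" where
  "control_dual_norm \<tau> T y = (SUP u\<in>{u \<in> controls \<tau> T. control_norm T u \<le> 1}. ennreal (norm (y u)))"

definition final_state_observable ::
  "('k::real_or_complex \<Rightarrow> 'x::banach \<Rightarrow> 'x) \<Rightarrow> 'x topology \<Rightarrow> 'u::banach topology \<Rightarrow>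
   (real \<Rightarrow> 'x \<Rightarrow> 'x) \<Rightarrow> ('u \<Rightarrow> 'x) \<Rightarrow> real \<Rightarrow> bool" where
  "final_state_observable smul \<tau>X \<tau>U S B T \<longleftrightarrow>
     (\<exists>C\<ge>0. \<forall>f\<in>circ_dual smul \<tau>X.
        ennreal (onorm (circ_op (S T) f))
          \<le> ennreal C * control_dual_norm \<tau>U T (circ_op (input_map smul \<tau>X S B T) f))"


section \<open>Vector measures\<close>

definition observation_measure ::
  "(real \<Rightarrow> 'x::banach \<Rightarrow> 'x) \<Rightarrow> ('u::banach \<Rightarrow> 'x) \<Rightarrow> ('x \<Rightarrow> 'k::real_or_complex) \<Rightarrow>
   real set \<Rightarrow> 'u \<Rightarrow> 'k" where
  "observation_measure S B f N u = (LINT t:N|lborel. circ_op B (circ_op (S t) f) u)"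

definition semivariation ::
  "real \<Rightarrow> (real set \<Rightarrow> 'u::banach \<Rightarrow> 'k::real_or_complex) \<Rightarrow> ennreal" where
  "semivariation T \<nu> =
     (SUP (\<P>, w)\<in>{(\<P>, w). finite \<P> \<and> partition_on {0..T} \<P> \<and> \<P> \<subseteq> sets borel \<and>
                        (\<forall>N\<in>\<P>. norm (w N) \<le> 1)}.
        ennreal (norm (\<Sum>N\<in>\<P>. \<nu> N (w N))))"

end

theory Submission
  imports Defs
begin

text \<open>For a control \<open>u\<close> the integrand \<open>S (T - t) (B (u t))\<close> is \<open>\<tau>X\<close>-continuous and bounded, so its Riemann
  sums are bounded and \<open>\<tau>X\<close>-Cauchy, hence Cauchy for the mixed topology, and sequential completeness
  yields the Pettis integral; every \<open>f \<in> X\<^sup>\<circ>\<close> commutes with it.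

  Observability gives controllability by separating \<open>- S T x\<close> from the convex balanced set of states
  reached by controls of norm at most \<open>(2 C + 1) \<parallel>x\<parallel>\<close>. Conversely, the C-sequential property makes
  each \<open>f \<in> X\<^sup>\<circ>\<close> small on \<open>{z. p z < d \<and> \<parallel>z\<parallel> \<le> R}\<close> for some \<open>p\<close> and \<open>d\<close>, because sequences
  converging in the mixed topology are norm bounded; testing \<open>f\<close> on approximately annihilated final
  states then gives the estimate.

  If \<open>\<tau>U\<close> is the norm topology, the dual norm and the semivariation coincide: continuous controls are
  uniform limits of step functions, and Borel step functions agree with continuous functions of norm
  at most one off sets of small measure.\<close>


section \<open>The Hahn-Banach theorem\<close>

text \<open>Controllability supplies one control for each seminorm and tolerance, so the final
  states form a net, while a functional in \<open>circ_dual\<close> is only known to respect bounded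
  sequences; C-sequentiality has to close this gap. Behind it stands the question how a limit in the
  mixed topology can be controlled at all, since that topology is given only as the finest of its
  candidates. The way in is to exhibit a candidate that is fine enough, here one built from a
  weighted supremum of norming functionals. In the other direction no such problem arises, because
  the separating functional already lies in the \<tau>-dual. The 2 in \<open>2 C + 1\<close> is the
  price of passing from a real functional to one over the scalar field, whose norm is bounded by two
  real values; the summand 1 makes the final inequality contradictory.\<close>

definition sublinear :: "('a::real_vector \<Rightarrow> real) \<Rightarrow> bool" where
  "sublinear q \<longleftrightarrow> (\<forall>x y. q (x + y) \<le> q x + q y) \<and> (\<forall>x. \<forall>t\<ge>0. q (t *\<^sub>R x) = t * q x)"

text \<open>The inequality at \<open>inverse t\<close>, applied to \<open>t *\<^sub>R x\<close>, is
  the converse of the one at \<open>t\<close>, so functionals defined as infima need a check in one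
  direction only.\<close>

lemma sublinearI:
  assumes add: "\<And>x y. q (x + y) \<le> q x + q y"
    and scale: "\<And>t x. t > 0 \<Longrightarrow> q (t *\<^sub>R x) \<le> t * q x"
  shows "sublinear q"
proof -
  \<comment> \<open>The factors 2 and 1/2 give \<open>q 0 \<le> 2 * q 0\<close> and
    \<open>q 0 \<le> q 0 / 2\<close>, which exclude both signs.\<close>
  have "q 0 = 0"
    using scale[of 2 0] scale[of "1/2" 0] by simp
  moreover have "q (t *\<^sub>R x) = t * q x" if "t > 0" for t x
  proof (rule antisym)
    have "t * q x \<le> t * (inverse t * q (t *\<^sub>R x))"
      using scale[of "inverse t" "t *\<^sub>R x"] that by (intro mult_left_mono) auto
    then show "t * q x \<le> q (t *\<^sub>R x)" using that by (simp add: field_simps)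
  qed (rule scale[OF that])
  ultimately show ?thesis
    unfolding sublinear_def using add by (metis less_eq_real_def mult_zero_left scaleR_zero_left)
qed

lemma sublinear_add: "sublinear q \<Longrightarrow> q (x + y) \<le> q x + q y"
  by (simp add: sublinear_def)

lemma sublinear_scaleR: "sublinear q \<Longrightarrow> t \<ge> 0 \<Longrightarrow> q (t *\<^sub>R x) = t * q x"
  by (simp add: sublinear_def)

lemma sublinear_zero: "sublinear q \<Longrightarrow> q 0 = 0"
  using sublinear_scaleR[of q 0 0] by simp

lemma sublinear_lower_bound: "sublinear q \<Longrightarrow> - q (- x) \<le> q x"
  using sublinear_add[of q x "- x"] sublinear_zero[of q] by simp

text \<open>Minimizing \<open>q (x + t *\<^sub>R a) - t * q a\<close> over \<open>t \<ge> 0\<close>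
  lowers \<open>q\<close> as far as the direction \<open>a\<close> permits. If \<open>q\<close> is
  minimal, then \<open>r = q\<close> and the last inequality becomes superadditivity in direction
  \<open>a\<close>; at \<open>x = - a\<close> it reads \<open>r (- a) \<le> - q a\<close>.\<close>

lemma sublinear_minorant:
  assumes q: "sublinear q"
  obtains r where "sublinear r" "\<And>x. r x \<le> q x" "\<And>x. r x \<le> q (x + a) - q a"
proof
  define r where "r x = (INF t\<in>{0..}. q (x + t *\<^sub>R a) - t * q a)" for x
  have "- q (- x) \<le> q (x + t *\<^sub>R a) - t * q a" if "t \<ge> 0" for x t
    using sublinear_add[OF q, of "x + t *\<^sub>R a" "- x"] sublinear_scaleR[OF q that, of a] by simp
  then have bdd: "bdd_below ((\<lambda>t. q (x + t *\<^sub>R a) - t * q a) ` {0..})" for x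
    by (intro bdd_belowI2[of _ "- q (- x)"]) auto
  have le: "r x \<le> q (x + t *\<^sub>R a) - t * q a" if "t \<ge> 0" for x t
    unfolding r_def by (rule cINF_lower[OF bdd]) (use that in auto)
  have ge: "c \<le> r x" if "\<And>t. t \<ge> 0 \<Longrightarrow> c \<le> q (x + t *\<^sub>R a) - t * q a" for c x
    unfolding r_def by (rule cINF_greatest) (use that in auto)
  show "r x \<le> q x" for x using le[of 0 x] by simp
  show "r x \<le> q (x + a) - q a" for x using le[of 1 x] by simp
  show "sublinear r"
  proof (rule sublinearI)
    fix x y
    have "r (x + y) - r y \<le> r x"
    proof (rule ge)
      fix s :: real assume s: "s \<ge> 0"
      have "r (x + y) - (q (x + s *\<^sub>R a) - s * q a) \<le> r y"
      proof (rule ge)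
        fix t :: real assume t: "t \<ge> 0"
        have "r (x + y) \<le> q (x + y + (s + t) *\<^sub>R a) - (s + t) * q a"
          using s t by (intro le) simp
        also have "x + y + (s + t) *\<^sub>R a = (x + s *\<^sub>R a) + (y + t *\<^sub>R a)"
          by (simp add: algebra_simps)
        finally show "r (x + y) - (q (x + s *\<^sub>R a) - s * q a) \<le> q (y + t *\<^sub>R a) - t * q a"
          using sublinear_add[OF q, of "x + s *\<^sub>R a" "y + t *\<^sub>R a"] by (simp add: algebra_simps)
      qed
      then show "r (x + y) - r y \<le> q (x + s *\<^sub>R a) - s * q a" by simp
    qed
    then show "r (x + y) \<le> r x + r y" by simp
  next
    fix t :: real and x assume t: "t > 0"
    have "r (t *\<^sub>R x) / t \<le> r x"
    proof (rule ge)
      fix s :: real assume s: "s \<ge> 0"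
      have "r (t *\<^sub>R x) \<le> q (t *\<^sub>R (x + s *\<^sub>R a)) - (t * s) * q a"
        using le[of "t * s" "t *\<^sub>R x"] s t by (simp add: scaleR_add_right)
      also have "\<dots> = t * (q (x + s *\<^sub>R a) - s * q a)"
        using sublinear_scaleR[OF q, of t "x + s *\<^sub>R a"] t by (simp add: right_diff_distrib)
      finally show "r (t *\<^sub>R x) / t \<le> q (x + s *\<^sub>R a) - s * q a"
        using t by (simp add: field_simps)
    qed
    then show "r (t *\<^sub>R x) \<le> t * r x" using t by (simp add: field_simps)
  qed
qed

text \<open>Zorn's lemma for the reversed pointwise order. A nonempty chain is bounded by its
  pointwise infimum, which is finite because every sublinear \<open>c \<le> q\<close> satisfies
  \<open>- q (- x) \<le> c x\<close>.\<close>

lemma minimal_sublinear_exists: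
  fixes q :: "'a::real_vector \<Rightarrow> real"
  assumes q: "sublinear q"
  obtains f where "sublinear f" "f \<le> q" "\<And>r. sublinear r \<Longrightarrow> r \<le> f \<Longrightarrow> r = f"
proof -
  define Q where "Q = {r :: 'a \<Rightarrow> real. sublinear r \<and> r \<le> q}"
  have "\<exists>m\<in>Q. \<forall>r\<in>Q. m \<ge> r \<longrightarrow> r = m"
  proof (rule predicate_Zorn)
    show "partial_order_on Q (relation_of (\<ge>) Q)"
      by (rule partial_order_on_relation_ofI) auto
  next
    fix C assume "C \<in> Chains (relation_of (\<ge>) Q)"
    then have C: "C \<subseteq> Q" and chain: "\<And>c d. c \<in> C \<Longrightarrow> d \<in> C \<Longrightarrow> c \<le> d \<or> d \<le> c"
      by (auto simp: Chains_def relation_of_def)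
    show "\<exists>u\<in>Q. \<forall>c\<in>C. c \<ge> u"
    proof (cases "C = {}")
      case True
      then show ?thesis using q by (auto simp: Q_def)
    next
      case False
      define u where "u x = (INF c\<in>C. c x)" for x
      have "- q (- x) \<le> c x" if "c \<in> C" for c x
      proof -
        have "sublinear c" "c (- x) \<le> q (- x)" using that C by (auto simp: Q_def le_fun_def)
        then show ?thesis using sublinear_lower_bound[of c x] by simp
      qed
      then have bdd: "bdd_below ((\<lambda>c. c x) ` C)" for x
        by (intro bdd_belowI2[of _ "- q (- x)"])
      have le: "u x \<le> c x" if "c \<in> C" for c x
        unfolding u_def by (rule cINF_lower[OF bdd that])
      have ge: "b \<le> u x" if "\<And>c. c \<in> C \<Longrightarrow> b \<le> c x" for b x
        unfolding u_def by (rule cINF_greatest[OF False that])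
      have "sublinear u"
      proof (rule sublinearI)
        fix x y
        have "u (x + y) - u y \<le> u x"
        proof (rule ge)
          fix c assume c: "c \<in> C"
          have "u (x + y) - c x \<le> u y"
          proof (rule ge)
            fix d assume d: "d \<in> C"
            \<comment> \<open>The two infima run over \<open>c\<close> and \<open>d\<close>
              independently; comparability in the chain gives one member below both.\<close>
            obtain e where e: "e \<in> C" "e \<le> c" "e \<le> d" using chain[OF c d] c d by blast
            then have "e (x + y) \<le> e x + e y" using C by (auto simp: Q_def sublinear_def)
            moreover have "e x \<le> c x" "e y \<le> d y" using e by (auto simp: le_fun_def)
            ultimately show "u (x + y) - c x \<le> d y" using le[OF e(1), of "x + y"] by simp
          qed
          then show "u (x + y) - u y \<le> c x" by simp
        qed
        then show "u (x + y) \<le> u x + u y" by simp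
      next
        fix t :: real and x assume t: "t > 0"
        have "u (t *\<^sub>R x) / t \<le> u x"
        proof (rule ge)
          fix c assume c: "c \<in> C"
          then have "c (t *\<^sub>R x) = t * c x" using C t by (auto simp: Q_def sublinear_def)
          then show "u (t *\<^sub>R x) / t \<le> c x" using le[OF c, of "t *\<^sub>R x"] t by (simp add: field_simps)
        qed
        then show "u (t *\<^sub>R x) \<le> t * u x" using t by (simp add: field_simps)
      qed
      moreover obtain c where c: "c \<in> C" using False by blast
      then have "u \<le> c" "c \<le> q" using le C by (auto simp: le_fun_def Q_def)
      then have "u \<le> q" by (rule order_trans)
      ultimately show ?thesis using le by (auto simp: Q_def le_fun_def)
    qed
  qed
  then obtain m where m: "m \<in> Q" "\<And>r. r \<in> Q \<Longrightarrow> r \<le> m \<Longrightarrow> r = m" by blast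
  show ?thesis
  proof
    show "sublinear m" "m \<le> q" using m(1) by (auto simp: Q_def)
    then show "r = m" if "sublinear r" "r \<le> m" for r
      using that m(2)[of r] order_trans[of r m q] by (simp add: Q_def)
  qed
qed

text \<open>A minimal sublinear functional equals each minorant that
  \<open>sublinear_minorant\<close> produces from it, hence is additive, and additivity settles
  negative factors. The preliminary minorant step at \<open>z\<close> forces
  \<open>f (- z) \<le> - q z\<close>, so that the bound is attained at \<open>z\<close>.\<close>

theorem sublinear_Hahn_Banach:
  fixes q :: "'a::real_vector \<Rightarrow> real"
  assumes q: "sublinear q"
  obtains f where "linear f" "\<And>x. f x \<le> q x" "f z = q z"
proof -
  obtain r where r: "sublinear r" "\<And>x. r x \<le> q x" "\<And>x. r x \<le> q (x + z) - q z"
    using sublinear_minorant[OF q] by blast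
  obtain f where f: "sublinear f" "f \<le> r" and min: "\<And>r. sublinear r \<Longrightarrow> r \<le> f \<Longrightarrow> r = f"
    using minimal_sublinear_exists[OF r(1)] by blast
  have add: "f (x + y) = f x + f y" for x y
  proof (rule antisym)
    obtain s where s: "sublinear s" "\<And>x. s x \<le> f x" "\<And>x. s x \<le> f (x + y) - f y"
      using sublinear_minorant[OF f(1)] by blast
    then have "s = f" by (intro min) (auto simp: le_fun_def)
    then show "f x + f y \<le> f (x + y)" using s(3)[of x] by simp
  qed (rule sublinear_add[OF f(1)])
  have neg: "f (- x) = - f x" for x
    using add[of x "- x"] sublinear_zero[OF f(1)] by simp
  have "f (t *\<^sub>R x) = t * f x" for t x
  proof (cases "t \<ge> 0")
    case False
    then have "f ((- t) *\<^sub>R x) = (- t) * f x" by (intro sublinear_scaleR[OF f(1)]) simp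
    then show ?thesis using neg[of "t *\<^sub>R x"] by simp
  qed (rule sublinear_scaleR[OF f(1)])
  with add have "linear f" by (intro linearI) auto
  moreover have le: "f x \<le> q x" for x
    using f(2) r(2) by (meson le_fun_def order_trans)
  moreover have "f z = q z"
  proof (rule antisym[OF le])
    have "f (- z) \<le> r (- z)" using f(2) by (simp add: le_fun_def)
    also have "\<dots> \<le> - q z" using r(3)[of "- z"] sublinear_zero[OF q] by simp
    finally show "q z \<le> f z" using neg[of z] by simp
  qed
  ultimately show ?thesis using that by blast
qed

section \<open>Topologies induced by seminorms\<close>

lemma bounded_linear_if_continuous:
  fixes f :: "'a::real_normed_vector \<Rightarrow> 'b::real_normed_vector"
  assumes "linear f" "continuous_on UNIV f"
  shows "bounded_linear f"
proof -
  interpret f: linear f by fact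
  obtain d where d: "d > 0" "\<And>x. norm x < d \<Longrightarrow> norm (f x) < 1"
    using assms(2) unfolding continuous_on_iff by (metis UNIV_I dist_0_norm f.zero zero_less_one dist_commute)
  show ?thesis
  proof (rule bounded_linear_intro[where K = "2 / d"])
    fix x
    show "norm (f x) \<le> norm x * (2 / d)"
    proof (cases "x = 0")
      case False
      define c where "c = d / (2 * norm x)"
      have c: "c > 0" using d False by (simp add: c_def)
      have "norm (c *\<^sub>R x) < d" using d False by (simp add: c_def)
      then have "norm (c *\<^sub>R f x) < 1" using d(2) f.scaleR by metis
      then have "c * norm (f x) < 1" using c by simp
      then show ?thesis using d False by (simp add: c_def field_simps)
    qed simp
  qed (auto simp: f.add f.scaleR)
qed

section \<open>Linearity over the scalar field and over the reals\<close>

lemma (in normed_space_over) linear_iff_field: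
  "Vector_Spaces.linear smul (*) f \<longleftrightarrow>
     (\<forall>x y. f (x + y) = f x + f y) \<and> (\<forall>a x. f (smul a x) = a * f x)"
  unfolding Vector_Spaces.linear_iff
  using vector_space_axioms vector_space_over_itself.vector_space_axioms by blast

lemma linear_over_imp_linear:
  assumes "normed_space_over s1" "normed_space_over s2" "Vector_Spaces.linear s1 s2 f"
  shows "linear f"
proof (rule linearI)
  fix x y r
  show "f (x + y) = f x + f y" using assms(3) unfolding Vector_Spaces.linear_iff by metis
  show "f (r *\<^sub>R x) = r *\<^sub>R f x"
    using assms(3) normed_space_over.smul_of_real[OF assms(1), of r x]
      normed_space_over.smul_of_real[OF assms(2), of r "f x"]
    unfolding Vector_Spaces.linear_iff by metis
qed

text \<open>Functionals are maps into the field; viewing it as a normed space over itself makes the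
  passage to real linearity apply to them.\<close>

lemma normed_space_over_field: "normed_space_over ((*) :: 'k::real_or_complex \<Rightarrow> 'k \<Rightarrow> 'k)"
  by unfold_locales (auto simp: norm_mult scaleR_conv_of_real algebra_simps)

lemma (in normed_space_over) linear_functional_imp_linear:
  "Vector_Spaces.linear smul (*) f \<Longrightarrow> linear f"
  by (rule linear_over_imp_linear[OF normed_space_over_axioms normed_space_over_field])

text \<open>In the complex case \<open>F\<close> is \<open>f x - f (j x) j\<close> with
  \<open>j\<close> a square root of -1; in the real case \<open>F\<close> is \<open>f\<close> and
  \<open>j\<close> is 1. The two norm bounds cover both, so that no later argument distinguishes the
  scalar fields.\<close>

lemma (in normed_space_over) functional_over_field_exists:
  fixes f :: "'x \<Rightarrow> real"
  assumes "linear f"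
  obtains F j where "Vector_Spaces.linear smul (*) F" "norm j = 1"
    "\<And>x. \<bar>f x\<bar> \<le> norm (F x)" "\<And>x. norm (F x) \<le> \<bar>f x\<bar> + \<bar>f (smul j x)\<bar>"
proof -
  interpret f: linear f by fact
  obtain h :: "'k \<Rightarrow> complex" where h: "\<And>a b. h (a + b) = h a + h b"
    "\<And>a b. h (a * b) = h a * h b" "\<And>r. h (r *\<^sub>R 1) = of_real r" "\<And>a. norm (h a) = norm a"
    and range: "range h = \<real> \<or> range h = UNIV"
    using real_or_complex_embedding by blast
  have h_real: "h (of_real r) = of_real r" for r by (simp add: h(3) of_real_def)
  have h_inj: "a = b" if "h a = h b" for a b
  proof -
    have "h (a - b) = h a - h b" using h(1)[of "a - b" b] by (simp add: algebra_simps)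
    then show ?thesis using that h(4)[of "a - b"] by simp
  qed
  from range show ?thesis
  proof
    assume R: "range h = \<real>"
    have real: "\<exists>r. a = of_real r" for a :: 'k
    proof -
      have "h a \<in> \<real>" using R by blast
      then obtain r where "h a = of_real r" by (auto elim: Reals_cases)
      then show ?thesis using h_real[of r] h_inj by metis
    qed
    show ?thesis
    proof (rule that[of "\<lambda>x. of_real (f x)" 1])
      show "Vector_Spaces.linear smul (*) (\<lambda>x. of_real (f x))"
        unfolding linear_iff_field
      proof (intro conjI allI)
        fix a :: 'k and x
        obtain r where "a = of_real r" using real by blast
        then show "of_real (f (smul a x)) = a * of_real (f x)"
          by (simp add: smul_of_real f.scaleR)
      qed (simp add: f.add)
    qed auto
  next
    assume R: "range h = UNIV"
    then obtain j where j: "h j = \<i>" by (metis UNIV_I imageE)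
    have jj: "j * j = - 1"
    proof (rule h_inj)
      show "h (j * j) = h (- 1)"
        using h_real[of "- 1"] by (simp add: h(2) j)
    qed
    have norm_j: "norm j = 1" using h(4)[of j] j by simp
    have split: "\<exists>r s. a = of_real r + of_real s * j" for a :: 'k
    proof -
      have "h a = h (of_real (Re (h a)) + of_real (Im (h a)) * j)"
        by (simp add: h(1,2) h_real j complex_eq_iff)
      then show ?thesis using h_inj by blast
    qed
    define F :: "'x \<Rightarrow> 'k" where "F x = of_real (f x) + of_real (- f (smul j x)) * j" for x
    show ?thesis
    proof
      show "Vector_Spaces.linear smul (*) F"
        unfolding linear_iff_field
      proof (intro conjI allI)
        show "F (x + y) = F x + F y" for x y
          by (simp add: F_def f.add scale_right_distrib algebra_simps)
        fix a :: 'k and x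
        obtain r s where a: "a = of_real r + of_real s * j" using split by blast
        have ax: "smul a x = r *\<^sub>R x + s *\<^sub>R smul j x"
          by (simp add: a scale_left_distrib smul_of_real flip: scale_scale)
        have "smul j (smul a x) = smul (a * j) x" by (simp add: mult.commute)
        also have "a * j = of_real (- s) + of_real r * j"
          using jj by (simp add: a distrib_right mult.assoc)
        finally have jax: "smul j (smul a x) = (- s) *\<^sub>R x + r *\<^sub>R smul j x"
          by (simp add: scale_left_distrib smul_of_real flip: scale_scale of_real_minus)
        have "F (smul a x) = of_real (r * f x + s * f (smul j x)) + of_real (s * f x - r * f (smul j x)) * j"
          unfolding F_def jax unfolding ax by (simp add: f.add f.scaleR f.diff)
        also have "\<dots> = of_real r * of_real (f x) - (of_real r * of_real (f (smul j x))) * j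
            + of_real s * of_real (f x) * j - of_real s * of_real (f (smul j x)) * (j * j)"
          by (simp add: jj distrib_right left_diff_distrib)
        also have "\<dots> = a * F x"
          unfolding F_def a by (simp add: algebra_simps)
        finally show "F (smul a x) = a * F x" .
      qed
      show "norm j = 1" by (rule norm_j)
      show "\<bar>f x\<bar> \<le> norm (F x)" for x
      proof -
        have "h (F x) = of_real (f x) + of_real (- f (smul j x)) * \<i>"
          by (simp only: F_def h(1,2) h_real j)
        then have "Re (h (F x)) = f x" by simp
        then show ?thesis using abs_Re_le_cmod[of "h (F x)"] by (simp add: h(4))
      qed
      show "norm (F x) \<le> \<bar>f x\<bar> + \<bar>f (smul j x)\<bar>" for x
        using norm_triangle_ineq[of "of_real (f x) :: 'k" "of_real (- f (smul j x)) * j"]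
        by (simp add: F_def norm_mult norm_j)
    qed
  qed
qed

section \<open>Calculus of seminorms and of the topology given by a directed system\<close>

lemma (in normed_space_over) seminorm_onD:
  assumes "seminorm_on smul p"
  shows seminorm_add: "p (x + y) \<le> p x + p y"
    and seminorm_smul: "p (smul a x) = norm a * p x"
    and seminorm_scaleR: "p (r *\<^sub>R x) = \<bar>r\<bar> * p x"
    and seminorm_zero: "p 0 = 0"
    and seminorm_minus: "p (- x) = p x"
    and seminorm_diff_commute: "p (x - y) = p (y - x)"
    and seminorm_nonneg: "0 \<le> p x"
    and seminorm_triangle: "p (x - z) \<le> p (x - y) + p (y - z)"
proof -
  show add: "p (x + y) \<le> p x + p y" for x y
    using assms by (simp add: seminorm_on_def)
  show smul: "p (smul a x) = norm a * p x" for a x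
    using assms by (auto simp: seminorm_on_def)
  show scaleR: "p (r *\<^sub>R x) = \<bar>r\<bar> * p x" for r x
    using smul[of "of_real r" x] by (simp add: smul_of_real)
  show zero: "p 0 = 0" using scaleR[of 0 0] by simp
  show minus: "p (- x) = p x" for x using scaleR[of "-1" x] by simp
  show "p (x - y) = p (y - x)" using minus[of "x - y"] by simp
  show "0 \<le> p x" using add[of x "- x"] by (simp add: zero minus)
  show "p (x - z) \<le> p (x - y) + p (y - z)" using add[of "x - y" "y - z"] by simp
qed

locale seminorm_topology = normed_space_over smul
  for smul :: "'k::real_or_complex \<Rightarrow> 'x::real_normed_vector \<Rightarrow> 'x" +
  fixes P :: "('x \<Rightarrow> real) set" and \<tau> :: "'x topology"
  assumes inducing: "directed_seminorms_inducing smul P \<tau>"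
begin

lemma seminorm: "p \<in> P \<Longrightarrow> seminorm_on smul p"
  using inducing by (simp add: directed_seminorms_inducing_def)

lemma openin_iff: "openin \<tau> V \<longleftrightarrow> (\<forall>x\<in>V. \<exists>p\<in>P. \<exists>e>0. {y. p (y - x) < e} \<subseteq> V)"
  using inducing by (simp add: directed_seminorms_inducing_def)

lemma openin_seminorm_ball:
  assumes p: "p \<in> P"
  shows "openin \<tau> {y. p (y - x) < e}"
  unfolding openin_iff
proof
  fix y assume y: "y \<in> {y. p (y - x) < e}"
  have "{z. p (z - y) < e - p (y - x)} \<subseteq> {z. p (z - x) < e}"
    using seminorm_triangle[OF seminorm[OF p], of _ x y] by (auto simp: less_diff_eq intro: order.strict_trans1)
  then show "\<exists>q\<in>P. \<exists>d>0. {z. q (z - y) < d} \<subseteq> {y. p (y - x) < e}"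
    using p y by (metis diff_gt_0_iff_gt mem_Collect_eq)
qed

lemma topspace_eq: "topspace \<tau> = UNIV"
proof -
  obtain p where "p \<in> P" using inducing by (auto simp: directed_seminorms_inducing_def)
  then have "openin \<tau> UNIV" unfolding openin_iff using zero_less_one by blast
  then show ?thesis by (metis openin_subset top.extremum_uniqueI)
qed

lemma continuous_map_into_iff:
  "continuous_map Z \<tau> f \<longleftrightarrow>
     (\<forall>z\<in>topspace Z. \<forall>p\<in>P. \<forall>e>0. \<exists>W. openin Z W \<and> z \<in> W \<and> (\<forall>w\<in>W. p (f w - f z) < e))"
  (is "?L \<longleftrightarrow> ?R")
proof
  assume f: ?L
  show ?R
  proof (intro ballI allI impI)
    fix z p and e :: real assume z: "z \<in> topspace Z" "p \<in> P" "e > 0"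
    define W where "W = {w \<in> topspace Z. f w \<in> {y. p (y - f z) < e}}"
    have "openin Z W"
      unfolding W_def by (rule openin_continuous_map_preimage[OF f openin_seminorm_ball[OF z(2)]])
    moreover have "z \<in> W" "\<forall>w\<in>W. p (f w - f z) < e"
      using z seminorm_zero[OF seminorm[OF z(2)]] by (auto simp: W_def)
    ultimately show "\<exists>W. openin Z W \<and> z \<in> W \<and> (\<forall>w\<in>W. p (f w - f z) < e)"
      by (intro exI[of _ W] conjI)
  qed
next
  assume R: ?R
  have "openin Z {z \<in> topspace Z. f z \<in> V}" if V: "openin \<tau> V" for V
  proof (subst openin_subopen, intro ballI)
    fix z assume "z \<in> {z \<in> topspace Z. f z \<in> V}"
    then have z: "z \<in> topspace Z" "f z \<in> V" by auto
    obtain p e where p: "p \<in> P" "e > 0" "{y. p (y - f z) < e} \<subseteq> V"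
      using V[unfolded openin_iff, rule_format, OF z(2)] by auto
    obtain W where "openin Z W" "z \<in> W" "\<forall>w\<in>W. p (f w - f z) < e"
      using R[rule_format, OF z(1) p(1,2)] by auto
    then show "\<exists>W. openin Z W \<and> z \<in> W \<and> W \<subseteq> {z \<in> topspace Z. f z \<in> V}"
      using p(3) openin_subset[of Z W] by blast
  qed
  then show ?L by (simp add: continuous_map_def topspace_eq)
qed

lemma limitin_iff: "limitin \<tau> s x F \<longleftrightarrow> (\<forall>p\<in>P. ((\<lambda>n. p (s n - x)) \<longlongrightarrow> 0) F)"
  (is "?L \<longleftrightarrow> ?R")
proof
  assume L: ?L
  show ?R
  proof (intro ballI tendstoI)
    fix p and e :: real assume p: "p \<in> P" and e: "e > 0"
    have "x \<in> {y. p (y - x) < e}" using e seminorm_zero[OF seminorm[OF p]] by simp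
    then have "\<forall>\<^sub>F n in F. s n \<in> {y. p (y - x) < e}"
      using L openin_seminorm_ball[OF p] unfolding limitin_def by blast
    then show "\<forall>\<^sub>F n in F. dist (p (s n - x)) 0 < e"
      using seminorm_nonneg[OF seminorm[OF p]] by simp
  qed
next
  assume R: ?R
  have "\<forall>\<^sub>F n in F. s n \<in> V" if V: "openin \<tau> V" "x \<in> V" for V
  proof -
    obtain p e where p: "p \<in> P" "e > 0" "{y. p (y - x) < e} \<subseteq> V"
      using V unfolding openin_iff by blast
    then have "\<forall>\<^sub>F n in F. p (s n - x) < e" using R by (intro order_tendstoD(2)) auto
    then show ?thesis using p(3) by (auto elim: eventually_mono)
  qed
  then show ?L by (simp add: limitin_def topspace_eq)
qed

lemma linear_topology: "linear_topology smul \<tau>"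
  unfolding linear_topology_def
proof (intro conjI topspace_eq)
  show "continuous_map (prod_topology \<tau> \<tau>) \<tau> (\<lambda>(x, y). x + y)"
    unfolding continuous_map_into_iff
  proof (clarify)
    fix a b p and e :: real assume p: "p \<in> P" and e: "e > 0"
    note sn = seminorm[OF p]
    define W where "W = {y. p (y - a) < e / 2} \<times> {y. p (y - b) < e / 2}"
    have "openin (prod_topology \<tau> \<tau>) W"
      unfolding W_def openin_prod_Times_iff using openin_seminorm_ball[OF p] by blast
    moreover have "(a, b) \<in> W" using e seminorm_zero[OF sn] by (simp add: W_def)
    moreover have "p (x + y - (a + b)) < e" if "(x, y) \<in> W" for x y
      using that seminorm_add[OF sn, of "x - a" "y - b"] by (simp add: W_def algebra_simps)
    ultimately show "\<exists>W. openin (prod_topology \<tau> \<tau>) W \<and> (a, b) \<in> W \<and>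
        (\<forall>w\<in>W. p ((case w of (x, y) \<Rightarrow> x + y) - (a + b)) < e)"
      by auto
  qed
  show "continuous_map (prod_topology euclidean \<tau>) \<tau> (\<lambda>(a, x). smul a x)"
    unfolding continuous_map_into_iff
  proof (clarify)
    fix a :: 'k and x p and e :: real assume p: "p \<in> P" and e: "e > 0"
    note sn = seminorm[OF p]
    \<comment> \<open>The estimate rests on
      \<open>smul b y - smul a x = smul b (y - x) + smul (b - a) x\<close>. Here \<open>d\<close>
      keeps the second term below \<open>e / 2\<close>, \<open>K\<close> bounds
      \<open>norm b\<close> for \<open>b\<close> within \<open>d\<close> of \<open>a\<close>, and
      \<open>c\<close> keeps the first term at most \<open>e / 2\<close>.\<close>
    define d where "d = e / (2 * (p x + 1))"
    define K where "K = norm a + d + 1"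
    define c where "c = e / (2 * K)"
    have px: "p x \<ge> 0" by (rule seminorm_nonneg[OF sn])
    then have d: "d > 0" using e by (simp add: d_def)
    then have K: "K > 0" by (simp add: K_def add_nonneg_pos)
    then have c: "c > 0" using e by (simp add: c_def)
    define W where "W = ball a d \<times> {y. p (y - x) < c}"
    have "openin (prod_topology euclidean \<tau>) W"
      unfolding W_def openin_prod_Times_iff using openin_seminorm_ball[OF p] by simp
    moreover have "(a, x) \<in> W" using c d seminorm_zero[OF sn] by (simp add: W_def)
    moreover have "p (smul b y - smul a x) < e" if "(b, y) \<in> W" for b y
    proof -
      have b: "norm (b - a) < d" and y: "p (y - x) < c"
        using that by (auto simp: W_def dist_norm norm_minus_commute)
      have "norm b \<le> K" using norm_triangle_sub[of b a] b by (simp add: K_def)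
      have "smul b y - smul a x = smul b (y - x) + smul (b - a) x"
        by (simp add: scale_right_diff_distrib scale_left_diff_distrib)
      then have "p (smul b y - smul a x) \<le> norm b * p (y - x) + norm (b - a) * p x"
        using seminorm_add[OF sn, of "smul b (y - x)" "smul (b - a) x"] by (simp add: seminorm_smul[OF sn])
      also have "norm b * p (y - x) \<le> K * c"
        using \<open>norm b \<le> K\<close> y K seminorm_nonneg[OF sn] by (intro mult_mono) auto
      also have "K * c = e / 2"
        using K by (simp add: c_def)
      also have "norm (b - a) * p x \<le> d * p x" using b px by (intro mult_right_mono) auto
      also have "d * p x < e / 2" using e px by (simp add: d_def field_simps)
      finally show ?thesis by simp
    qed
    ultimately show "\<exists>W. openin (prod_topology euclidean \<tau>) W \<and> (a, x) \<in> W \<and>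
        (\<forall>w\<in>W. p ((case w of (a, x) \<Rightarrow> smul a x) - smul a x) < e)"
      by auto
  qed
qed

lemma top_dual_if_dominated:
  assumes F: "Vector_Spaces.linear smul (*) F" and p: "p \<in> P" and le: "\<And>x. norm (F x) \<le> c * p x"
  shows "F \<in> top_dual smul \<tau>"
proof -
  interpret F: linear F by (rule linear_functional_imp_linear[OF F])
  have "openin \<tau> (F -` V)" if V: "open V" for V
    unfolding openin_iff
  proof
    fix x assume "x \<in> F -` V"
    then obtain e where e: "e > 0" "ball (F x) e \<subseteq> V" using V open_contains_ball by blast
    \<comment> \<open>The sign of \<open>c\<close> is unrestricted; \<open>\<bar>c\<bar> + 1\<close>
      is a positive upper bound for it.\<close>
    define d where "d = e / (\<bar>c\<bar> + 1)"
    have d: "d > 0" using e by (simp add: d_def add_nonneg_pos)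
    have "y \<in> F -` V" if y: "p (y - x) < d" for y
    proof -
      have "dist (F x) (F y) = norm (F (y - x))" by (simp add: F.diff dist_norm norm_minus_commute)
      also have "\<dots> \<le> c * p (y - x)" by (rule le)
      also have "\<dots> \<le> (\<bar>c\<bar> + 1) * p (y - x)"
        using seminorm_nonneg[OF seminorm[OF p]] by (intro mult_right_mono) auto
      also have "\<dots> < e" using y by (simp add: d_def pos_less_divide_eq add_nonneg_pos mult.commute)
      finally show ?thesis using e(2) by auto
    qed
    then show "\<exists>p\<in>P. \<exists>d>0. {y. p (y - x) < d} \<subseteq> F -` V" using p d by blast
  qed
  then show ?thesis
    using F by (auto simp: top_dual_def continuous_map_def topspace_eq vimage_def)
qed

end

text \<open>Serves to build a candidate topology from seminorms made by hand. Directedness is what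
  gives closure under intersections; the radius \<open>min d e / (C + 1)\<close> absorbs the
  constant \<open>C\<close>, which may be 0.\<close>

lemma directed_seminorms_inducing_exists:
  assumes "P \<noteq> {}" "\<And>p. p \<in> P \<Longrightarrow> seminorm_on smul p"
    and dir: "\<And>p q. p \<in> P \<Longrightarrow> q \<in> P \<Longrightarrow> \<exists>r\<in>P. \<exists>C\<ge>0. \<forall>x. max (p x) (q x) \<le> C * r x"
  obtains \<tau> where "directed_seminorms_inducing smul P \<tau>"
proof
  define opn where "opn V \<longleftrightarrow> (\<forall>x\<in>V. \<exists>p\<in>P. \<exists>e>0. {y. p (y - x) < e} \<subseteq> V)" for V
  have "opn (V \<inter> W)" if VW: "opn V" "opn W" for V W
    unfolding opn_def
  proof
    fix x assume "x \<in> V \<inter> W"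
    then obtain p q d e where pq: "p \<in> P" "q \<in> P" "d > 0" "e > 0"
      "{y. p (y - x) < d} \<subseteq> V" "{y. q (y - x) < e} \<subseteq> W"
      using VW unfolding opn_def by blast
    obtain r C where r: "r \<in> P" "C \<ge> 0" "\<And>x. max (p x) (q x) \<le> C * r x"
      using dir[OF pq(1,2)] by blast
    have "{y. r (y - x) < min d e / (C + 1)} \<subseteq> V \<inter> W"
    proof clarify
      fix y assume "r (y - x) < min d e / (C + 1)"
      then have "(C + 1) * r (y - x) < min d e" using r(2) by (simp add: field_simps)
      \<comment> \<open>Here \<open>smul\<close> is arbitrary, so nonnegativity of \<open>r\<close>
        is not at hand; a negative value makes the product nonpositive, which is enough.\<close>
      moreover have "C * r (y - x) < min d e"
      proof (cases "r (y - x) \<ge> 0")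
        case True
        then show ?thesis using calculation by (simp add: algebra_simps)
      next
        case False
        then have "C * r (y - x) \<le> 0" using r(2) by (simp add: mult_nonneg_nonpos)
        then show ?thesis using pq(3,4) by (simp add: min_def)
      qed
      ultimately have "p (y - x) < d" "q (y - x) < e" using r(3)[of "y - x"] by auto
      then show "y \<in> V \<inter> W" using pq(5,6) by blast
    qed
    moreover have "min d e / (C + 1) > 0" using pq(3,4) r(2) by simp
    ultimately show "\<exists>p\<in>P. \<exists>e>0. {y. p (y - x) < e} \<subseteq> V \<inter> W" using r(1) by blast
  qed
  moreover have "opn (\<Union>\<V>)" if "\<forall>V\<in>\<V>. opn V" for \<V>
    unfolding opn_def
  proof
    fix x assume "x \<in> \<Union>\<V>"
    then obtain V where "V \<in> \<V>" "x \<in> V" by blast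
    then show "\<exists>p\<in>P. \<exists>e>0. {y. p (y - x) < e} \<subseteq> \<Union>\<V>"
      using that unfolding opn_def by (meson Union_upper order_trans)
  qed
  ultimately have "istopology opn" unfolding istopology_def by blast
  from topology_inverse'[OF this]
  have open_iff: "openin (topology opn) V \<longleftrightarrow> (\<forall>x\<in>V. \<exists>p\<in>P. \<exists>e>0. {y. p (y - x) < e} \<subseteq> V)" for V
    by (simp add: opn_def)
  have seminorms: "\<forall>p\<in>P. seminorm_on smul p"
    using assms(2) by blast
  have directed: "\<forall>p\<in>P. \<forall>q\<in>P. \<exists>r\<in>P. \<exists>C\<ge>0. \<forall>x. max (p x) (q x) \<le> C * r x"
    using dir by blast
  show "directed_seminorms_inducing smul P (topology opn)"
    unfolding directed_seminorms_inducing_def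
    by (intro conjI assms(1) seminorms directed allI open_iff)
qed

section \<open>The mixed topology\<close>

lemma limitin_coarser:
  "coarser_than \<tau> \<gamma> \<Longrightarrow> topspace \<tau> = UNIV \<Longrightarrow> limitin \<gamma> s x F \<Longrightarrow> limitin \<tau> s x F"
  by (auto simp: limitin_def coarser_than_def)

lemma continuous_map_coarser:
  "coarser_than \<tau> \<sigma> \<Longrightarrow> topspace \<tau> = UNIV \<Longrightarrow> topspace \<sigma> = UNIV \<Longrightarrow> continuous_map \<tau> Y f \<Longrightarrow>
     continuous_map \<sigma> Y f"
  by (auto simp: continuous_map_def coarser_than_def)

definition seminorm_ball :: "('x::ab_group_add \<Rightarrow> real) \<Rightarrow> 'x \<Rightarrow> real \<Rightarrow> 'x set" where
  "seminorm_ball p x e = {y. p (y - x) < e}"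

lemma mem_seminorm_ball [simp]: "y \<in> seminorm_ball p x e \<longleftrightarrow> p (y - x) < e"
  by (simp add: seminorm_ball_def)

lemma (in seminorm_topology) openinE:
  assumes "openin \<tau> V" "x \<in> V"
  obtains p e where "p \<in> P" "e > 0" "seminorm_ball p x e \<subseteq> V"
proof -
  have "\<exists>p\<in>P. \<exists>e>0. seminorm_ball p x e \<subseteq> V"
    using assms(1)[unfolded openin_iff] assms(2) unfolding seminorm_ball_def by (rule bspec)
  then show ?thesis using that by blast
qed

locale saks_seminorms = seminorm_topology smul P \<tau>
  for smul :: "'k::real_or_complex \<Rightarrow> 'x::banach \<Rightarrow> 'x" and P \<tau> +
  assumes saks: "saks_space smul \<tau>"
begin

abbreviation mixed where "mixed \<equiv> mixed_topology smul \<tau>"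

lemma coarser_euclidean: "coarser_than \<tau> euclidean"
  using saks by (simp add: saks_space_def)

lemma mixed_finest:
  shows mixed_candidate_mixed: "mixed_candidate smul \<tau> mixed"
    and coarser_mixed: "mixed_candidate smul \<tau> \<sigma> \<Longrightarrow> coarser_than \<sigma> mixed"
  using theI'[OF mixed_topology_unique_existence[OF linear_topology coarser_euclidean]]
  unfolding mixed_topology_def by blast+

lemma mixed_limit_imp_limit: "limitin mixed s x F \<Longrightarrow> limitin \<tau> s x F"
  using mixed_candidate_mixed limitin_coarser topspace_eq by (auto simp: mixed_candidate_def)

text \<open>On a norm ball the mixed topology agrees with \<tau>, so a mixed neighbourhood of 0
  contains the trace of a \<tau>-ball there. The seminorm and its radius depend on
  \<open>R\<close>.\<close>

lemma mixed_nhds_zero: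
  assumes W: "openin mixed W" "0 \<in> W"
  obtains p d where "p \<in> P" "d > 0" "\<And>z. p z < d \<Longrightarrow> norm z \<le> R \<Longrightarrow> z \<in> W"
proof -
  \<comment> \<open>The absolute value puts 0 into the ball whatever the sign of
    \<open>R\<close>.\<close>
  define N where "N = cball (0::'x) \<bar>R\<bar>"
  have "subtopology mixed N = subtopology \<tau> N"
    using mixed_candidate_mixed by (simp add: mixed_candidate_def N_def)
  moreover have "openin (subtopology mixed N) (W \<inter> N)"
    using W by (auto simp: openin_subtopology)
  ultimately obtain V where V: "openin \<tau> V" "W \<inter> N = V \<inter> N"
    by (auto simp: openin_subtopology)
  have "0 \<in> W \<inter> N" using W by (simp add: N_def)
  then have "0 \<in> V" using V by simp
  with V(1) obtain p d where pd: "p \<in> P" "d > 0" "seminorm_ball p 0 d \<subseteq> V"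
    by (rule openinE)
  have "z \<in> W" if "p z < d" "norm z \<le> R" for z
  proof -
    have "z \<in> seminorm_ball p 0 d" "z \<in> N" using that by (auto simp: N_def)
    then show ?thesis using V(2) pd(3) by blast
  qed
  then show ?thesis using that[OF pd(1,2)] by blast
qed

lemma linear_top_dual: "f \<in> top_dual smul \<tau> \<Longrightarrow> Vector_Spaces.linear smul (*) f"
  by (simp add: top_dual_def)

lemma continuous_map_top_dual: "f \<in> top_dual smul \<tau> \<Longrightarrow> continuous_map \<tau> euclidean f"
  by (simp add: top_dual_def)

lemma continuous_on_top_dual: "f \<in> top_dual smul \<tau> \<Longrightarrow> continuous_on UNIV f"
  using continuous_map_coarser[OF coarser_euclidean topspace_eq _ continuous_map_top_dual]
  by simp

lemma zero_in_top_dual: "(\<lambda>_. 0) \<in> top_dual smul \<tau>"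
  by (simp add: top_dual_def linear_iff_field)

text \<open>The norming property of the \<tau>-dual, in the form used to estimate norms. The zero
  functional ensures that the supremum has a nonempty index set.\<close>

lemma norm_le_if_top_dual_le:
  assumes "\<And>f. f \<in> top_dual smul \<tau> \<Longrightarrow> onorm f \<le> 1 \<Longrightarrow> norm (f x) \<le> c"
  shows "norm x \<le> c"
proof -
  have "norm x = (SUP f\<in>{f \<in> top_dual smul \<tau>. onorm f \<le> 1}. norm (f x))"
    using saks unfolding saks_space_def by blast
  also have "\<dots> \<le> c"
  proof (rule cSUP_least)
    have "(\<lambda>_. 0) \<in> {f \<in> top_dual smul \<tau>. onorm f \<le> 1}"
      using zero_in_top_dual by (simp add: onorm_zero)
    then show "{f \<in> top_dual smul \<tau>. onorm f \<le> 1} \<noteq> {}" by blast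
  qed (use assms in auto)
  finally show ?thesis .
qed

lemma bounded_linear_top_dual:
  assumes "f \<in> top_dual smul \<tau>"
  shows "bounded_linear f"
  using bounded_linear_if_continuous linear_functional_imp_linear linear_top_dual[OF assms]
    continuous_on_top_dual[OF assms] by blast

lemma top_dual_separates:
  assumes "\<And>f. f \<in> top_dual smul \<tau> \<Longrightarrow> f x = f y"
  shows "x = y"
proof -
  have "norm (x - y) \<le> 0"
  proof (rule norm_le_if_top_dual_le)
    fix f assume f: "f \<in> top_dual smul \<tau>"
    then have "f (x - y) = f x - f y" using bounded_linear_top_dual bounded_linear.linear linear_diff by blast
    then show "norm (f (x - y)) \<le> 0" using assms[OF f] by simp
  qed
  then show ?thesis by simp
qed

lemma openin_top_dual_ball:
  assumes "f \<in> top_dual smul \<tau>"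
  shows "openin \<tau> {z. norm (f z) < e}"
proof -
  have "openin \<tau> {z \<in> topspace \<tau>. f z \<in> ball 0 e}"
    by (rule openin_continuous_map_preimage[OF continuous_map_top_dual[OF assms]]) simp
  then show ?thesis by (simp add: topspace_eq)
qed

text \<open>Adjoining \<open>q\<close> to the seminorms of \<open>\<tau>\<close> gives a competitor of the mixed topology.\<close>

lemma mixed_limit_seminorm:
  assumes q: "seminorm_on smul q" and le: "\<And>x. q x \<le> norm x"
    and cont: "\<And>R e. e > 0 \<Longrightarrow> \<exists>p\<in>P. \<exists>d>0. \<forall>z. p z < d \<longrightarrow> norm z \<le> R \<longrightarrow> q z < e"
    and lim: "limitin mixed s x F"
  shows "((\<lambda>n. q (s n - x)) \<longlongrightarrow> 0) F"
proof -
  \<comment> \<open>Maxima with \<open>q\<close>, unlike the mere addition of \<open>q\<close> as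
    one more member, keep the system directed; each new ball is the intersection of a
    \<open>p\<close>-ball and a \<open>q\<close>-ball.\<close>
  define P' where "P' = (\<lambda>p x. max (p x) (q x)) ` P"
  have "seminorm_on smul r" if r: "r \<in> P'" for r
  proof -
    obtain p where p: "seminorm_on smul p" and r: "r = (\<lambda>x. max (p x) (q x))"
      using r seminorm by (auto simp: P'_def)
    show ?thesis
      unfolding seminorm_on_def r
    proof (intro conjI allI)
      fix a x y
      show "max (p (x + y)) (q (x + y)) \<le> max (p x) (q x) + max (p y) (q y)"
        using seminorm_add[OF p, of x y] seminorm_add[OF q, of x y] by linarith
      show "max (p (smul a x)) (q (smul a x)) = norm a * max (p x) (q x)"
        by (simp add: seminorm_smul[OF p] seminorm_smul[OF q] max_mult_distrib_left)
    qed
  qed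
  note sn' = this
  have dir': "\<exists>r\<in>P'. \<exists>C\<ge>0. \<forall>x. max (p x) (p' x) \<le> C * r x" if pp': "p \<in> P'" "p' \<in> P'" for p p'
  proof -
    obtain p1 p2 where p: "p1 \<in> P" "p2 \<in> P" "p = (\<lambda>x. max (p1 x) (q x))" "p' = (\<lambda>x. max (p2 x) (q x))"
      using pp' unfolding P'_def image_iff by blast
    obtain r C where r: "r \<in> P" "C \<ge> 0" "\<And>x. max (p1 x) (p2 x) \<le> C * r x"
      using inducing p(1,2) unfolding directed_seminorms_inducing_def by meson
    \<comment> \<open>\<open>C\<close> dominates the part coming from \<open>P\<close>, the extra 1
      dominates \<open>q\<close>.\<close>
    have "max (p x) (p' x) \<le> (C + 1) * max (r x) (q x)" for x
    proof -
      have "0 \<le> r x" "0 \<le> q x"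
        using seminorm_nonneg[OF seminorm[OF r(1)]] seminorm_nonneg[OF q] by auto
      then have "C * r x \<le> C * max (r x) (q x)" "0 \<le> C * max (r x) (q x)" "0 \<le> max (r x) (q x)"
        using r(2) by (auto intro: mult_left_mono)
      then show ?thesis using r(3)[of x] by (simp add: p distrib_right)
    qed
    moreover have "C + 1 \<ge> 0" using r(2) by simp
    ultimately show ?thesis
      using r(1) unfolding P'_def
      by (intro bexI[where x = "\<lambda>x. max (r x) (q x)"] exI[of _ "C + 1"] conjI allI imageI)
  qed
  have "P' \<noteq> {}" using inducing by (simp add: P'_def directed_seminorms_inducing_def)
  then obtain \<sigma> where \<sigma>: "directed_seminorms_inducing smul P' \<sigma>"
    using directed_seminorms_inducing_exists[of P' smul] sn' dir' by metis
  interpret \<sigma>: seminorm_topology smul P' \<sigma>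
    by unfold_locales (rule \<sigma>)
  have finer: "coarser_than \<tau> \<sigma>"
    unfolding coarser_than_def
  proof (intro allI impI)
    fix V assume V: "openin \<tau> V"
    show "openin \<sigma> V"
      unfolding \<sigma>.openin_iff
    proof
      fix x assume "x \<in> V"
      with V obtain p e where p: "p \<in> P" "e > 0" "seminorm_ball p x e \<subseteq> V"
        by (rule openinE)
      have "(\<lambda>x. max (p x) (q x)) \<in> P'" using p(1) by (simp add: P'_def)
      moreover have "{y. max (p (y - x)) (q (y - x)) < e} \<subseteq> V" using p(3) by auto
      ultimately show "\<exists>p\<in>P'. \<exists>e>0. {y. p (y - x) < e} \<subseteq> V"
        using p(2) by (intro bexI[where x = "\<lambda>x. max (p x) (q x)"] exI[of _ e] conjI)
    qed
  qed
  have open_\<sigma>: "\<exists>p\<in>P. \<exists>e>0. seminorm_ball p x e \<inter> seminorm_ball q x e \<subseteq> V"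
    if V: "openin \<sigma> V" and x: "x \<in> V" for x V
  proof -
    from V x obtain r e where r: "r \<in> P'" "e > 0" "seminorm_ball r x e \<subseteq> V"
      by (rule \<sigma>.openinE)
    obtain p where p: "p \<in> P" "r = (\<lambda>x. max (p x) (q x))" using r(1) unfolding P'_def image_iff by blast
    have "seminorm_ball p x e \<inter> seminorm_ball q x e \<subseteq> V" using r(3) p(2) by auto
    then show ?thesis using p(1) r(2) by blast
  qed
  have "coarser_than \<sigma> euclidean"
    unfolding coarser_than_def
  proof (intro allI impI)
    fix V assume V: "openin \<sigma> V"
    have "\<exists>W. open W \<and> x \<in> W \<and> W \<subseteq> V" if x: "x \<in> V" for x
    proof -
      obtain p e where p: "p \<in> P" "e > 0" "seminorm_ball p x e \<inter> seminorm_ball q x e \<subseteq> V"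
        using open_\<sigma>[OF V x] by blast
      have "open (seminorm_ball p x e)"
        using openin_seminorm_ball[OF p(1)] coarser_euclidean
        by (simp add: coarser_than_def seminorm_ball_def)
      then have "open (seminorm_ball p x e \<inter> ball x e)" by auto
      moreover have "q (y - x) < e" if "y \<in> ball x e" for y
        using le[of "y - x"] that by (simp add: dist_norm norm_minus_commute)
      ultimately show ?thesis
        using p seminorm_zero[OF seminorm[OF p(1)]]
        by (intro exI[of _ "seminorm_ball p x e \<inter> ball x e"]) auto
    qed
    then have "open V" by (subst open_subopen) blast
    then show "openin euclidean V" by simp
  qed
  moreover have "subtopology \<sigma> N = subtopology \<tau> N" if N: "bounded N" for N
    unfolding topology_eq
  proof (intro allI iffI)
    fix G assume "openin (subtopology \<sigma> N) G"
    then obtain V where V: "openin \<sigma> V" "G = V \<inter> N" by (auto simp: openin_subtopology)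
    obtain R where R: "\<And>y. y \<in> N \<Longrightarrow> norm y \<le> R" using N by (auto simp: bounded_iff)
    \<comment> \<open>The largest \<tau>-open set whose trace on \<open>N\<close> lies in
      \<open>V\<close>; what remains is that it covers \<open>V \<inter> N\<close>.\<close>
    define W where "W = \<Union>{W. openin \<tau> W \<and> W \<inter> N \<subseteq> V}"
    have "x \<in> W" if x: "x \<in> V" "x \<in> N" for x
    proof -
      obtain p e where p: "p \<in> P" "e > 0" "seminorm_ball p x e \<inter> seminorm_ball q x e \<subseteq> V"
        using open_\<sigma>[OF V(1) x(1)] by blast
      \<comment> \<open>Differences of points of \<open>N\<close> have norm at most
        \<open>2 * R\<close>, so within \<open>N\<close> the \<open>q\<close>-ball around
        \<open>x\<close> contains the trace of a \<open>p'\<close>-ball.\<close>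
      obtain p' d where p': "p' \<in> P" "d > 0" "\<forall>z. p' z < d \<longrightarrow> norm z \<le> 2 * R \<longrightarrow> q z < e"
        using cont[OF p(2), of "2 * R"] by blast
      have "norm (y - x) \<le> 2 * R" if "y \<in> N" for y
        using norm_triangle_ineq4[of y x] R[OF that] R[OF x(2)] by simp
      then have "(seminorm_ball p x e \<inter> seminorm_ball p' x d) \<inter> N \<subseteq> V"
        using p(3) p'(3) by auto
      moreover have "openin \<tau> (seminorm_ball p x e \<inter> seminorm_ball p' x d)"
        using openin_seminorm_ball[OF p(1)] openin_seminorm_ball[OF p'(1)]
        unfolding seminorm_ball_def by blast
      moreover have "x \<in> seminorm_ball p x e \<inter> seminorm_ball p' x d"
        using p(2) p'(2) seminorm_zero[OF seminorm[OF p(1)]] seminorm_zero[OF seminorm[OF p'(1)]]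
        by simp
      ultimately show ?thesis unfolding W_def by blast
    qed
    then have "G = W \<inter> N" unfolding V(2) W_def by blast
    moreover have "openin \<tau> W" unfolding W_def by blast
    ultimately show "openin (subtopology \<tau> N) G" by (auto simp: openin_subtopology)
  next
    fix G assume "openin (subtopology \<tau> N) G"
    then show "openin (subtopology \<sigma> N) G"
      using finer by (auto simp: openin_subtopology coarser_than_def)
  qed
  ultimately have "mixed_candidate smul \<tau> \<sigma>"
    using finer \<sigma>.linear_topology by (simp add: mixed_candidate_def)
  then have "limitin \<sigma> s x F"
    using limitin_coarser[OF coarser_mixed \<sigma>.topspace_eq lim] by blast
  obtain p where p: "p \<in> P" using inducing by (auto simp: directed_seminorms_inducing_def)
  have "((\<lambda>n. max (p (s n - x)) (q (s n - x))) \<longlongrightarrow> 0) F"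
    using \<open>limitin \<sigma> s x F\<close>[unfolded \<sigma>.limitin_iff] p by (auto simp: P'_def)
  then show ?thesis
    by (rule tendsto_sandwich[OF _ _ tendsto_const, rotated -1])
      (auto simp: seminorm_nonneg[OF q])
qed

end

section \<open>Boundedness of convergent sequences, and functionals respecting bounded
  sequences\<close>

context saks_seminorms
begin

text \<open>Terms of size beyond \<open>(real k + 1)\<^sup>2\<close> are detected by functionals
  \<open>f k\<close> of norm at most 1. The supremum \<open>q\<close> of all
  \<open>norm (f k x) / (real k + 1)\<close> is \<tau>-continuous at 0 on bounded sets, as its tail
  is uniformly small there. By \<open>mixed_limit_seminorm\<close> it is then continuous along mixed
  limits, yet it is unbounded on the chosen terms.\<close>

lemma mixed_limit_imp_bounded:
  assumes lim: "limitin mixed s x sequentially"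
  shows "bounded (range s)"
proof (rule ccontr)
  assume "\<not> bounded (range s)"
  then have "\<not> Bseq s" by (simp add: Bseq_eq_bounded)
  have "\<exists>n\<ge>k. norm (s n) > K" if "K > 0" for k K
    using \<open>\<not> Bseq s\<close> that unfolding Bfun_def eventually_sequentially by (meson not_le_imp_less)
  \<comment> \<open>The square leaves a growing factor \<open>real k + 1\<close> after division by
    the weight.\<close>
  then have "\<forall>k. \<exists>n\<ge>k. norm (s n) > (real k + 1)\<^sup>2" by simp
  then obtain n where n: "\<And>k. n k \<ge> k" "\<And>k. norm (s (n k)) > (real k + 1)\<^sup>2" by metis
  have "\<exists>f. f \<in> top_dual smul \<tau> \<and> onorm f \<le> 1 \<and> norm (f (s (n k))) > (real k + 1)\<^sup>2" for k
    using norm_le_if_top_dual_le[of "s (n k)" "(real k + 1)\<^sup>2"] n(2)[of k] by force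
  then obtain f where f: "\<And>k. f k \<in> top_dual smul \<tau>" "\<And>k. onorm (f k) \<le> 1"
    "\<And>k. norm (f k (s (n k))) > (real k + 1)\<^sup>2" by metis
  have lin: "bounded_linear (f k)" for k by (rule bounded_linear_top_dual[OF f(1)])
  have f_le: "norm (f k x) \<le> norm x" for k x
    using onorm[OF lin, of k x] mult_right_mono[OF f(2)[of k] norm_ge_zero[of x]] by simp
  define q where "q x = (SUP k. norm (f k x) / (real k + 1))" for x
  have term_le: "norm (f k x) / (real k + 1) \<le> norm x" for k x
  proof -
    have "norm x \<le> norm x * (real k + 1)" by (simp add: distrib_left)
    then have "norm (f k x) \<le> norm x * (real k + 1)" using f_le[of k x] by simp
    then show ?thesis by (simp add: divide_le_eq add_nonneg_pos)
  qed
  have q_ge: "norm (f k x) / (real k + 1) \<le> q x" for k x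
    unfolding q_def by (rule cSUP_upper) (auto intro: bdd_aboveI2 term_le)
  have q_le: "q x \<le> c" if "\<And>k. norm (f k x) / (real k + 1) \<le> c" for c x
    unfolding q_def by (rule cSUP_least) (use that in auto)
  have q_scale_le: "q (smul a x) \<le> norm a * q x" for a x
  proof (rule q_le)
    fix k
    have "norm (f k (smul a x)) = norm a * norm (f k x)"
      using linear_top_dual[OF f(1)[of k]] by (simp add: linear_iff_field norm_mult)
    then show "norm (f k (smul a x)) / (real k + 1) \<le> norm a * q x"
      using mult_left_mono[OF q_ge[of k x] norm_ge_zero[of a]] by simp
  qed
  have q: "seminorm_on smul q"
    unfolding seminorm_on_def
  proof (intro conjI allI)
    fix x y a
    show "q (x + y) \<le> q x + q y"
    proof (rule q_le)
      fix k
      have "norm (f k (x + y)) \<le> norm (f k x) + norm (f k y)"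
        using linear_top_dual[OF f(1)[of k]] by (simp add: linear_iff_field norm_triangle_ineq)
      then have "norm (f k (x + y)) / (real k + 1) \<le> (norm (f k x) + norm (f k y)) / (real k + 1)"
        by (rule divide_right_mono) simp
      then show "norm (f k (x + y)) / (real k + 1) \<le> q x + q y"
        using q_ge[of k x] q_ge[of k y] by (simp add: add_divide_distrib)
    qed
    have nonneg: "0 \<le> q x" for x
      using order_trans[OF divide_nonneg_nonneg q_ge[of 0 x]] by simp
    show "q (smul a x) = norm a * q x"
    proof (rule antisym[OF q_scale_le])
      show "norm a * q x \<le> q (smul a x)"
      proof (cases "a = 0")
        case False
        have "q x \<le> norm (inverse a) * q (smul a x)"
          using q_scale_le[of "inverse a" "smul a x"] False by simp
        then have "norm a * q x \<le> norm a * (norm (inverse a) * q (smul a x))"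
          by (rule mult_left_mono) simp
        also have "\<dots> = q (smul a x)" using False by (simp add: norm_inverse)
        finally show ?thesis .
      qed (simp add: nonneg)
    qed
  qed
  have cont: "\<exists>p\<in>P. \<exists>d>0. \<forall>z. p z < d \<longrightarrow> norm z \<le> R \<longrightarrow> q z < e" if e: "e > 0" for R e
  proof -
    \<comment> \<open>Beyond \<open>m\<close> the weight alone brings the quotient below
      \<open>e / 2\<close> on the ball of radius \<open>R\<close>; the finitely many remaining
      functionals are handled by the \<tau>-open set \<open>W\<close>.\<close>
    obtain m where m: "\<bar>R\<bar> / (e / 2) < real m" using reals_Archimedean2 by blast
    define W where "W = (\<Inter>k\<in>{..m}. {z. norm (f k z) < e / 2})"
    have "openin \<tau> W"
      unfolding W_def by (rule openin_INT2) (use openin_top_dual_ball[OF f(1), of _ "e / 2"] in auto)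
    moreover have "0 \<in> W"
      using e linear_0[OF bounded_linear.linear[OF lin]] by (simp add: W_def)
    ultimately obtain p d where p: "p \<in> P" "d > 0" "seminorm_ball p 0 d \<subseteq> W" by (rule openinE)
    have "q z < e" if z: "p z < d" "norm z \<le> R" for z
    proof -
      have "z \<in> seminorm_ball p 0 d" using z(1) by simp
      then have zW: "z \<in> W" using p(3) by blast
      have "q z \<le> e / 2"
      proof (rule q_le)
        fix k
        show "norm (f k z) / (real k + 1) \<le> e / 2"
        proof (cases "k \<le> m")
          case True
          then have "norm (f k z) < e / 2" using zW by (simp add: W_def)
          moreover have "e / 2 * 1 \<le> e / 2 * (real k + 1)" using e by (intro mult_left_mono) auto
          ultimately show ?thesis by (simp add: divide_le_eq add_nonneg_pos)
        next
          case False
          have "norm (f k z) \<le> \<bar>R\<bar>" using f_le[of k z] z(2) by simp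
          also have "\<dots> \<le> e / 2 * real m" using m e by (simp add: field_simps)
          also have "\<dots> \<le> e / 2 * (real k + 1)" using e False by (intro mult_left_mono) auto
          finally show ?thesis by (simp add: divide_le_eq add_nonneg_pos)
        qed
      qed
      then show ?thesis using e by simp
    qed
    then show ?thesis using p(1,2) by blast
  qed
  have "q x \<le> norm x" for x by (rule q_le[OF term_le])
  from order_tendstoD(2)[OF mixed_limit_seminorm[OF q this cont lim] zero_less_one]
  have "\<forall>\<^sub>F k in sequentially. q (s k - x) < 1" .
  then obtain N where N: "\<And>k. k \<ge> N \<Longrightarrow> q (s k - x) < 1" by (auto simp: eventually_sequentially)
  \<comment> \<open>The index \<open>l\<close> is at least \<open>N\<close>, so
    \<open>s (n l)\<close> is within \<open>q\<close>-distance 1 of \<open>x\<close>, and at least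
    \<open>k\<close>, so \<open>real l + 1 < q (s (n l))\<close> contradicts the bound
    \<open>1 + q x\<close>.\<close>
  obtain k where k: "1 + q x < real k" using reals_Archimedean2 by blast
  define l where "l = max k N"
  have "real l + 1 < norm (f l (s (n l))) / (real l + 1)"
    using f(3)[of l] by (simp add: less_divide_eq add_nonneg_pos power2_eq_square)
  also have "\<dots> \<le> q (s (n l))" by (rule q_ge)
  also have "\<dots> \<le> q (s (n l) - x) + q x" using seminorm_add[OF q, of "s (n l) - x" x] by simp
  also have "q (s (n l) - x) < 1" using n(1)[of l] by (intro N) (simp add: l_def)
  finally show False using k by (simp add: l_def)
qed

lemma circ_dual_linear: "f \<in> circ_dual smul \<tau> \<Longrightarrow> Vector_Spaces.linear smul (*) f"
  by (simp add: circ_dual_def top_dual_def)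

lemma bounded_linear_circ_dual: "f \<in> circ_dual smul \<tau> \<Longrightarrow> bounded_linear f"
  by (rule bounded_linear_if_continuous)
    (auto simp: circ_dual_def top_dual_def intro: linear_functional_imp_linear)

lemma circ_dual_tendsto:
  assumes f: "f \<in> circ_dual smul \<tau>" and s: "bounded (range s)" "limitin \<tau> s x sequentially"
  shows "(\<lambda>n. f (s n)) \<longlonglongrightarrow> f x"
proof -
  have "bounded (insert x (range s))" using s(1) by simp
  moreover have "range s \<subseteq> insert x (range s)" "x \<in> insert x (range s)" by auto
  ultimately show ?thesis using f s(2) unfolding circ_dual_def by blast
qed

lemma top_dual_subset_circ_dual: "top_dual smul \<tau> \<subseteq> circ_dual smul \<tau>"
proof
  fix f assume f: "f \<in> top_dual smul \<tau>"
  have "(\<lambda>n. f (s n)) \<longlonglongrightarrow> f x" if "limitin \<tau> s x sequentially" for s x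
    using continuous_map_limit[OF continuous_map_top_dual[OF f] that] by (simp add: o_def)
  then show "f \<in> circ_dual smul \<tau>"
    using linear_top_dual[OF f] continuous_on_top_dual[OF f]
    by (simp add: circ_dual_def top_dual_def)
qed

text \<open>The preimage of a ball under \<open>f\<close> is convex, and it is sequentially open
  because mixed limits are bounded \<tau>-limits. So it is a mixed neighbourhood of 0, to which
  \<open>mixed_nhds_zero\<close> applies.\<close>

lemma circ_dual_small_on_bounded:
  assumes C: "C_sequential mixed" and f: "f \<in> circ_dual smul \<tau>" and e: "e > 0"
  obtains p d where "p \<in> P" "d > 0" "\<And>z. p z < d \<Longrightarrow> norm z \<le> R \<Longrightarrow> norm (f z) < e"
proof -
  have lin: "linear f" using bounded_linear_circ_dual[OF f] by (rule bounded_linear.linear)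
  define V where "V = f -` ball 0 e"
  have "convex V" unfolding V_def by (rule convex_linear_vimage[OF lin convex_ball])
  moreover have "sequentially_open mixed V"
    unfolding sequentially_open_def
  proof (intro ballI allI impI)
    fix x s assume x: "x \<in> V" and s: "limitin mixed s x sequentially"
    have "(\<lambda>n. f (s n)) \<longlonglongrightarrow> f x"
      by (rule circ_dual_tendsto[OF f mixed_limit_imp_bounded[OF s] mixed_limit_imp_limit[OF s]])
    then have "\<forall>\<^sub>F n in sequentially. f (s n) \<in> ball 0 e"
      using x by (intro topological_tendstoD) (auto simp: V_def)
    then show "\<forall>\<^sub>F n in sequentially. s n \<in> V" by (simp add: V_def)
  qed
  ultimately have "openin mixed V" using C by (simp add: C_sequential_def)
  moreover have "0 \<in> V" using e by (simp add: V_def linear_0[OF lin])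
  ultimately obtain p d where "p \<in> P" "d > 0" and V: "\<And>z. p z < d \<Longrightarrow> norm z \<le> R \<Longrightarrow> z \<in> V"
    using mixed_nhds_zero[of V R] by metis
  moreover have "norm (f z) < e" if "z \<in> V" for z using that by (simp add: V_def)
  ultimately show ?thesis using that[of p d] by metis
qed

text \<open>Completeness concerns the mixed topology, the Cauchy condition concerns \<tau>.
  Boundedness links them: all differences stay in the ball of radius \<open>2 * R\<close>, where the
  two topologies agree.\<close>

lemma bounded_Cauchy_has_limit:
  assumes complete: "sequentially_complete mixed" and s: "bounded (range s)"
    and Cauchy: "\<And>p e. p \<in> P \<Longrightarrow> e > 0 \<Longrightarrow> \<exists>N. \<forall>m\<ge>N. \<forall>n\<ge>N. p (s m - s n) < e"
  obtains x where "limitin \<tau> s x sequentially"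
proof -
  obtain R where R: "\<And>n. norm (s n) \<le> R" using s by (auto simp: bounded_iff)
  have "\<exists>N. \<forall>m\<ge>N. \<forall>n\<ge>N. s m - s n \<in> V" if V: "openin mixed V" "0 \<in> V" for V
  proof -
    obtain p d where p: "p \<in> P" "d > 0" "\<And>z. p z < d \<Longrightarrow> norm z \<le> 2 * R \<Longrightarrow> z \<in> V"
      using mixed_nhds_zero[OF V, of "2 * R"] by metis
    have "norm (s m - s n) \<le> 2 * R" for m n
      using norm_triangle_ineq4[of "s m" "s n"] R[of m] R[of n] by simp
    then show ?thesis using Cauchy[OF p(1,2)] p(3) by meson
  qed
  then obtain x where "limitin mixed s x sequentially"
    using complete unfolding sequentially_complete_def by blast
  then show ?thesis using that mixed_limit_imp_limit by blast
qed

end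

section \<open>Pettis integrals of continuous functions\<close>

text \<open>The cells are the level sets of \<open>\<lfloor>t / d\<rfloor>\<close>. Only values
  attained on the interval are listed, so that no cell is empty, as \<open>partition_on\<close>
  demands.\<close>

lemma fine_borel_partition:
  fixes a b d :: real
  assumes d: "d > 0"
  obtains \<P> where "finite \<P>" "partition_on {a..b} \<P>" "\<P> \<subseteq> sets borel"
    "\<And>N s t. N \<in> \<P> \<Longrightarrow> s \<in> N \<Longrightarrow> t \<in> N \<Longrightarrow> \<bar>s - t\<bar> < d"
proof
  define cell where "cell i = {t \<in> {a..b}. \<lfloor>t / d\<rfloor> = i}" for i
  define \<P> where "\<P> = cell ` (\<lambda>t. \<lfloor>t / d\<rfloor>) ` {a..b}"
  have "(\<lambda>t. \<lfloor>t / d\<rfloor>) ` {a..b} \<subseteq> {\<lfloor>a / d\<rfloor>..\<lfloor>b / d\<rfloor>}"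
    using d by (auto intro!: floor_mono divide_right_mono)
  then show "finite \<P>" unfolding \<P>_def by (meson finite_atLeastAtMost_int finite_imageI finite_subset)
  show "partition_on {a..b} \<P>"
    by (rule partition_onI) (auto simp: \<P>_def cell_def disjnt_def)
  show "\<P> \<subseteq> sets borel" by (auto simp: \<P>_def cell_def)
  show "\<bar>s - t\<bar> < d" if "N \<in> \<P>" "s \<in> N" "t \<in> N" for N s t
  proof -
    have "\<lfloor>s / d\<rfloor> = \<lfloor>t / d\<rfloor>" using that by (auto simp: \<P>_def cell_def)
    then have "\<bar>s / d - t / d\<bar> < 1" by linarith
    then show ?thesis using d by (simp add: flip: diff_divide_distrib)
  qed
qed

lemma finite_partition_onD:
  assumes "partition_on A \<P>"
  shows "(\<Union>N\<in>\<P>. N) = A" and "disjoint_family_on (\<lambda>N. N) \<P>"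
  using assms by (auto simp: partition_on_def disjoint_family_on_def disjoint_def)

lemma set_integral_interval_const:
  fixes c :: "'b::{banach, second_countable_topology}"
  assumes "N \<in> sets borel" "N \<subseteq> {a..b::real}"
  shows "set_integrable lborel N (\<lambda>_. c)" and "(LINT t:N|lborel. c) = measure lborel N *\<^sub>R c"
proof -
  have "emeasure lborel N \<le> emeasure lborel {a..b}" using assms by (intro emeasure_mono) auto
  then have fin: "emeasure lborel N < \<infinity>" using emeasure_lborel_cbox_finite[of a b]
    by (auto simp: less_top[symmetric] top_unique)
  then show "set_integrable lborel N (\<lambda>_. c)"
    unfolding set_integrable_def using assms(1) by (intro integrable_indicator) auto
  show "(LINT t:N|lborel. c) = measure lborel N *\<^sub>R c"
    unfolding set_lebesgue_integral_def
    using fin assms(1) by (intro has_bochner_integral_integral_eq has_bochner_integral_indicator) auto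
qed

text \<open>The integrand \<open>\<phi> N\<close> may depend on the cell and on the point: constants
  give Riemann sums, and \<open>f (S t (B (w N)))\<close> gives the sums that define the
  semivariation.\<close>

lemma partition_integral_approx:
  fixes \<psi> :: "real \<Rightarrow> 'b::{banach, second_countable_topology}"
  assumes \<P>: "finite \<P>" "partition_on {a..b} \<P>" "\<P> \<subseteq> sets borel" and ab: "a \<le> b"
    and \<psi>: "set_integrable lborel {a..b} \<psi>"
    and \<phi>: "\<And>N. N \<in> \<P> \<Longrightarrow> set_integrable lborel N (\<phi> N)"
    and le: "\<And>N t. N \<in> \<P> \<Longrightarrow> t \<in> N \<Longrightarrow> norm (\<phi> N t - \<psi> t) \<le> e"
  shows "norm ((\<Sum>N\<in>\<P>. LINT t:N|lborel. \<phi> N t) - (LINT t:{a..b}|lborel. \<psi> t)) \<le> (b - a) * e"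
proof -
  note part = finite_partition_onD[OF \<P>(2)]
  have sub: "N \<subseteq> {a..b}" and sets: "N \<in> sets borel" if "N \<in> \<P>" for N
    using that \<P>(2,3) by (auto simp: partition_on_def)
  have split: "(\<Sum>N\<in>\<P>. LINT t:N|lborel. h t) = (LINT t:{a..b}|lborel. h t)"
    if "set_integrable lborel {a..b} h" for h :: "real \<Rightarrow> 'c::{banach, second_countable_topology}"
    using set_integral_finite_Union[OF \<P>(1) part(2), of lborel h] sub sets
      set_integrable_subset[OF that] part(1) by simp
  have int: "set_integrable lborel N \<psi>" if "N \<in> \<P>" for N
    by (rule set_integrable_subset[OF \<psi>]) (use sub[OF that] sets[OF that] in auto)
  have "(\<Sum>N\<in>\<P>. LINT t:N|lborel. \<phi> N t) - (LINT t:{a..b}|lborel. \<psi> t)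
      = (\<Sum>N\<in>\<P>. LINT t:N|lborel. \<phi> N t - \<psi> t)"
    unfolding split[OF \<psi>, symmetric] sum_subtractf[symmetric]
    by (intro sum.cong refl set_integral_diff(2)[symmetric] \<phi> int)
  also have "norm \<dots> \<le> (\<Sum>N\<in>\<P>. LINT t:N|lborel. e)"
  proof (rule sum_norm_le)
    fix N assume N: "N \<in> \<P>"
    have "norm (LINT t:N|lborel. \<phi> N t - \<psi> t) \<le> (LINT t:N|lborel. norm (\<phi> N t - \<psi> t))"
      by (rule set_integral_norm_bound) (rule set_integral_diff(1)[OF \<phi>[OF N] int[OF N]])
    also have "\<dots> \<le> (LINT t:N|lborel. e)"
      using le[OF N]
      by (intro set_integral_mono set_integrable_norm set_integral_diff(1) \<phi>[OF N] int[OF N]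
            set_integral_interval_const(1)[OF sets[OF N] sub[OF N]])
    finally show "norm (LINT t:N|lborel. \<phi> N t - \<psi> t) \<le> (LINT t:N|lborel. e)" .
  qed
  also have "\<dots> = (LINT t:{a..b}|lborel. e)"
    by (rule split) (rule set_integral_interval_const[of _ a b]; simp)
  also have "\<dots> = (b - a) * e"
    using ab by (subst set_integral_interval_const[of _ a b]) auto
  finally show ?thesis .
qed

text \<open>Both bi-continuity and \<open>circ_dual\<close> speak about sequences, so continuity
  along sequences is the form that passes through the semigroup and through the functionals.\<close>

definition sequentially_continuous_on ::
  "'a::topological_space set \<Rightarrow> 'y topology \<Rightarrow> ('a \<Rightarrow> 'y) \<Rightarrow> bool" where
  "sequentially_continuous_on K Y g \<longleftrightarrow>
     (\<forall>s t. (\<forall>n. s n \<in> K) \<and> t \<in> K \<and> s \<longlonglongrightarrow> t \<longrightarrow> limitin Y (\<lambda>n. g (s n)) (g t) sequentially)"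

lemma sequentially_continuous_onD:
  "sequentially_continuous_on K Y g \<Longrightarrow> (\<And>n. s n \<in> K) \<Longrightarrow> t \<in> K \<Longrightarrow> s \<longlonglongrightarrow> t \<Longrightarrow>
     limitin Y (\<lambda>n. g (s n)) (g t) sequentially"
  by (simp add: sequentially_continuous_on_def)

lemma continuous_map_imp_sequentially_continuous_on:
  assumes "continuous_map (top_of_set K) Y g"
  shows "sequentially_continuous_on K Y g"
  unfolding sequentially_continuous_on_def
proof (intro allI impI, elim conjE)
  fix s t assume "\<forall>n. s n \<in> K" "t \<in> K" "s \<longlonglongrightarrow> t"
  then have "limitin (top_of_set K) s t sequentially" by (simp add: limitin_subtopology)
  from continuous_map_limit[OF assms this]
  show "limitin Y (\<lambda>n. g (s n)) (g t) sequentially" by (simp add: o_def)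
qed

lemma (in seminorm_topology) sequentially_continuous_on_tendsto:
  assumes "sequentially_continuous_on K \<tau> g" "p \<in> P" "\<And>n. s n \<in> K" "t \<in> K" "s \<longlonglongrightarrow> t"
  shows "(\<lambda>n. p (g (s n) - g t)) \<longlonglongrightarrow> 0"
  using sequentially_continuous_onD[OF assms(1,3,4,5)] assms(2) by (simp add: limitin_iff)

text \<open>A failure yields pairs with \<open>s n - t n\<close> tending to 0 and
  \<open>p\<close>-distance at least \<open>e\<close>; along a subsequence both members converge to
  the same \<open>l\<close>, and the triangle inequality through \<open>g l\<close> is
  contradicted.\<close>

lemma (in seminorm_topology) sequentially_continuous_on_uniformly:
  fixes K :: "real set"
  assumes g: "sequentially_continuous_on K \<tau> g" and p: "p \<in> P" and e: "e > 0" and K: "compact K"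
  obtains d where "d > 0" "\<And>s t. s \<in> K \<Longrightarrow> t \<in> K \<Longrightarrow> \<bar>s - t\<bar> < d \<Longrightarrow> p (g s - g t) < e"
proof -
  note sn = seminorm[OF p]
  have "\<exists>d>0. \<forall>s\<in>K. \<forall>t\<in>K. \<bar>s - t\<bar> < d \<longrightarrow> p (g s - g t) < e"
  proof (rule ccontr)
    assume "\<not> ?thesis"
    then have "\<forall>n. \<exists>s t. s \<in> K \<and> t \<in> K \<and> \<bar>s - t\<bar> < inverse (real (Suc n)) \<and> \<not> p (g s - g t) < e"
      by (metis inverse_positive_iff_positive of_nat_0_less_iff zero_less_Suc)
    then obtain s t where st: "\<And>n. s n \<in> K" "\<And>n. t n \<in> K"
      "\<And>n. \<bar>s n - t n\<bar> < inverse (real (Suc n))" "\<And>n. \<not> p (g (s n) - g (t n)) < e"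
      by metis
    obtain l r where l: "l \<in> K" and r: "strict_mono r" "(s \<circ> r) \<longlonglongrightarrow> l"
      using K st(1) unfolding compact_eq_seq_compact_metric seq_compact_def by meson
    have "(\<lambda>n. s n - t n) \<longlonglongrightarrow> 0"
      by (rule Lim_null_comparison[OF _ LIMSEQ_inverse_real_of_nat])
        (use st(3) in \<open>auto intro!: always_eventually less_imp_le\<close>)
    then have "(\<lambda>n. s (r n) - t (r n)) \<longlonglongrightarrow> 0"
      using LIMSEQ_subseq_LIMSEQ[OF _ r(1)] by (fastforce simp: o_def)
    from tendsto_diff[OF r(2) this] have t: "(\<lambda>n. t (r n)) \<longlonglongrightarrow> l" by (simp add: o_def)
    have "(\<lambda>n. p (g (s (r n)) - g l) + p (g (t (r n)) - g l)) \<longlonglongrightarrow> 0 + 0"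
      using r(2) t l st(1,2)
      by (intro tendsto_add sequentially_continuous_on_tendsto[OF g p]) (auto simp: o_def)
    then have "\<forall>\<^sub>F n in sequentially. p (g (s (r n)) - g l) + p (g (t (r n)) - g l) < e"
      using e by (intro order_tendstoD(2)) auto
    then obtain n where "p (g (s (r n)) - g l) + p (g (t (r n)) - g l) < e"
      by (auto simp: eventually_sequentially)
    then have "p (g (s (r n)) - g (t (r n))) < e"
      using seminorm_triangle[OF sn, of "g (s (r n))" "g (t (r n))" "g l"]
        seminorm_diff_commute[OF sn, of "g l" "g (t (r n))"] by simp
    then show False using st(4) by blast
  qed
  then show ?thesis using that by blast
qed

text \<open>Supplies the tolerances of the estimates below; the factor \<open>c\<close> may vanish,
  hence the denominator \<open>c + 1\<close>.\<close>

lemma exists_small_factor: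
  fixes c e :: real
  assumes "e > 0" "c \<ge> 0"
  shows "\<exists>d>0. c * d < e"
proof (intro exI[of _ "e / (c + 1)"] conjI)
  have "c * e < e * (c + 1)" using assms by (simp add: algebra_simps)
  then show "c * (e / (c + 1)) < e" using assms by (simp add: divide_less_eq add_nonneg_pos)
qed (use assms in simp)

section \<open>Riemann sums over Borel partitions\<close>

definition riemann_sum :: "real set set \<Rightarrow> (real \<Rightarrow> 'x::real_vector) \<Rightarrow> 'x" where
  "riemann_sum \<P> g = (\<Sum>N\<in>\<P>. measure lborel N *\<^sub>R g (SOME t. t \<in> N))"

text \<open>Cells of a partition are nonempty, so the choice in \<open>riemann_sum\<close> is a
  point of the cell and not an arbitrary real.\<close>

lemma partition_on_tag: "partition_on A \<P> \<Longrightarrow> N \<in> \<P> \<Longrightarrow> (SOME t. t \<in> N) \<in> N"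
  by (auto simp: partition_on_def some_in_eq)

text \<open>Applied to the sum, \<open>f\<close> gives the integral of a step function close to
  \<open>f (g t)\<close>. Continuity is asked of the composite alone, so that \<open>f\<close> can
  also be a functional from the Hahn-Banach theorem.\<close>

lemma linear_riemann_sum_approx:
  fixes f :: "'x::real_vector \<Rightarrow> 'b::{banach, second_countable_topology, real_normed_vector}"
  assumes \<P>: "finite \<P>" "partition_on {a..b} \<P>" "\<P> \<subseteq> sets borel" and ab: "a \<le> b"
    and f: "linear f" and cont: "continuous_on {a..b} (\<lambda>t. f (g t))"
    and le: "\<And>N s t. N \<in> \<P> \<Longrightarrow> s \<in> N \<Longrightarrow> t \<in> N \<Longrightarrow> norm (f (g s) - f (g t)) \<le> e"
  shows "norm (f (riemann_sum \<P> g) - (LINT t:{a..b}|lborel. f (g t))) \<le> (b - a) * e"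
proof -
  have sub: "N \<subseteq> {a..b}" and sets: "N \<in> sets borel" if "N \<in> \<P>" for N
    using that \<P>(2,3) by (auto simp: partition_on_def)
  have "f (riemann_sum \<P> g) = (\<Sum>N\<in>\<P>. LINT t:N|lborel. f (g (SOME t. t \<in> N)))"
    unfolding riemann_sum_def linear_sum[OF f] linear_scale[OF f]
    by (intro sum.cong refl set_integral_interval_const(2)[symmetric]) (use sets sub in auto)
  moreover have "norm ((\<Sum>N\<in>\<P>. LINT t:N|lborel. f (g (SOME t. t \<in> N))) - (LINT t:{a..b}|lborel. f (g t)))
      \<le> (b - a) * e"
  proof (rule partition_integral_approx[OF \<P> ab borel_integrable_atLeastAtMost'[OF cont]])
    fix N assume N: "N \<in> \<P>"
    show "set_integrable lborel N (\<lambda>_. f (g (SOME t. t \<in> N)))"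
      by (rule set_integral_interval_const(1)[OF sets[OF N] sub[OF N]])
    show "norm (f (g (SOME t. t \<in> N)) - f (g t)) \<le> e" if "t \<in> N" for t
      by (rule le[OF N partition_on_tag[OF \<P>(2) N] that])
  qed
  ultimately show ?thesis by simp
qed

lemma (in normed_space_over) sublinear_seminorm: "seminorm_on smul p \<Longrightarrow> sublinear p"
  by (rule sublinearI) (auto simp: seminorm_add seminorm_scaleR)

text \<open>A linear functional below \<open>p\<close> that attains \<open>p\<close> at the
  difference reduces the claim to comparing two scalar sums with one scalar integral. This avoids a
  common refinement and any integral of \<open>g\<close> itself, whose existence is still
  open.\<close>

lemma (in seminorm_topology) riemann_sum_diff_le:
  assumes g: "sequentially_continuous_on {a..b} \<tau> g" and p: "p \<in> P" and ab: "a \<le> b"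
    and \<P>: "finite \<P>" "partition_on {a..b} \<P>" "\<P> \<subseteq> sets borel"
    and \<Q>: "finite \<Q>" "partition_on {a..b} \<Q>" "\<Q> \<subseteq> sets borel"
    and le: "\<And>N s t. N \<in> \<P> \<union> \<Q> \<Longrightarrow> s \<in> N \<Longrightarrow> t \<in> N \<Longrightarrow> p (g s - g t) \<le> e"
  shows "p (riemann_sum \<P> g - riemann_sum \<Q> g) \<le> 2 * ((b - a) * e)"
proof -
  note sn = seminorm[OF p]
  obtain f where f: "linear f" "\<And>x. f x \<le> p x"
    "f (riemann_sum \<P> g - riemann_sum \<Q> g) = p (riemann_sum \<P> g - riemann_sum \<Q> g)"
    using sublinear_Hahn_Banach[OF sublinear_seminorm[OF sn]] by metis
  have f_le: "\<bar>f x\<bar> \<le> p x" for x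
    using f(2)[of x] f(2)[of "- x"] by (simp add: linear_neg[OF f(1)] seminorm_minus[OF sn])
  have diff: "norm (f x - f y) \<le> p (x - y)" for x y
    using f_le[of "x - y"] by (simp add: linear_diff[OF f(1)])
  have cont: "continuous_on {a..b} (\<lambda>t. f (g t))"
    unfolding continuous_on_sequentially
  proof (intro allI ballI impI, elim conjE)
    fix s t assume "t \<in> {a..b}" "\<forall>n. s n \<in> {a..b}" "s \<longlonglongrightarrow> t"
    then have "(\<lambda>n. p (g (s n) - g t)) \<longlonglongrightarrow> 0"
      by (intro sequentially_continuous_on_tendsto[OF g p]) auto
    then have "(\<lambda>n. f (g (s n)) - f (g t)) \<longlonglongrightarrow> 0"
      by (rule Lim_null_comparison[rotated]) (use diff in auto)
    then show "((\<lambda>t. f (g t)) \<circ> s) \<longlonglongrightarrow> f (g t)" by (simp add: LIM_zero_iff o_def)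
  qed
  define I where "I = (LINT t:{a..b}|lborel. f (g t))"
  have "norm (f (riemann_sum \<P> g) - I) \<le> (b - a) * e"
    unfolding I_def
    by (rule linear_riemann_sum_approx[OF \<P> ab f(1) cont]) (use order_trans[OF diff le] in blast)
  moreover have "norm (f (riemann_sum \<Q> g) - I) \<le> (b - a) * e"
    unfolding I_def
    by (rule linear_riemann_sum_approx[OF \<Q> ab f(1) cont]) (use order_trans[OF diff le] in blast)
  ultimately have "f (riemann_sum \<P> g) - f (riemann_sum \<Q> g) \<le> 2 * ((b - a) * e)"
    by (simp add: abs_le_iff)
  then show ?thesis using f(3) by (simp add: linear_diff[OF f(1)])
qed

lemma norm_riemann_sum_le:
  fixes g :: "real \<Rightarrow> 'x::real_normed_vector"
  assumes \<P>: "finite \<P>" "partition_on {a..b} \<P>" "\<P> \<subseteq> sets borel" and ab: "a \<le> b"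
    and G: "\<And>t. t \<in> {a..b} \<Longrightarrow> norm (g t) \<le> G"
  shows "norm (riemann_sum \<P> g) \<le> (b - a) * G"
proof -
  have "norm (riemann_sum \<P> g) \<le> (\<Sum>N\<in>\<P>. measure lborel N *\<^sub>R G)"
    unfolding riemann_sum_def
  proof (rule sum_norm_le)
    fix N assume N: "N \<in> \<P>"
    then have "N \<subseteq> {a..b}" using \<P>(2) by (auto simp: partition_on_def)
    with partition_on_tag[OF \<P>(2) N] have "(SOME t. t \<in> N) \<in> {a..b}" by blast
    then show "norm (measure lborel N *\<^sub>R g (SOME t. t \<in> N)) \<le> measure lborel N *\<^sub>R G"
      using G by (auto intro: mult_left_mono)
  qed
  also have "\<dots> = riemann_sum \<P> (\<lambda>_. G)" by (simp add: riemann_sum_def)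
  \<comment> \<open>The Riemann sum of a constant is compared with its integral at tolerance 0, in
    place of adding up the measures of the cells.\<close>
  also have "\<dots> \<le> (b - a) * G"
    using linear_riemann_sum_approx[OF \<P> ab linear_id, of "\<lambda>_. G" 0] ab
    by (simp add: set_integral_interval_const[of _ a b])
  finally show ?thesis .
qed

section \<open>Existence and norm bound of the Pettis integral\<close>

context saks_seminorms
begin

lemma continuous_on_circ_dual:
  fixes K :: "real set"
  assumes g: "sequentially_continuous_on K \<tau> g" and bdd: "bounded (g ` K)"
    and f: "f \<in> circ_dual smul \<tau>"
  shows "continuous_on K (\<lambda>t. f (g t))"
  unfolding continuous_on_sequentially
proof (intro allI ballI impI, elim conjE)
  fix s t assume st: "t \<in> K" "\<forall>n. s n \<in> K" "s \<longlonglongrightarrow> t"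
  have "bounded (range (\<lambda>n. g (s n)))" by (rule bounded_subset[OF bdd]) (use st in auto)
  from circ_dual_tendsto[OF f this sequentially_continuous_onD[OF g _ st(1,3)]]
  show "((\<lambda>t. f (g t)) \<circ> s) \<longlonglongrightarrow> f (g t)" using st(2) by (simp add: o_def)
qed

text \<open>One vector serves all functionals: \<open>y\<close> is the \<tau>-limit of a single
  bounded sequence of Riemann sums, and limits of this kind are exactly what members of
  \<open>circ_dual\<close> respect.\<close>

lemma weak_integral_exists:
  fixes a b :: real
  assumes complete: "sequentially_complete mixed" and ab: "a \<le> b"
    and g: "sequentially_continuous_on {a..b} \<tau> g" and bdd: "bounded (g ` {a..b})"
  obtains y where "\<And>f. f \<in> circ_dual smul \<tau> \<Longrightarrow> f y = (LINT t:{a..b}|lborel. f (g t))"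
proof -
  obtain G where G: "\<And>t. t \<in> {a..b} \<Longrightarrow> norm (g t) \<le> G"
    using bdd unfolding bounded_iff by blast
  have "\<exists>\<P>. finite \<P> \<and> partition_on {a..b} \<P> \<and> \<P> \<subseteq> sets borel \<and>
      (\<forall>N\<in>\<P>. \<forall>s\<in>N. \<forall>t\<in>N. \<bar>s - t\<bar> < inverse (real (Suc n)))" for n
    by (rule fine_borel_partition[of "inverse (real (Suc n))" a b]) auto
  then obtain \<P> where \<P>: "\<And>n. finite (\<P> n)" "\<And>n. partition_on {a..b} (\<P> n)" "\<And>n. \<P> n \<subseteq> sets borel"
    and mesh: "\<And>n N s t. N \<in> \<P> n \<Longrightarrow> s \<in> N \<Longrightarrow> t \<in> N \<Longrightarrow> \<bar>s - t\<bar> < inverse (real (Suc n))"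
    by metis
  have sub: "t \<in> {a..b}" if "N \<in> \<P> n" "t \<in> N" for n N t
    using that \<P>(2)[of n] unfolding partition_on_def by blast
  have mesh_le: "\<exists>n\<^sub>0. \<forall>n\<ge>n\<^sub>0. \<forall>N\<in>\<P> n. \<forall>s\<in>N. \<forall>t\<in>N. \<bar>s - t\<bar> < d" if d: "d > 0" for d
  proof -
    obtain n\<^sub>0 where n0: "inverse (real (Suc n\<^sub>0)) < d" using reals_Archimedean[OF d] by blast
    have "\<bar>s - t\<bar> < d" if "n \<ge> n\<^sub>0" "N \<in> \<P> n" "s \<in> N" "t \<in> N" for n N s t
    proof -
      have "inverse (real (Suc n)) \<le> inverse (real (Suc n\<^sub>0))" using that(1) by (intro le_imp_inverse_le) auto
      then show ?thesis using mesh[OF that(2-)] n0 by linarith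
    qed
    then show ?thesis by blast
  qed
  define R where "R n = riemann_sum (\<P> n) g" for n
  have "norm (R n) \<le> (b - a) * G" for n
    unfolding R_def by (rule norm_riemann_sum_le[OF \<P> ab G])
  then have bddR: "bounded (range R)" unfolding bounded_iff by blast
  have "\<exists>n\<^sub>0. \<forall>m\<ge>n\<^sub>0. \<forall>n\<ge>n\<^sub>0. p (R m - R n) < e" if p: "p \<in> P" and e: "e > 0" for p e
  proof -
    \<comment> \<open>The factor \<open>2 * (b - a)\<close> is the one of
      \<open>riemann_sum_diff_le\<close>.\<close>
    obtain e' where e': "e' > 0" "2 * (b - a) * e' < e"
      using exists_small_factor[of e "2 * (b - a)"] e ab by auto
    obtain d where d: "d > 0" "\<And>s t. s \<in> {a..b} \<Longrightarrow> t \<in> {a..b} \<Longrightarrow> \<bar>s - t\<bar> < d \<Longrightarrow> p (g s - g t) < e'"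
      using sequentially_continuous_on_uniformly[OF g p e'(1)] compact_Icc by metis
    obtain n\<^sub>0 where n0: "\<And>n N s t. n \<ge> n\<^sub>0 \<Longrightarrow> N \<in> \<P> n \<Longrightarrow> s \<in> N \<Longrightarrow> t \<in> N \<Longrightarrow> \<bar>s - t\<bar> < d"
      using mesh_le[OF d(1)] by blast
    have "p (R m - R n) < e" if "m \<ge> n\<^sub>0" "n \<ge> n\<^sub>0" for m n
    proof -
      have "p (g s - g t) \<le> e'" if "N \<in> \<P> m \<union> \<P> n" "s \<in> N" "t \<in> N" for N s t
        using that d(2)[of s t] sub n0 \<open>m \<ge> n\<^sub>0\<close> \<open>n \<ge> n\<^sub>0\<close> by (metis Un_iff less_imp_le)
      then have "p (R m - R n) \<le> 2 * ((b - a) * e')"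
        unfolding R_def by (rule riemann_sum_diff_le[OF g p ab \<P> \<P>])
      then show ?thesis using e'(2) by (simp only: mult.assoc)
    qed
    then show ?thesis by blast
  qed
  from bounded_Cauchy_has_limit[OF complete bddR this]
  obtain y where y: "limitin \<tau> R y sequentially" by metis
  show ?thesis
  proof (rule that[of y])
    fix f assume f: "f \<in> circ_dual smul \<tau>"
    have lin: "linear f" using bounded_linear_circ_dual[OF f] by (rule bounded_linear.linear)
    have cont: "continuous_on {a..b} (\<lambda>t. f (g t))" by (rule continuous_on_circ_dual[OF g bdd f])
    have "(\<lambda>n. f (R n)) \<longlonglongrightarrow> (LINT t:{a..b}|lborel. f (g t))"
    proof (rule tendstoI)
      fix e :: real assume e: "e > 0"
      obtain e' where e': "e' > 0" "(b - a) * e' < e"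
        using exists_small_factor[of e "b - a"] e ab by auto
      obtain d where d: "d > 0" "\<And>s t. s \<in> {a..b} \<Longrightarrow> t \<in> {a..b} \<Longrightarrow> \<bar>s - t\<bar> < d \<Longrightarrow>
          norm (f (g s) - f (g t)) < e'"
        using compact_uniformly_continuous[OF cont compact_Icc] e'(1)
        unfolding uniformly_continuous_on_def by (auto simp: dist_norm)
      obtain n\<^sub>0 where n0: "\<And>n N s t. n \<ge> n\<^sub>0 \<Longrightarrow> N \<in> \<P> n \<Longrightarrow> s \<in> N \<Longrightarrow> t \<in> N \<Longrightarrow> \<bar>s - t\<bar> < d"
        using mesh_le[OF d(1)] by blast
      have "dist (f (R n)) (LINT t:{a..b}|lborel. f (g t)) < e" if n: "n \<ge> n\<^sub>0" for n
      proof -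
        have "norm (f (g s) - f (g t)) \<le> e'" if "N \<in> \<P> n" "s \<in> N" "t \<in> N" for N s t
          using that d(2)[of s t] sub n0 n by (metis less_imp_le)
        then have "dist (f (R n)) (LINT t:{a..b}|lborel. f (g t)) \<le> (b - a) * e'"
          unfolding R_def dist_norm by (rule linear_riemann_sum_approx[OF \<P> ab lin cont])
        then show ?thesis using e'(2) by simp
      qed
      then show "\<forall>\<^sub>F n in sequentially. dist (f (R n)) (LINT t:{a..b}|lborel. f (g t)) < e"
        by (auto simp: eventually_sequentially)
    qed
    moreover have "(\<lambda>n. f (R n)) \<longlonglongrightarrow> f y" by (rule circ_dual_tendsto[OF f bddR y])
    ultimately show "f y = (LINT t:{a..b}|lborel. f (g t))" using LIMSEQ_unique by blast
  qed
qed

text \<open>The definition tests with the \<tau>-dual, which separates points, so the integral is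
  the vector of \<open>weak_integral_exists\<close> and inherits its identity for all of
  \<open>circ_dual\<close>. The norm bound holds because the \<tau>-dual is norming.\<close>

lemma pettis_integral_properties:
  fixes a b :: real
  assumes complete: "sequentially_complete mixed" and ab: "a \<le> b"
    and g: "sequentially_continuous_on {a..b} \<tau> g" and G: "\<And>t. t \<in> {a..b} \<Longrightarrow> norm (g t) \<le> G"
  shows circ_dual_pettis_integral:
      "f \<in> circ_dual smul \<tau> \<Longrightarrow> f (pettis_integral smul \<tau> {a..b} g) = (LINT t:{a..b}|lborel. f (g t))"
    and norm_pettis_integral_le: "norm (pettis_integral smul \<tau> {a..b} g) \<le> (b - a) * G"
proof -
  have bdd: "bounded (g ` {a..b})" using G unfolding bounded_iff by blast
  obtain y where y: "\<And>f. f \<in> circ_dual smul \<tau> \<Longrightarrow> f y = (LINT t:{a..b}|lborel. f (g t))"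
    using weak_integral_exists[OF complete ab g bdd] by metis
  have int: "set_integrable lborel {a..b} (\<lambda>t. f (g t))" if "f \<in> circ_dual smul \<tau>" for f
    by (rule borel_integrable_atLeastAtMost'[OF continuous_on_circ_dual[OF g bdd that]])
  have "pettis_integral smul \<tau> {a..b} g = y"
    unfolding pettis_integral_def
  proof (rule the_equality)
    show "has_pettis_integral smul \<tau> {a..b} g y"
      using y int top_dual_subset_circ_dual by (auto simp: has_pettis_integral_def)
    show "z = y" if "has_pettis_integral smul \<tau> {a..b} g z" for z
    proof (rule top_dual_separates)
      fix f assume f: "f \<in> top_dual smul \<tau>"
      then have "f y = (LINT t:{a..b}|lborel. f (g t))" using y top_dual_subset_circ_dual by blast
      moreover have "f z = (LINT t:{a..b}|lborel. f (g t))"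
        using bspec[OF that[unfolded has_pettis_integral_def] f] by simp
      ultimately show "f z = f y" by simp
    qed
  qed
  then show eq: "f (pettis_integral smul \<tau> {a..b} g) = (LINT t:{a..b}|lborel. f (g t))"
    if "f \<in> circ_dual smul \<tau>" for f using y[OF that] by simp
  show "norm (pettis_integral smul \<tau> {a..b} g) \<le> (b - a) * G"
  proof (rule norm_le_if_top_dual_le)
    fix f assume f: "f \<in> top_dual smul \<tau>" and f1: "onorm f \<le> 1"
    then have f': "f \<in> circ_dual smul \<tau>" using top_dual_subset_circ_dual by blast
    have "norm (f (g t)) \<le> G" if "t \<in> {a..b}" for t
    proof -
      have "norm (f (g t)) \<le> onorm f * norm (g t)" by (rule onorm[OF bounded_linear_top_dual[OF f]])
      also have "\<dots> \<le> 1 * norm (g t)" by (rule mult_right_mono[OF f1]) simp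
      finally show ?thesis using G[OF that] by simp
    qed
    note le = this
    have "norm (LINT t:{a..b}|lborel. f (g t)) \<le> (LINT t:{a..b}|lborel. norm (f (g t)))"
      by (rule set_integral_norm_bound[OF int[OF f']])
    also have "\<dots> \<le> (LINT t:{a..b}|lborel. G)"
      by (intro set_integral_mono set_integrable_norm int[OF f'] le)
        (rule set_integral_interval_const[of _ a b]; simp)+
    also have "\<dots> = (b - a) * G" using ab by (subst set_integral_interval_const[of _ a b]) auto
    finally show "norm (f (pettis_integral smul \<tau> {a..b} g)) \<le> (b - a) * G"
      by (simp add: eq[OF f'])
  qed
qed

end

section \<open>Duality of controllability and observability\<close>

text \<open>The gauge \<open>q y = inf {s + p (y - s k) / e | s \<ge> 0, k \<in> K}\<close> is at most \<open>1\<close> on \<open>K\<close> and at least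
  \<open>1\<close> at every point whose \<open>p\<close>-distance from \<open>K\<close> is at least \<open>e\<close>.\<close>

lemma (in normed_space_over) real_functional_separates:
  assumes p: "seminorm_on smul p" and e: "e > 0"
    and K: "convex K" "0 \<in> K" and far: "\<And>k. k \<in> K \<Longrightarrow> e \<le> p (z - k)"
  obtains f :: "'x \<Rightarrow> real" where "linear f" "\<And>x. f x \<le> p x / e" "\<And>k. k \<in> K \<Longrightarrow> f k \<le> 1" "1 \<le> f z"
proof -
  define G where "G y = {s + p (y - s *\<^sub>R k) / e |s k. 0 \<le> s \<and> k \<in> K}" for y
  define q where "q y = Inf (G y)" for y
  have mem: "s + p (y - s *\<^sub>R k) / e \<in> G y" if "0 \<le> s" "k \<in> K" for s k y
    unfolding G_def using that by blast
  have nonempty: "G y \<noteq> {}" for y using mem[of 0 0 y] K(2) by blast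
  have "0 \<le> c" if c: "c \<in> G y" for c y
  proof -
    obtain s k where "c = s + p (y - s *\<^sub>R k) / e" "0 \<le> s" using c unfolding G_def by blast
    then show ?thesis using seminorm_nonneg[OF p] e by simp
  qed
  then have bdd: "bdd_below (G y)" for y by (rule bdd_belowI)
  have q_le: "q y \<le> s + p (y - s *\<^sub>R k) / e" if "0 \<le> s" "k \<in> K" for s k y
    unfolding q_def by (rule cInf_lower[OF mem[OF that] bdd])
  have q_ge: "c \<le> q y" if c: "\<And>s k. 0 \<le> s \<Longrightarrow> k \<in> K \<Longrightarrow> c \<le> s + p (y - s *\<^sub>R k) / e" for c y
    unfolding q_def
  proof (rule cInf_greatest[OF nonempty])
    fix d assume "d \<in> G y"
    then obtain s k where d: "d = s + p (y - s *\<^sub>R k) / e" "0 \<le> s" "k \<in> K" unfolding G_def by blast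
    show "c \<le> d" unfolding d(1) by (rule c[OF d(2,3)])
  qed
  have "sublinear q"
  proof (rule sublinearI)
    fix x y
    have "q (x + y) - q y \<le> q x"
    proof (rule q_ge)
      fix s k assume s: "(0::real) \<le> s" "k \<in> K"
      have "q (x + y) - (s + p (x - s *\<^sub>R k) / e) \<le> q y"
      proof (rule q_ge)
        fix t l assume t: "(0::real) \<le> t" "l \<in> K"
        \<comment> \<open>By convexity the combination is \<open>s + t\<close> times a point of
          \<open>K\<close>; if both factors vanish, 0 serves as that point.\<close>
        obtain m where m: "m \<in> K" "s *\<^sub>R k + t *\<^sub>R l = (s + t) *\<^sub>R m"
        proof (cases "s + t = 0")
          case True
          then have "s = 0" "t = 0" using s t by auto
          then show ?thesis using that[of 0] K(2) by simp
        next
          case False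
          then have st: "s + t > 0" using s t by simp
          have "(s / (s + t)) *\<^sub>R k + (t / (s + t)) *\<^sub>R l \<in> K"
            by (rule convexD[OF K(1) s(2) t(2)]) (use s t st in \<open>auto simp flip: add_divide_distrib\<close>)
          then show ?thesis using that st by (simp add: scaleR_add_right)
        qed
        have "q (x + y) \<le> (s + t) + p ((x + y) - (s + t) *\<^sub>R m) / e"
          using s t by (intro q_le m(1)) simp
        also have "(x + y) - (s + t) *\<^sub>R m = (x - s *\<^sub>R k) + (y - t *\<^sub>R l)"
          by (simp add: m(2)[symmetric])
        also have "p \<dots> / e \<le> (p (x - s *\<^sub>R k) + p (y - t *\<^sub>R l)) / e"
          using e by (intro divide_right_mono seminorm_add[OF p]) simp
        finally show "q (x + y) - (s + p (x - s *\<^sub>R k) / e) \<le> t + p (y - t *\<^sub>R l) / e"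
          by (simp add: add_divide_distrib)
      qed
      then show "q (x + y) - q y \<le> s + p (x - s *\<^sub>R k) / e" by simp
    qed
    then show "q (x + y) \<le> q x + q y" by simp
  next
    fix t :: real and x assume t: "t > 0"
    have "q (t *\<^sub>R x) / t \<le> q x"
    proof (rule q_ge)
      fix s k assume s: "(0::real) \<le> s" "k \<in> K"
      have "q (t *\<^sub>R x) \<le> t * s + p (t *\<^sub>R x - (t * s) *\<^sub>R k) / e"
        using s t by (intro q_le) auto
      also have "t *\<^sub>R x - (t * s) *\<^sub>R k = t *\<^sub>R (x - s *\<^sub>R k)" by (simp add: scaleR_diff_right)
      finally have "q (t *\<^sub>R x) \<le> t * (s + p (x - s *\<^sub>R k) / e)"
        using t by (simp add: seminorm_scaleR[OF p] distrib_left)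
      then show "q (t *\<^sub>R x) / t \<le> s + p (x - s *\<^sub>R k) / e"
        using t by (simp add: divide_le_eq mult.commute)
    qed
    then show "q (t *\<^sub>R x) \<le> t * q x" using t by (simp add: divide_le_eq mult.commute)
  qed
  then obtain f where f: "linear f" "\<And>x. f x \<le> q x" "f z = q z" using sublinear_Hahn_Banach by metis
  show ?thesis
  proof (rule that[OF f(1)])
    show "f x \<le> p x / e" for x using q_le[of 0 0 x] K(2) f(2)[of x] by simp
    show "f k \<le> 1" if "k \<in> K" for k
      using q_le[of 1 k k] that f(2)[of k] by (simp add: seminorm_zero[OF p])
    show "1 \<le> f z"
      unfolding f(3)
    proof (rule q_ge)
      fix s k assume s: "(0::real) \<le> s" "k \<in> K"
      show "1 \<le> s + p (z - s *\<^sub>R k) / e"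
      \<comment> \<open>For \<open>s < 1\<close> the point \<open>s *\<^sub>R k\<close> is a convex
        combination of \<open>k\<close> and 0, hence in \<open>K\<close> and at
        \<open>p\<close>-distance at least \<open>e\<close> from \<open>z\<close>.\<close>
      proof (cases "s \<ge> 1")
        case True
        then show ?thesis using divide_nonneg_pos[OF seminorm_nonneg[OF p] e] by (simp add: add_increasing2)
      next
        case False
        then have "s *\<^sub>R k + (1 - s) *\<^sub>R 0 \<in> K" using s K by (intro convexD[OF K(1)]) auto
        then have "1 \<le> p (z - s *\<^sub>R k) / e" using far e by simp
        then show ?thesis using s by simp
      qed
    qed
  qed
qed

text \<open>Since \<open>K\<close> is invariant under scalars of norm 1, the real functional is at
  most 1 in absolute value at both \<open>k\<close> and \<open>smul j k\<close>; the two values add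
  up to the bound 2 for \<open>F\<close>.\<close>

lemma (in seminorm_topology) top_dual_separates_balanced:
  assumes p: "p \<in> P" and e: "e > 0"
    and K: "convex K" "0 \<in> K" and bal: "\<And>a k. norm a = 1 \<Longrightarrow> k \<in> K \<Longrightarrow> smul a k \<in> K"
    and far: "\<And>k. k \<in> K \<Longrightarrow> e \<le> p (z - k)"
  obtains F where "F \<in> top_dual smul \<tau>" "\<And>k. k \<in> K \<Longrightarrow> norm (F k) \<le> 2" "1 \<le> norm (F z)"
proof -
  note sn = seminorm[OF p]
  obtain f where f: "linear f" "\<And>x. f x \<le> p x / e" "\<And>k. k \<in> K \<Longrightarrow> f k \<le> 1" "1 \<le> f z"
    using real_functional_separates[OF sn e K far] by metis
  obtain F j where F: "Vector_Spaces.linear smul (*) F" and j: "norm j = 1"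
    and F_ge: "\<And>x. \<bar>f x\<bar> \<le> norm (F x)" and F_le: "\<And>x. norm (F x) \<le> \<bar>f x\<bar> + \<bar>f (smul j x)\<bar>"
    using functional_over_field_exists[OF f(1)] by metis
  have f_abs: "\<bar>f x\<bar> \<le> p x / e" for x
    using f(2)[of x] f(2)[of "- x"] by (simp add: linear_neg[OF f(1)] seminorm_minus[OF sn])
  have minus: "- k \<in> K" if "k \<in> K" for k using bal[of "- 1" k] that by simp
  have f_K: "\<bar>f k\<bar> \<le> 1" if "k \<in> K" for k
    using f(3)[OF that] f(3)[OF minus[OF that]] by (simp add: linear_neg[OF f(1)])
  have "norm (F x) \<le> (2 / e) * p x" for x
    using F_le[of x] f_abs[of x] f_abs[of "smul j x"] by (simp add: seminorm_smul[OF sn] j)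
  then have "F \<in> top_dual smul \<tau>" by (rule top_dual_if_dominated[OF F p])
  moreover have "norm (F k) \<le> 2" if "k \<in> K" for k
    using F_le[of k] f_K[OF that] f_K[OF bal[OF j that]] by simp
  moreover have "1 \<le> norm (F z)" using F_ge[of z] f(4) by simp
  ultimately show ?thesis using that by blast
qed

section \<open>The control system and its input map\<close>

locale control_system = saks_seminorms scaleX P \<tau>X
  for scaleX :: "'k::real_or_complex \<Rightarrow> 'x::banach \<Rightarrow> 'x" and P \<tau>X +
  fixes scaleU :: "'k \<Rightarrow> 'u::banach \<Rightarrow> 'u" and \<tau>U :: "'u topology"
    and S :: "real \<Rightarrow> 'x \<Rightarrow> 'x" and B :: "'u \<Rightarrow> 'x" and T :: real
  assumes complete: "sequentially_complete (mixed_topology scaleX \<tau>X)"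
    and C_seq: "C_sequential (mixed_topology scaleX \<tau>X)"
    and saksU: "saks_space scaleU \<tau>U"
    and bicontinuous: "locally_bicontinuous scaleX \<tau>X S"
    and B: "B \<in> bounded_ops scaleU scaleX"
    and B_continuous: "\<And>N. bounded N \<Longrightarrow> continuous_map (subtopology \<tau>U N) \<tau>X B"
    and T: "T > 0"
begin

sublocale U: normed_space_over scaleU
  using saksU by (simp add: saks_space_def)

lemma linear_topology_U: "linear_topology scaleU \<tau>U"
  using saksU by (simp add: saks_space_def locally_convex_topology_def)

lemma S_bounded_op: "t \<ge> 0 \<Longrightarrow> S t \<in> bounded_ops scaleX scaleX"
  using bicontinuous by (simp add: locally_bicontinuous_def semigroup_ops_def)

lemma bounded_linear_S: "t \<ge> 0 \<Longrightarrow> bounded_linear (S t)"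
  using S_bounded_op[of t] linear_over_imp_linear[OF normed_space_over_axioms normed_space_over_axioms]
  by (intro bounded_linear_if_continuous) (auto simp: bounded_ops_def)

lemma bounded_linear_B: "bounded_linear B"
  using B linear_over_imp_linear[OF U.normed_space_over_axioms normed_space_over_axioms]
  by (intro bounded_linear_if_continuous) (auto simp: bounded_ops_def)

lemma S_smul: "t \<ge> 0 \<Longrightarrow> S t (scaleX a x) = scaleX a (S t x)"
  using S_bounded_op[of t] by (simp add: bounded_ops_def Vector_Spaces.linear_iff)

lemma B_smul: "B (scaleU a u) = scaleX a (B u)"
  using B by (simp add: bounded_ops_def Vector_Spaces.linear_iff)

lemma S_locally_bounded:
  obtains M where "M > 0" "\<And>t x. t \<in> {0..T} \<Longrightarrow> norm (S t x) \<le> M * norm x"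
proof -
  obtain M \<omega> where M: "M \<ge> 1" "\<And>t. t \<ge> 0 \<Longrightarrow> onorm (S t) \<le> M * exp (\<omega> * t)"
    using bicontinuous unfolding locally_bicontinuous_def by blast
  \<comment> \<open>The growth rate may be negative, so \<open>\<bar>\<omega>\<bar> * T\<close> is
    taken to bound \<open>\<omega> * t\<close> on the whole interval.\<close>
  have "norm (S t x) \<le> M * exp (\<bar>\<omega>\<bar> * T) * norm x" if t: "t \<in> {0..T}" for t x
  proof -
    have "\<omega> * t \<le> \<bar>\<omega>\<bar> * T" using t by (intro mult_mono) auto
    then have "M * exp (\<omega> * t) \<le> M * exp (\<bar>\<omega>\<bar> * T)" using M(1) by simp
    then have "onorm (S t) \<le> M * exp (\<bar>\<omega>\<bar> * T)" using M(2)[of t] t by simp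
    then have "onorm (S t) * norm x \<le> M * exp (\<bar>\<omega>\<bar> * T) * norm x" by (rule mult_right_mono) simp
    then show ?thesis using onorm[OF bounded_linear_S, of t x] t by simp
  qed
  then show ?thesis using that[of "M * exp (\<bar>\<omega>\<bar> * T)"] M(1) by simp
qed

text \<open>The difference splits into \<open>S (r (s n))\<close> applied to
  \<open>v (s n) - v t\<close>, small by the locally uniform condition on bounded sequences, and a
  difference along the orbit of \<open>v t\<close>. The time change \<open>r\<close> covers both
  \<open>T - t\<close> in the input map and \<open>t\<close> in the observation.\<close>

lemma sequentially_continuous_on_S:
  fixes K :: "real set"
  assumes v: "sequentially_continuous_on K \<tau>X v" "bounded (v ` K)"
    and r: "continuous_on K r" "r ` K \<subseteq> {0..T}"
  shows "sequentially_continuous_on K \<tau>X (\<lambda>t. S (r t) (v t))"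
  unfolding sequentially_continuous_on_def
proof (intro allI impI, elim conjE)
  fix s t assume s: "\<forall>n. s n \<in> K" "t \<in> K" "s \<longlonglongrightarrow> t"
  have r_mem: "r (s n) \<in> {0..T}" "r t \<in> {0..T}" for n
    using s(1,2) r(2) unfolding image_subset_iff by blast+
  have r_lim: "(\<lambda>n. r (s n)) \<longlonglongrightarrow> r t"
    using r(1) s unfolding continuous_on_sequentially by (auto simp: o_def)
  have vs: "bounded (range (\<lambda>n. v (s n)))" by (rule bounded_subset[OF v(2)]) (use s in auto)
  have v_lim: "limitin \<tau>X (\<lambda>n. v (s n)) (v t) sequentially"
    using sequentially_continuous_onD[OF v(1) _ s(2,3)] s(1) by simp
  have orbit: "sequentially_continuous_on {0..} \<tau>X (\<lambda>\<rho>. S \<rho> (v t))"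
    using bicontinuous
    by (intro continuous_map_imp_sequentially_continuous_on) (simp add: locally_bicontinuous_def)
  show "limitin \<tau>X (\<lambda>n. S (r (s n)) (v (s n))) (S (r t) (v t)) sequentially"
    unfolding limitin_iff
  proof
    fix p assume p: "p \<in> P"
    note sn = seminorm[OF p]
    have 1: "(\<lambda>n. p (S (r (s n)) (v t) - S (r t) (v t))) \<longlonglongrightarrow> 0"
      by (rule sequentially_continuous_on_tendsto[OF orbit p _ _ r_lim]) (use r_mem in auto)
    have 2: "(\<lambda>n. p (S (r (s n)) (v (s n) - v t))) \<longlonglongrightarrow> 0"
    proof (rule tendstoI)
      fix e :: real assume e: "e > 0"
      have "openin \<tau>X (seminorm_ball p 0 e)"
        unfolding seminorm_ball_def by (rule openin_seminorm_ball[OF p])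
      moreover have "0 \<in> seminorm_ball p 0 e" using e by (simp add: seminorm_zero[OF sn])
      ultimately have "\<forall>\<^sub>F n in sequentially. \<forall>\<rho>\<in>{0..T}. S \<rho> (v (s n) - v t) \<in> seminorm_ball p 0 e"
        using bicontinuous vs v_lim T unfolding locally_bicontinuous_def by (meson less_imp_le)
      then show "\<forall>\<^sub>F n in sequentially. dist (p (S (r (s n)) (v (s n) - v t))) 0 < e"
      proof (rule eventually_mono)
        fix n assume "\<forall>\<rho>\<in>{0..T}. S \<rho> (v (s n) - v t) \<in> seminorm_ball p 0 e"
        with r_mem(1) have "S (r (s n)) (v (s n) - v t) \<in> seminorm_ball p 0 e" by blast
        then show "dist (p (S (r (s n)) (v (s n) - v t))) 0 < e"
          using seminorm_nonneg[OF sn] by simp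
      qed
    qed
    have diff: "S (r (s n)) (v (s n) - v t) = S (r (s n)) (v (s n)) - S (r (s n)) (v t)" for n
      by (rule linear_diff[OF bounded_linear.linear[OF bounded_linear_S]]) (use r_mem(1)[of n] in simp)
    have le: "norm (p (S (r (s n)) (v (s n)) - S (r t) (v t)))
        \<le> p (S (r (s n)) (v (s n) - v t)) + p (S (r (s n)) (v t) - S (r t) (v t))" for n
      unfolding diff real_norm_def abs_of_nonneg[OF seminorm_nonneg[OF sn]]
      by (rule seminorm_triangle[OF sn])
    have sum: "(\<lambda>n. p (S (r (s n)) (v (s n) - v t)) + p (S (r (s n)) (v t) - S (r t) (v t))) \<longlonglongrightarrow> 0"
      using tendsto_add[OF 2 1] by simp
    show "(\<lambda>n. p (S (r (s n)) (v (s n)) - S (r t) (v t))) \<longlonglongrightarrow> 0"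
      by (rule Lim_null_comparison[OF always_eventually[OF allI[OF le]] sum])
  qed
qed

lemma bounded_control: "u \<in> controls \<tau>U T \<Longrightarrow> bounded (u ` {0..T})"
  by (simp add: controls_def)

lemma norm_control_le: "u \<in> controls \<tau>U T \<Longrightarrow> t \<in> {0..T} \<Longrightarrow> norm (u t) \<le> control_norm T u"
  unfolding control_norm_def
  by (rule cSUP_upper) (auto dest!: bounded_control simp: bounded_norm_comp intro: bounded_imp_bdd_above)

lemma control_norm_le: "(\<And>t. t \<in> {0..T} \<Longrightarrow> norm (u t) \<le> c) \<Longrightarrow> control_norm T u \<le> c"
  unfolding control_norm_def using T by (intro cSUP_least) auto

lemma control_add:
  assumes "u \<in> controls \<tau>U T" "v \<in> controls \<tau>U T"
  shows "(\<lambda>t. u t + v t) \<in> controls \<tau>U T"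
proof -
  have "continuous_map (top_of_set {0..T}) (prod_topology \<tau>U \<tau>U) (\<lambda>t. (u t, v t))"
    using assms by (simp add: controls_def continuous_map_pairedI)
  then have "continuous_map (top_of_set {0..T}) \<tau>U ((\<lambda>(x, y). x + y) \<circ> (\<lambda>t. (u t, v t)))"
    by (rule continuous_map_compose) (use linear_topology_U in \<open>simp add: linear_topology_def\<close>)
  then show ?thesis using assms by (simp add: controls_def o_def bounded_plus_comp)
qed

lemma control_smul:
  assumes "u \<in> controls \<tau>U T"
  shows "(\<lambda>t. scaleU a (u t)) \<in> controls \<tau>U T"
proof -
  have "continuous_map (top_of_set {0..T}) (prod_topology euclidean \<tau>U) (\<lambda>t. (a, u t))"
    using assms by (simp add: controls_def continuous_map_pairedI)
  then have "continuous_map (top_of_set {0..T}) \<tau>U ((\<lambda>(a, x). scaleU a x) \<circ> (\<lambda>t. (a, u t)))"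
    by (rule continuous_map_compose) (use linear_topology_U in \<open>simp add: linear_topology_def\<close>)
  moreover have "bounded ((\<lambda>t. scaleU a (u t)) ` {0..T})"
  proof -
    have "norm (scaleU a (u t)) \<le> norm a * control_norm T u" if "t \<in> {0..T}" for t
      using norm_control_le[OF assms that] by (simp add: U.norm_smul mult_left_mono)
    then show ?thesis unfolding bounded_iff by blast
  qed
  ultimately show ?thesis by (simp add: controls_def o_def)
qed

lemma control_zero: "(\<lambda>_. 0) \<in> controls \<tau>U T"
  using linear_topology_U by (auto simp: controls_def linear_topology_def image_constant_conv)

text \<open>A control stays in the bounded set \<open>N\<close> of its values, and on such sets
  \<open>B\<close> is continuous between the coarse topologies.\<close>

lemma sequentially_continuous_on_B:
  assumes u: "u \<in> controls \<tau>U T"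
  shows "sequentially_continuous_on {0..T} \<tau>X (\<lambda>t. B (u t))" "bounded ((\<lambda>t. B (u t)) ` {0..T})"
proof -
  define N where "N = u ` {0..T}"
  have N: "bounded N" using bounded_control[OF u] by (simp add: N_def)
  have "continuous_map (top_of_set {0..T}) (subtopology \<tau>U N) u"
    using u by (auto simp: controls_def continuous_map_in_subtopology N_def)
  from continuous_map_compose[OF this B_continuous[OF N]]
  have "continuous_map (top_of_set {0..T}) \<tau>X (\<lambda>t. B (u t))" by (simp add: o_def)
  then show "sequentially_continuous_on {0..T} \<tau>X (\<lambda>t. B (u t))"
    by (rule continuous_map_imp_sequentially_continuous_on)
  show "bounded ((\<lambda>t. B (u t)) ` {0..T})"
    using bounded_linear_image[OF N bounded_linear_B] by (simp add: N_def image_image)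
qed

lemma SB_bound:
  obtains M where "M > 0" "\<And>t w. t \<in> {0..T} \<Longrightarrow> norm (S t (B w)) \<le> M * norm w"
proof -
  obtain M where M: "M > 0" "\<And>t x. t \<in> {0..T} \<Longrightarrow> norm (S t x) \<le> M * norm x"
    using S_locally_bounded by metis
  obtain L where L: "L > 0" "\<And>w. norm (B w) \<le> norm w * L"
    using bounded_linear.pos_bounded[OF bounded_linear_B] by metis
  have "norm (S t (B w)) \<le> (M * L) * norm w" if "t \<in> {0..T}" for t w
  proof -
    have "norm (S t (B w)) \<le> M * norm (B w)" by (rule M(2)[OF that])
    also have "\<dots> \<le> M * (norm w * L)" using M(1) L(2) by (intro mult_left_mono) auto
    finally show ?thesis by (simp add: algebra_simps)
  qed
  then show ?thesis using that[of "M * L"] M(1) L(1) by simp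
qed

lemma sequentially_continuous_on_SB:
  assumes u: "u \<in> controls \<tau>U T" and r: "continuous_on {0..T} r" "r ` {0..T} \<subseteq> {0..T}"
  shows "sequentially_continuous_on {0..T} \<tau>X (\<lambda>t. S (r t) (B (u t)))"
    and "bounded ((\<lambda>t. S (r t) (B (u t))) ` {0..T})"
proof -
  show "sequentially_continuous_on {0..T} \<tau>X (\<lambda>t. S (r t) (B (u t)))"
    by (rule sequentially_continuous_on_S[OF sequentially_continuous_on_B[OF u] r])
  obtain M where M: "M > 0" "\<And>t w. t \<in> {0..T} \<Longrightarrow> norm (S t (B w)) \<le> M * norm w"
    using SB_bound by metis
  have "norm (S (r t) (B (u t))) \<le> M * control_norm T u" if t: "t \<in> {0..T}" for t
  proof -
    have "r t \<in> {0..T}" using r(2) t by blast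
    then have "norm (S (r t) (B (u t))) \<le> M * norm (u t)" by (rule M(2))
    also have "\<dots> \<le> M * control_norm T u" using M(1) norm_control_le[OF u t] by simp
    finally show ?thesis .
  qed
  then show "bounded ((\<lambda>t. S (r t) (B (u t))) ` {0..T})" unfolding bounded_iff by blast
qed

lemma reversal: "continuous_on {0..T} (\<lambda>t. T - t)" "(\<lambda>t. T - t) ` {0..T} \<subseteq> {0..T}"
  by (auto intro!: continuous_intros)

abbreviation input where "input \<equiv> input_map scaleX \<tau>X S B T"

lemma circ_dual_input:
  assumes u: "u \<in> controls \<tau>U T" and f: "f \<in> circ_dual scaleX \<tau>X"
  shows "set_integrable lborel {0..T} (\<lambda>t. f (S (T - t) (B (u t))))"
    and "f (input u) = (LINT t:{0..T}|lborel. f (S (T - t) (B (u t))))"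
proof -
  note g = sequentially_continuous_on_SB[OF u reversal]
  show "set_integrable lborel {0..T} (\<lambda>t. f (S (T - t) (B (u t))))"
    by (rule borel_integrable_atLeastAtMost'[OF continuous_on_circ_dual[OF g f]])
  obtain G where "\<And>t. t \<in> {0..T} \<Longrightarrow> norm (S (T - t) (B (u t))) \<le> G"
    using g(2) unfolding bounded_iff by blast
  from circ_dual_pettis_integral[OF complete _ g(1) this f] T
  show "f (input u) = (LINT t:{0..T}|lborel. f (S (T - t) (B (u t))))"
    by (simp add: input_map_def)
qed

text \<open>Bounds every state reachable at a given cost before a particular control is selected;
  the constant is \<open>T\<close> times the bound for \<open>S t\<close> composed with
  \<open>B\<close>.\<close>

lemma input_bound:
  obtains L where "L > 0" "\<And>u. u \<in> controls \<tau>U T \<Longrightarrow> norm (input u) \<le> L * control_norm T u"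
proof -
  obtain M where M: "M > 0" "\<And>t w. t \<in> {0..T} \<Longrightarrow> norm (S t (B w)) \<le> M * norm w"
    using SB_bound by metis
  have "norm (input u) \<le> (T * M) * control_norm T u" if u: "u \<in> controls \<tau>U T" for u
  proof -
    have "norm (S (T - t) (B (u t))) \<le> M * control_norm T u" if t: "t \<in> {0..T}" for t
    proof -
      have "norm (S (T - t) (B (u t))) \<le> M * norm (u t)" using t by (intro M(2)) simp
      also have "\<dots> \<le> M * control_norm T u" using M(1) norm_control_le[OF u t] by simp
      finally show ?thesis .
    qed
    from norm_pettis_integral_le[OF complete _ sequentially_continuous_on_SB(1)[OF u reversal] this] T
    show ?thesis by (simp add: input_map_def mult.assoc)
  qed
  then show ?thesis using that[of "T * M"] M(1) T by simp
qed

lemma top_dual_circ: "f \<in> top_dual scaleX \<tau>X \<Longrightarrow> f \<in> circ_dual scaleX \<tau>X"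
  using top_dual_subset_circ_dual by blast

text \<open>The \<tau>-dual separates points, so additivity of the vector integral can be read off
  from the scalar integrals.\<close>

lemma input_add:
  assumes u: "u \<in> controls \<tau>U T" and v: "v \<in> controls \<tau>U T"
  shows "input (\<lambda>t. u t + v t) = input u + input v"
proof (rule top_dual_separates)
  fix f assume f: "f \<in> top_dual scaleX \<tau>X"
  note f' = top_dual_circ[OF f]
  have lin: "linear f" by (rule linear_functional_imp_linear[OF linear_top_dual[OF f]])
  have "f (input (\<lambda>t. u t + v t)) = (LINT t:{0..T}|lborel. f (S (T - t) (B (u t + v t))))"
    by (rule circ_dual_input(2)[OF control_add[OF u v] f'])
  also have "\<dots> = (LINT t:{0..T}|lborel. f (S (T - t) (B (u t))) + f (S (T - t) (B (v t))))"
    by (rule set_lebesgue_integral_cong)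
      (auto simp: linear_add[OF bounded_linear.linear[OF bounded_linear_B]]
        linear_add[OF bounded_linear.linear[OF bounded_linear_S]] linear_add[OF lin])
  also have "\<dots> = f (input u) + f (input v)"
    unfolding circ_dual_input(2)[OF u f'] circ_dual_input(2)[OF v f']
    by (rule set_integral_add(2)[OF circ_dual_input(1)[OF u f'] circ_dual_input(1)[OF v f']])
  finally show "f (input (\<lambda>t. u t + v t)) = f (input u + input v)" by (simp add: linear_add[OF lin])
qed

lemma input_smul:
  assumes u: "u \<in> controls \<tau>U T"
  shows "input (\<lambda>t. scaleU a (u t)) = scaleX a (input u)"
proof (rule top_dual_separates)
  fix f assume f: "f \<in> top_dual scaleX \<tau>X"
  note f' = top_dual_circ[OF f]
  have smul: "f (scaleX a x) = a * f x" for a x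
    using linear_top_dual[OF f] by (simp add: linear_iff_field)
  have "f (input (\<lambda>t. scaleU a (u t))) = (LINT t:{0..T}|lborel. f (S (T - t) (B (scaleU a (u t)))))"
    by (rule circ_dual_input(2)[OF control_smul[OF u] f'])
  also have "\<dots> = (LINT t:{0..T}|lborel. a * f (S (T - t) (B (u t))))"
    by (rule set_lebesgue_integral_cong) (auto simp: B_smul S_smul smul)
  also have "\<dots> = a * f (input u)"
    unfolding circ_dual_input(2)[OF u f'] by (rule set_integral_mult_right)
  finally show "f (input (\<lambda>t. scaleU a (u t))) = f (scaleX a (input u))" by (simp add: smul)
qed

lemma mild_solution_final: "mild_solution scaleX \<tau>X S B x u T = S T x + input u"
  by (simp add: mild_solution_def input_map_def)

end

section \<open>The two implications between controllability and observability\<close>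

context control_system
begin

abbreviation dual_norm where
  "dual_norm f \<equiv> control_dual_norm \<tau>U T (circ_op input f)"

lemma dual_norm_ge:
  assumes "u \<in> controls \<tau>U T" "control_norm T u \<le> 1"
  shows "ennreal (norm (f (input u))) \<le> dual_norm f"
  unfolding control_dual_norm_def circ_op_def o_def
  by (rule SUP_upper2[of u]) (use assms in auto)

lemma dual_norm_le:
  assumes "\<And>u. u \<in> controls \<tau>U T \<Longrightarrow> control_norm T u \<le> 1 \<Longrightarrow> ennreal (norm (f (input u))) \<le> c"
  shows "dual_norm f \<le> c"
  unfolding control_dual_norm_def circ_op_def o_def by (rule SUP_least) (use assms in auto)

text \<open>Rescale the control by \<open>inverse c\<close>. The bound \<open>c\<close> is kept
  apart from \<open>control_norm T u\<close>, which may be 0.\<close>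

lemma norm_input_le_dual_norm:
  assumes f: "f \<in> circ_dual scaleX \<tau>X" and n: "dual_norm f = ennreal n" "n \<ge> 0"
    and u: "u \<in> controls \<tau>U T" "control_norm T u \<le> c" and c: "c > 0"
  shows "norm (f (input u)) \<le> c * n"
proof -
  define v where "v t = scaleU (of_real (inverse c)) (u t)" for t
  have v: "v \<in> controls \<tau>U T" unfolding v_def by (rule control_smul[OF u(1)])
  have "control_norm T v \<le> 1"
  proof (rule control_norm_le)
    fix t assume "t \<in> {0..T}"
    then have "norm (u t) \<le> c" using norm_control_le[OF u(1)] u(2) by (meson order_trans)
    moreover have "v t = inverse c *\<^sub>R u t" unfolding v_def by (rule U.smul_of_real)
    ultimately show "norm (v t) \<le> 1" using c by (simp add: field_simps)
  qed
  from dual_norm_ge[OF v this, of f] have "norm (f (input v)) \<le> n" using n by simp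
  moreover have "f (input v) = of_real (inverse c) * f (input u)"
    unfolding v_def input_smul[OF u(1)] using circ_dual_linear[OF f] by (simp add: linear_iff_field)
  then have "norm (f (input v)) = inverse c * norm (f (input u))"
    using c by (simp add: norm_mult del: of_real_inverse)
  ultimately show ?thesis using c by (simp add: field_simps)
qed

lemma bounded_linear_circ_S: "f \<in> circ_dual scaleX \<tau>X \<Longrightarrow> bounded_linear (circ_op (S T) f)"
  unfolding circ_op_def
  using bounded_linear_compose[OF bounded_linear_circ_dual bounded_linear_S] T by (simp add: o_def)

text \<open>In \<open>f (S T x) = f (S T x + input u) - f (input u)\<close> the first term is small
  and the second is at most cost times dual norm. With \<open>C + 1\<close> in place of
  \<open>C\<close> the cost bound \<open>c\<close> stays positive even for \<open>C = 0\<close>, and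
  an infinite dual norm is not multiplied by 0.\<close>

lemma controllable_imp_observable:
  assumes "cost_uniform_approx_null_controllable scaleX \<tau>X P \<tau>U S B T"
  shows "final_state_observable scaleX \<tau>X \<tau>U S B T"
proof -
  obtain C where C: "C \<ge> 0" and ctrl: "\<And>x e p. e > 0 \<Longrightarrow> p \<in> P \<Longrightarrow>
      \<exists>u\<in>controls \<tau>U T. control_norm T u \<le> C * norm x \<and> p (S T x + input u) \<le> e"
    using assms unfolding cost_uniform_approx_null_controllable_def mild_solution_final by blast
  obtain L where L: "L > 0" "\<And>u. u \<in> controls \<tau>U T \<Longrightarrow> norm (input u) \<le> L * control_norm T u"
    using input_bound by metis
  have "ennreal (onorm (circ_op (S T) f)) \<le> ennreal (C + 1) * dual_norm f"
    if f: "f \<in> circ_dual scaleX \<tau>X" for f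
  proof (cases "dual_norm f")
    case top
    then show ?thesis using C by (simp add: ennreal_mult_top)
  next
    case (real n)
    have lin: "linear f" using bounded_linear_circ_dual[OF f] by (rule bounded_linear.linear)
    have "norm (circ_op (S T) f x) \<le> ((C + 1) * n) * norm x" for x
    proof (cases "x = 0")
      case True
      then show ?thesis
        using linear_0[OF bounded_linear.linear[OF bounded_linear_circ_S[OF f]]] by simp
    next
      case False
      define c where "c = (C + 1) * norm x"
      have c: "c > 0" using C False by (simp add: c_def)
      show ?thesis
      proof (rule field_le_epsilon)
        fix e :: real assume e: "e > 0"
        \<comment> \<open>\<open>R\<close> has to be fixed before \<open>p\<close> and
          \<open>d\<close>, and the control comes only after these; a cost independent of the
          seminorm and of the tolerance makes this order possible.\<close>
        define R where "R = norm (S T x) + L * c"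
        obtain p d where p: "p \<in> P" "d > 0" "\<And>z. p z < d \<Longrightarrow> norm z \<le> R \<Longrightarrow> norm (f z) < e"
          using circ_dual_small_on_bounded[OF C_seq f e, of R] by metis
        obtain u where u: "u \<in> controls \<tau>U T" "control_norm T u \<le> C * norm x"
          "p (S T x + input u) \<le> d / 2"
          using ctrl[of "d / 2" p x] p(1,2) by auto
        have uc: "control_norm T u \<le> c" using u(2) by (simp add: c_def distrib_right add_increasing2)
        have "norm (input u) \<le> L * c"
          using order_trans[OF L(2)[OF u(1)] mult_left_mono[OF uc, of L]] L(1) by simp
        then have "norm (S T x + input u) \<le> R"
          unfolding R_def using norm_triangle_ineq[of "S T x" "input u"] by simp
        moreover have "p (S T x + input u) < d" using u(3) p(2) by simp
        ultimately have "norm (f (S T x + input u)) < e" by (intro p(3))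
        moreover have "norm (f (input u)) \<le> c * n"
          by (rule norm_input_le_dual_norm[OF f _ _ u(1) uc c]) (use real in auto)
        moreover have "f (S T x) = f (S T x + input u) - f (input u)"
          by (simp add: linear_add[OF lin])
        ultimately have "norm (f (S T x)) \<le> c * n + e"
          using norm_triangle_ineq4[of "f (S T x + input u)" "f (input u)"] by simp
        then show "norm (circ_op (S T) f x) \<le> (C + 1) * n * norm x + e"
          by (simp add: circ_op_def c_def algebra_simps)
      qed
    qed
    then have "onorm (circ_op (S T) f) \<le> (C + 1) * n"
      using real C by (intro onorm_bound) auto
    then have "ennreal (onorm (circ_op (S T) f)) \<le> ennreal ((C + 1) * n)" by (rule ennreal_leI)
    also have "\<dots> = ennreal (C + 1) * dual_norm f" using real C by (simp only: ennreal_mult)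
    finally show ?thesis .
  qed
  then show ?thesis
    unfolding final_state_observable_def using C by (intro exI[of _ "C + 1"]) auto
qed

text \<open>If no control works, a functional \<open>F\<close> is bounded by 2 on the states
  reachable at cost \<open>c\<close> and has norm at least 1 at \<open>S T x\<close>. Its dual norm
  is then at most \<open>2 / c\<close>, and observability gives
  \<open>c \<le> 2 * C * norm x\<close>, which is impossible for
  \<open>c = (2 * C + 1) * norm x\<close> with \<open>x\<close> nonzero.\<close>

lemma observable_imp_controllable:
  assumes "final_state_observable scaleX \<tau>X \<tau>U S B T"
  shows "cost_uniform_approx_null_controllable scaleX \<tau>X P \<tau>U S B T"
proof -
  obtain C where C: "C \<ge> 0" and obs: "\<And>f. f \<in> circ_dual scaleX \<tau>X \<Longrightarrow>
      ennreal (onorm (circ_op (S T) f)) \<le> ennreal C * dual_norm f"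
    using assms unfolding final_state_observable_def by blast
  have "\<exists>u\<in>controls \<tau>U T. control_norm T u \<le> (2 * C + 1) * norm x \<and> p (S T x + input u) \<le> e"
    if e: "e > 0" and p: "p \<in> P" for x e p
  proof (rule ccontr)
    assume no: "\<not> ?thesis"
    note sn = seminorm[OF p]
    define c where "c = (2 * C + 1) * norm x"
    have c0: "c \<ge> 0" using C by (simp add: c_def)
    define K where "K = {input u |u. u \<in> controls \<tau>U T \<and> control_norm T u \<le> c}"
    have mem: "input u \<in> K" if "u \<in> controls \<tau>U T" "\<And>t. t \<in> {0..T} \<Longrightarrow> norm (u t) \<le> c" for u
      unfolding K_def using that control_norm_le by blast
    have memE: "\<exists>u\<in>controls \<tau>U T. k = input u \<and> (\<forall>t\<in>{0..T}. norm (u t) \<le> c)" if "k \<in> K" for k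
      using that norm_control_le order_trans unfolding K_def by blast
    have "convex K"
    proof (rule convexI)
      fix k l and a b :: real assume "k \<in> K" "l \<in> K" and ab: "a \<ge> 0" "b \<ge> 0" "a + b = 1"
      then obtain u v where u: "u \<in> controls \<tau>U T" "k = input u" "\<And>t. t \<in> {0..T} \<Longrightarrow> norm (u t) \<le> c"
        and v: "v \<in> controls \<tau>U T" "l = input v" "\<And>t. t \<in> {0..T} \<Longrightarrow> norm (v t) \<le> c"
        using memE by metis
      have "a *\<^sub>R k + b *\<^sub>R l = input (\<lambda>t. scaleU (of_real a) (u t) + scaleU (of_real b) (v t))"
        unfolding u(2) v(2) input_add[OF control_smul[OF u(1)] control_smul[OF v(1)]]
          input_smul[OF u(1)] input_smul[OF v(1)] by (simp add: smul_of_real)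
      also have "\<dots> \<in> K"
      proof (rule mem[OF control_add[OF control_smul[OF u(1)] control_smul[OF v(1)]]])
        fix t assume t: "t \<in> {0..T}"
        have "a *\<^sub>R u t + b *\<^sub>R v t \<in> cball 0 c"
          using u(3)[OF t] v(3)[OF t] ab by (intro convexD[OF convex_cball]) auto
        then show "norm (scaleU (of_real a) (u t) + scaleU (of_real b) (v t)) \<le> c"
          by (simp add: U.smul_of_real)
      qed
      finally show "a *\<^sub>R k + b *\<^sub>R l \<in> K" .
    qed
    moreover have "0 \<in> K"
    proof -
      have "input (\<lambda>_. 0) = scaleX 0 (input (\<lambda>_. 0))"
        using input_smul[OF control_zero, of 0] by simp
      then show ?thesis using mem[OF control_zero] c0 by simp
    qed
    moreover have "scaleX a k \<in> K" if a: "norm a = 1" and k: "k \<in> K" for a k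
    proof -
      obtain u where u: "u \<in> controls \<tau>U T" "k = input u" "\<And>t. t \<in> {0..T} \<Longrightarrow> norm (u t) \<le> c"
        using memE[OF k] by metis
      show ?thesis
        unfolding u(2) input_smul[OF u(1), symmetric]
        by (rule mem[OF control_smul[OF u(1)]]) (simp add: U.norm_smul a u(3))
    qed
    moreover have "e \<le> p (- S T x - k)" if k: "k \<in> K" for k
    proof -
      obtain u where u: "u \<in> controls \<tau>U T" "control_norm T u \<le> c" "k = input u"
        using k unfolding K_def by blast
      then have "e < p (S T x + k)" using no unfolding c_def by force
      then show ?thesis using seminorm_minus[OF sn, of "S T x + k"] by simp
    qed
    ultimately obtain F where F: "F \<in> top_dual scaleX \<tau>X" "\<And>k. k \<in> K \<Longrightarrow> norm (F k) \<le> 2"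
      and "1 \<le> norm (F (- S T x))"
      using top_dual_separates_balanced[OF p e, of K "- S T x"] by metis
    note F' = top_dual_circ[OF F(1)]
    have "1 \<le> norm (circ_op (S T) F x)"
      using \<open>1 \<le> norm (F (- S T x))\<close> linear_neg[OF bounded_linear.linear[OF bounded_linear_circ_dual[OF F']]]
      by (simp add: circ_op_def)
    then have one_le: "1 \<le> onorm (circ_op (S T) F) * norm x"
      using onorm[OF bounded_linear_circ_S[OF F'], of x] by simp
    \<comment> \<open>Separation excludes \<open>x = 0\<close>, which the definition of
      \<open>K\<close> still allowed; from here on division by \<open>c\<close> is
      legitimate.\<close>
    then have x: "norm x > 0" by (cases "x = 0") auto
    then have c: "c > 0" using C by (simp add: c_def)
    have "dual_norm F \<le> ennreal (2 / c)"
    proof (rule dual_norm_le)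
      fix u assume u: "u \<in> controls \<tau>U T" "control_norm T u \<le> 1"
      have "input (\<lambda>t. scaleU (of_real c) (u t)) \<in> K"
      proof (rule mem[OF control_smul[OF u(1)]])
        fix t assume "t \<in> {0..T}"
        then have "norm (u t) \<le> 1" using norm_control_le[OF u(1)] u(2) by (meson order_trans)
        then show "norm (scaleU (of_real c) (u t)) \<le> c"
          using c mult_left_mono[of "norm (u t)" 1 c] by (simp add: U.norm_smul)
      qed
      then have "norm (F (scaleX (of_real c) (input u))) \<le> 2"
        using F(2) by (simp add: input_smul[OF u(1)])
      moreover have "F (scaleX (of_real c) (input u)) = of_real c * F (input u)"
        using linear_top_dual[OF F(1)] by (simp add: linear_iff_field)
      ultimately have "norm (F (input u)) \<le> 2 / c"
        using c by (simp add: norm_mult pos_le_divide_eq mult.commute)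
      then show "ennreal (norm (F (input u))) \<le> ennreal (2 / c)" by (rule ennreal_leI)
    qed
    then have "ennreal C * dual_norm F \<le> ennreal C * ennreal (2 / c)" by (rule mult_left_mono) simp
    also have "\<dots> = ennreal (C * (2 / c))" using C c by (intro ennreal_mult[symmetric]) auto
    finally have "ennreal (onorm (circ_op (S T) F)) \<le> ennreal (C * (2 / c))"
      using obs[OF F'] order_trans by blast
    then have "onorm (circ_op (S T) F) \<le> C * (2 / c)"
      using C c by (subst (asm) ennreal_le_iff) auto
    then have "1 \<le> C * (2 / c) * norm x"
      using order_trans[OF one_le mult_right_mono[of _ "C * (2 / c)" "norm x"]] by simp
    then have "c \<le> 2 * C * norm x" using c by (simp add: field_simps)
    then show False using x by (simp add: c_def algebra_simps)
  qed
  then show ?thesis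
    unfolding cost_uniform_approx_null_controllable_def mild_solution_final
    using C by (intro exI[of _ "2 * C + 1"]) auto
qed

theorem controllable_iff_observable:
  "cost_uniform_approx_null_controllable scaleX \<tau>X P \<tau>U S B T \<longleftrightarrow>
     final_state_observable scaleX \<tau>X \<tau>U S B T"
  using controllable_imp_observable observable_imp_controllable by blast

end

section \<open>The observation measure\<close>

text \<open>Inner regularity gives closed sets inside the cells. Urysohn functions that are 1 on one
  of them and 0 on the others glue the values \<open>w N\<close> continuously.\<close>

lemma continuous_approx_of_step_function:
  fixes w :: "real set \<Rightarrow> 'u::real_normed_vector"
  assumes \<P>: "finite \<P>" "partition_on A \<P>" "\<P> \<subseteq> sets borel"
    and w: "\<And>N. N \<in> \<P> \<Longrightarrow> norm (w N) \<le> 1" and e: "e > 0"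
  obtains u C where "continuous_on UNIV u" "\<And>t. norm (u t) \<le> 1"
    "\<And>N t. N \<in> \<P> \<Longrightarrow> t \<in> C N \<Longrightarrow> u t = w N"
    "\<And>N. N \<in> \<P> \<Longrightarrow> C N \<in> sets borel \<and> C N \<subseteq> N \<and> emeasure lborel (N - C N) < ennreal e"
proof -
  have "\<exists>C. closed C \<and> C \<subseteq> N \<and> emeasure lborel (N - C) < ennreal e" if N: "N \<in> \<P>" for N
  proof -
    have b: "N \<in> sets borel" using N \<P>(3) by blast
    then have "N \<in> sets lebesgue" by simp
    from sets_lebesgue_inner_closed[OF this e] obtain C
      where C: "closed C" "C \<subseteq> N" "emeasure lebesgue (N - C) < ennreal e" by metis
    have "N - C \<in> sets lborel" using b C(1) by auto
    then show ?thesis using C by auto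
  qed
  then obtain C where C: "\<And>N. N \<in> \<P> \<Longrightarrow> closed (C N)" "\<And>N. N \<in> \<P> \<Longrightarrow> C N \<subseteq> N"
    "\<And>N. N \<in> \<P> \<Longrightarrow> emeasure lborel (N - C N) < ennreal e" by metis
  have "\<exists>g::real \<Rightarrow> real. continuous_on UNIV g \<and> (\<forall>t\<in>C N. g t = 1) \<and>
      (\<forall>N'\<in>\<P> - {N}. \<forall>t\<in>C N'. g t = 0)" if N: "N \<in> \<P>" for N
  proof -
    define D where "D = (\<Union>N'\<in>\<P> - {N}. C N')"
    have "closed D" unfolding D_def using \<P>(1) C(1) by (intro closed_UN) auto
    moreover have "C N \<inter> N' = {}" if "N' \<in> \<P> - {N}" for N'
      using that N C(2)[OF N] \<P>(2) unfolding partition_on_def disjoint_def by blast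
    then have "C N \<inter> D = {}" unfolding D_def using C(2) by blast
    ultimately obtain g :: "real \<Rightarrow> real" where "continuous_on UNIV g"
      "\<And>t. t \<in> C N \<Longrightarrow> g t = 1" "\<And>t. t \<in> D \<Longrightarrow> g t = 0"
      using Urysohn[OF C(1)[OF N], of D 1 0] by metis
    then show ?thesis unfolding D_def by blast
  qed
  then obtain g :: "real set \<Rightarrow> real \<Rightarrow> real" where g: "\<And>N. N \<in> \<P> \<Longrightarrow> continuous_on UNIV (g N)"
    "\<And>N t. N \<in> \<P> \<Longrightarrow> t \<in> C N \<Longrightarrow> g N t = 1"
    "\<And>N N' t. N \<in> \<P> \<Longrightarrow> N' \<in> \<P> - {N} \<Longrightarrow> t \<in> C N' \<Longrightarrow> g N t = 0"
    by metis
  define v where "v t = (\<Sum>N\<in>\<P>. g N t *\<^sub>R w N)" for t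
  \<comment> \<open>Radial retraction onto the closed unit ball: it repairs the norm where the
    Urysohn functions overlap and fixes the values \<open>w N\<close>.\<close>
  define u where "u t = inverse (max 1 (norm (v t))) *\<^sub>R v t" for t
  have cont_v: "continuous_on UNIV v" unfolding v_def by (intro continuous_intros g(1))
  have "max 1 (norm (v t)) \<noteq> 0" for t by linarith
  then have "continuous_on UNIV u" unfolding u_def by (intro continuous_intros cont_v) auto
  moreover have "norm (u t) \<le> 1" for t
  proof -
    have "norm (u t) = norm (v t) / max 1 (norm (v t))" by (simp add: u_def divide_inverse mult.commute)
    also have "\<dots> \<le> 1" by (subst divide_le_eq_1_pos) (auto simp: less_max_iff_disj)
    finally show ?thesis .
  qed
  moreover have "u t = w N" if N: "N \<in> \<P>" and t: "t \<in> C N" for N t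
  proof -
    have "v t = (\<Sum>N'\<in>\<P>. if N' = N then w N else 0)"
      unfolding v_def
    proof (rule sum.cong[OF refl])
      fix N' assume N': "N' \<in> \<P>"
      show "g N' t *\<^sub>R w N' = (if N' = N then w N else 0)"
        using g(2)[OF N t] g(3)[OF N' _ t] N by (cases "N' = N") simp_all
    qed
    then have "v t = w N" using \<P>(1) N by simp
    then show ?thesis using w[OF N] by (simp add: u_def)
  qed
  moreover have "C N \<in> sets borel \<and> C N \<subseteq> N \<and> emeasure lborel (N - C N) < ennreal e" if "N \<in> \<P>" for N
    using C that by auto
  ultimately show ?thesis using that by blast
qed

lemma set_integral_reflect_interval:
  fixes h :: "real \<Rightarrow> 'b::{banach, second_countable_topology}"
  shows "(LINT t:{0..T}|lborel. h (T - t)) = (LINT t:{0..T}|lborel. h t)"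
proof -
  have "(LINT t:{0..T}|lborel. h t) = (\<integral>x. indicator {0..T} (T + (- 1) * x) *\<^sub>R h (T + (- 1) * x) \<partial>lborel)"
    unfolding set_lebesgue_integral_def by (subst lborel_integral_real_affine[where c = "- 1" and t = T]) auto
  also have "\<dots> = (LINT t:{0..T}|lborel. h (T - t))"
    unfolding set_lebesgue_integral_def
    by (intro Bochner_Integration.integral_cong refl) (auto simp: indicator_def)
  finally show ?thesis by simp
qed

section \<open>Comparison of the dual norm with the semivariation\<close>

context control_system
begin

text \<open>The input map involves \<open>S (T - t)\<close>, the observation measure
  \<open>S t\<close>; reversing the control translates between them without changing its
  norm.\<close>

lemma control_reverse:
  assumes u: "u \<in> controls \<tau>U T"
  shows "(\<lambda>t. u (T - t)) \<in> controls \<tau>U T"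
proof -
  have "continuous_map (top_of_set {0..T}) (top_of_set {0..T}) (\<lambda>t. T - t)"
    using reversal by (auto simp: continuous_map_in_subtopology)
  from continuous_map_compose[OF this, of \<tau>U u] u
  have "continuous_map (top_of_set {0..T}) \<tau>U (\<lambda>t. u (T - t))" by (simp add: controls_def o_def)
  moreover have "bounded ((\<lambda>t. u (T - t)) ` {0..T})"
    by (rule bounded_subset[OF bounded_control[OF u]]) auto
  ultimately show ?thesis by (simp add: controls_def)
qed

lemma circ_dual_observation:
  assumes u: "u \<in> controls \<tau>U T" and f: "f \<in> circ_dual scaleX \<tau>X"
  shows "set_integrable lborel {0..T} (\<lambda>t. f (S t (B (u t))))"
    and "f (input (\<lambda>t. u (T - t))) = (LINT t:{0..T}|lborel. f (S t (B (u t))))"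
proof -
  show "set_integrable lborel {0..T} (\<lambda>t. f (S t (B (u t))))"
    by (rule borel_integrable_atLeastAtMost'[OF continuous_on_circ_dual[OF sequentially_continuous_on_SB[OF u] f]])
      (auto intro: continuous_intros)
  show "f (input (\<lambda>t. u (T - t))) = (LINT t:{0..T}|lborel. f (S t (B (u t))))"
    unfolding circ_dual_input(2)[OF control_reverse[OF u] f]
    by (rule set_integral_reflect_interval)
qed

text \<open>Phrased for differences and uniform in \<open>t\<close>, because both comparisons
  replace one value of a control by another at the same time.\<close>

lemma circ_dual_SB_bound:
  assumes f: "f \<in> circ_dual scaleX \<tau>X"
  obtains M where "M > 0" "\<And>t v w. t \<in> {0..T} \<Longrightarrow> norm (f (S t (B v)) - f (S t (B w))) \<le> M * norm (v - w)"
proof -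
  obtain M where M: "M > 0" "\<And>t w. t \<in> {0..T} \<Longrightarrow> norm (S t (B w)) \<le> M * norm w"
    using SB_bound by metis
  have bl: "bounded_linear f" by (rule bounded_linear_circ_dual[OF f])
  obtain L where L: "L > 0" "\<And>x. norm (f x) \<le> norm x * L"
    using bounded_linear.pos_bounded[OF bl] by metis
  have "norm (f (S t (B v)) - f (S t (B w))) \<le> (M * L) * norm (v - w)" if t: "t \<in> {0..T}" for t v w
  proof -
    have "bounded_linear (\<lambda>w. f (S t (B w)))"
      using bounded_linear_compose[OF bl bounded_linear_compose[OF bounded_linear_S bounded_linear_B]] t
      by simp
    from linear_diff[OF bounded_linear.linear[OF this], of v w]
    have "f (S t (B v)) - f (S t (B w)) = f (S t (B (v - w)))" by (rule sym)
    also have "norm \<dots> \<le> norm (S t (B (v - w))) * L" by (rule L(2))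
    also have "\<dots> \<le> (M * norm (v - w)) * L" using L(1) M(2)[OF t] by (intro mult_right_mono) auto
    finally show ?thesis by (simp add: algebra_simps)
  qed
  then show ?thesis using that[of "M * L"] M(1) L(1) by simp
qed

lemma observation_measure_eq: "observation_measure S B f N w = (LINT t:N|lborel. f (S t (B w)))"
  by (simp add: observation_measure_def circ_op_def)

context
  assumes norm_topology: "\<tau>U = euclidean"
begin

lemma controls_iff_continuous: "u \<in> controls \<tau>U T \<longleftrightarrow> continuous_on {0..T} u"
  using compact_imp_bounded[OF compact_continuous_image[of "{0..T}" u]]
  by (auto simp: controls_def norm_topology)

lemma set_integrable_SB_const:
  assumes f: "f \<in> circ_dual scaleX \<tau>X" and N: "N \<in> sets borel" "N \<subseteq> {0..T}"
  shows "set_integrable lborel N (\<lambda>t. f (S t (B w)))"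
  by (rule set_integrable_subset[OF circ_dual_observation(1)[OF _ f, of "\<lambda>_. w"]])
    (use N controls_iff_continuous in auto)

text \<open>The values of the reversed control at the tags of a fine partition become the vectors
  \<open>w N\<close>. For the norm topology a control is uniformly norm continuous, so these vectors
  are close to it on entire cells.\<close>

lemma dual_norm_le_semivariation:
  assumes f: "f \<in> circ_dual scaleX \<tau>X"
  shows "dual_norm f \<le> semivariation T (observation_measure S B f)"
proof (rule dual_norm_le, rule ennreal_le_epsilon)
  fix u and e :: real assume u: "u \<in> controls \<tau>U T" "control_norm T u \<le> 1" and e: "e > 0"
  define v where "v t = u (T - t)" for t
  have v: "v \<in> controls \<tau>U T" unfolding v_def by (rule control_reverse[OF u(1)])
  have v1: "norm (v t) \<le> 1" if "t \<in> {0..T}" for t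
    using order_trans[OF norm_control_le[OF u(1), of "T - t"] u(2)] that by (simp add: v_def)
  obtain M where M: "M > 0"
    "\<And>t v w. t \<in> {0..T} \<Longrightarrow> norm (f (S t (B v)) - f (S t (B w))) \<le> M * norm (v - w)"
    using circ_dual_SB_bound[OF f] by metis
  \<comment> \<open>A variation below \<open>d\<close> within the cells changes the integrand by at
    most \<open>M * d\<close>, over an interval of length \<open>T\<close>.\<close>
  obtain d where d: "d > 0" "T * M * d < e"
    using exists_small_factor[OF e, of "T * M"] T M(1) by auto
  obtain \<delta> where \<delta>: "\<delta> > 0" "\<And>s t. s \<in> {0..T} \<Longrightarrow> t \<in> {0..T} \<Longrightarrow> \<bar>s - t\<bar> < \<delta> \<Longrightarrow> norm (v s - v t) < d"
    using compact_uniformly_continuous[OF v[unfolded controls_iff_continuous] compact_Icc] d(1)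
    unfolding uniformly_continuous_on_def by (auto simp: dist_norm)
  obtain \<P> where \<P>: "finite \<P>" "partition_on {0..T} \<P>" "\<P> \<subseteq> sets borel"
    and mesh: "\<And>N s t. N \<in> \<P> \<Longrightarrow> s \<in> N \<Longrightarrow> t \<in> N \<Longrightarrow> \<bar>s - t\<bar> < \<delta>"
    using fine_borel_partition[OF \<delta>(1), of 0 T] by metis
  have sub: "N \<subseteq> {0..T}" and sets: "N \<in> sets borel" if "N \<in> \<P>" for N
    using that \<P>(2,3) by (auto simp: partition_on_def)
  define w where "w N = v (SOME t. t \<in> N)" for N
  have tag: "(SOME t. t \<in> N) \<in> {0..T}" if "N \<in> \<P>" for N
    using partition_on_tag[OF \<P>(2) that] sub[OF that] by blast
  define \<Sigma> where "\<Sigma> = (\<Sum>N\<in>\<P>. observation_measure S B f N (w N))"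
  have "norm (\<Sigma> - (LINT t:{0..T}|lborel. f (S t (B (v t))))) \<le> (T - 0) * (M * d)"
    unfolding \<Sigma>_def observation_measure_eq
  proof (rule partition_integral_approx[OF \<P> _ circ_dual_observation(1)[OF v f]])
    show "0 \<le> T" using T by simp
    fix N assume N: "N \<in> \<P>"
    show "set_integrable lborel N (\<lambda>t. f (S t (B (w N))))"
      by (rule set_integrable_SB_const[OF f sets[OF N] sub[OF N]])
    fix t assume t: "t \<in> N"
    have tT: "t \<in> {0..T}" using t sub[OF N] by blast
    have "norm (v (SOME t. t \<in> N) - v t) < d"
      by (rule \<delta>(2)[OF tag[OF N] tT mesh[OF N partition_on_tag[OF \<P>(2) N] t]])
    then have "M * norm (w N - v t) \<le> M * d" unfolding w_def using M(1) by simp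
    with M(2)[OF tT] show "norm (f (S t (B (w N))) - f (S t (B (v t)))) \<le> M * d"
      by (rule order_trans)
  qed
  also have "(T - 0) * (M * d) \<le> e" using d(2) by (simp add: mult.assoc)
  finally have approx: "norm (\<Sigma> - (LINT t:{0..T}|lborel. f (S t (B (v t))))) \<le> e" .
  have "f (input u) = (LINT t:{0..T}|lborel. f (S t (B (v t))))"
    using circ_dual_observation(2)[OF v f] by (simp add: v_def)
  then have "norm (f (input u)) \<le> norm \<Sigma> + e"
    using approx norm_triangle_sub[of "f (input u)" \<Sigma>] by (simp add: norm_minus_commute)
  then have "ennreal (norm (f (input u))) \<le> ennreal (norm \<Sigma> + e)" by (rule ennreal_leI)
  also have "\<dots> = ennreal (norm \<Sigma>) + ennreal e" using e by (intro ennreal_plus) auto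
  also have "ennreal (norm \<Sigma>) \<le> semivariation T (observation_measure S B f)"
    unfolding semivariation_def \<Sigma>_def
    by (rule SUP_upper2[of "(\<P>, w)"]) (use \<P> v1 tag in \<open>auto simp: w_def\<close>)
  finally show "ennreal (norm (f (input u))) \<le> semivariation T (observation_measure S B f) + ennreal e"
    by (simp add: add_right_mono)
qed

text \<open>For the norm topology the continuous approximant of a step function is itself a control
  of norm at most 1, and the two functions can differ only on the small sets
  \<open>N - C N\<close>.\<close>

lemma semivariation_le_dual_norm:
  assumes f: "f \<in> circ_dual scaleX \<tau>X"
  shows "semivariation T (observation_measure S B f) \<le> dual_norm f"
  unfolding semivariation_def
proof (rule SUP_least, clarify, rule ennreal_le_epsilon)
  fix \<P> and w :: "real set \<Rightarrow> 'u" and e :: real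
  assume \<P>: "finite \<P>" "partition_on {0..T} \<P>" "\<P> \<subseteq> sets borel"
    and w: "\<forall>N\<in>\<P>. norm (w N) \<le> 1" and e: "e > 0"
  obtain M where M: "M > 0"
    "\<And>t v w. t \<in> {0..T} \<Longrightarrow> norm (f (S t (B v)) - f (S t (B w))) \<le> M * norm (v - w)"
    using circ_dual_SB_bound[OF f] by metis
  \<comment> \<open>There are \<open>card \<P>\<close> cells, each with an exceptional set of
    measure below \<open>d\<close> on which the integrands differ by at most
    \<open>2 * M\<close>.\<close>
  obtain d where d: "d > 0" "real (card \<P>) * (2 * M) * d < e"
    using exists_small_factor[OF e, of "real (card \<P>) * (2 * M)"] M(1) by auto
  obtain u C where u: "continuous_on UNIV u" "\<And>t. norm (u t) \<le> 1"
    and uC: "\<And>N t. N \<in> \<P> \<Longrightarrow> t \<in> C N \<Longrightarrow> u t = w N"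
    and C: "\<And>N. N \<in> \<P> \<Longrightarrow> C N \<in> sets borel \<and> C N \<subseteq> N \<and> emeasure lborel (N - C N) < ennreal d"
    using continuous_approx_of_step_function[OF \<P> _ d(1), of w] w by metis
  have sub: "N \<subseteq> {0..T}" and sets: "N \<in> sets borel" if "N \<in> \<P>" for N
    using that \<P>(2,3) by (auto simp: partition_on_def)
  have u_control: "u \<in> controls \<tau>U T"
    using continuous_on_subset[OF u(1)] by (simp add: controls_iff_continuous)
  note int_u = circ_dual_observation(1)[OF u_control f]
  have int_uN: "set_integrable lborel N (\<lambda>t. f (S t (B (u t))))" if "N \<in> \<P>" for N
    by (rule set_integrable_subset[OF int_u]) (use sets[OF that] sub[OF that] in auto)
  have split: "(LINT t:{0..T}|lborel. f (S t (B (u t)))) = (\<Sum>N\<in>\<P>. LINT t:N|lborel. f (S t (B (u t))))"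
    using set_integral_finite_Union[OF \<P>(1) finite_partition_onD(2)[OF \<P>(2)], of lborel "\<lambda>t. f (S t (B (u t)))"]
      int_uN sets finite_partition_onD(1)[OF \<P>(2)] by simp
  define \<Sigma> where "\<Sigma> = (\<Sum>N\<in>\<P>. observation_measure S B f N (w N))"
  have "norm (observation_measure S B f N (w N) - (LINT t:N|lborel. f (S t (B (u t))))) \<le> 2 * M * d"
    if N: "N \<in> \<P>" for N
  proof -
    note int_w = set_integrable_SB_const[OF f sets[OF N] sub[OF N], of "w N"]
    define E where "E = N - C N"
    have E: "E \<in> sets borel" "E \<subseteq> {0..T}" "E \<subseteq> N"
      using C[OF N] sets[OF N] sub[OF N] by (auto simp: E_def)
    have "observation_measure S B f N (w N) - (LINT t:N|lborel. f (S t (B (u t))))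
        = (LINT t:N|lborel. f (S t (B (w N))) - f (S t (B (u t))))"
      unfolding observation_measure_eq by (rule set_integral_diff(2)[OF int_w int_uN[OF N], symmetric])
    \<comment> \<open>On \<open>C N\<close> the two integrands coincide, so only \<open>E\<close>
      contributes.\<close>
    also have "\<dots> = (LINT t:E|lborel. f (S t (B (w N))) - f (S t (B (u t))))"
      unfolding set_lebesgue_integral_def
      by (intro Bochner_Integration.integral_cong refl)
        (use uC[OF N] in \<open>auto simp: E_def indicator_def\<close>)
    also have "norm \<dots> \<le> (LINT t:E|lborel. norm (f (S t (B (w N))) - f (S t (B (u t)))))"
      by (rule set_integral_norm_bound, rule set_integrable_subset[OF set_integral_diff(1)[OF int_w int_uN[OF N]]])
        (use E in auto)
    also have "\<dots> \<le> (LINT t:E|lborel. 2 * M)"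
    proof (rule set_integral_mono)
      show "set_integrable lborel E (\<lambda>t. norm (f (S t (B (w N))) - f (S t (B (u t)))))"
        by (rule set_integrable_norm, rule set_integrable_subset[OF set_integral_diff(1)[OF int_w int_uN[OF N]]])
          (use E in auto)
      show "set_integrable lborel E (\<lambda>t. 2 * M)" by (rule set_integral_interval_const[OF E(1,2)])
      fix t assume t: "t \<in> E"
      have "norm (w N - u t) \<le> 2"
        using norm_triangle_ineq4[of "w N" "u t"] u(2)[of t] w N by fastforce
      then have "M * norm (w N - u t) \<le> 2 * M" using M(1) by simp
      with M(2) show "norm (f (S t (B (w N))) - f (S t (B (u t)))) \<le> 2 * M"
        using t E(2) order_trans by blast
    qed
    also have "\<dots> = measure lborel E * (2 * M)" using set_integral_interval_const(2)[OF E(1,2), of "2 * M"] by simp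
    also have "\<dots> \<le> d * (2 * M)"
    proof (rule mult_right_mono)
      have "emeasure lborel E < ennreal d" using C[OF N] by (simp add: E_def)
      then show "measure lborel E \<le> d" unfolding measure_def using d(1) by (simp add: enn2real_leI less_imp_le)
    qed (use M(1) in simp)
    finally show ?thesis by (simp add: mult.commute mult.left_commute)
  qed
  then have "norm (\<Sigma> - (LINT t:{0..T}|lborel. f (S t (B (u t))))) \<le> (\<Sum>N\<in>\<P>. 2 * M * d)"
    unfolding \<Sigma>_def split sum_subtractf[symmetric] by (rule sum_norm_le)
  also have "\<dots> \<le> e" using d(2) by (simp add: mult.assoc)
  finally have "norm (\<Sigma> - f (input (\<lambda>t. u (T - t)))) \<le> e"
    by (simp add: circ_dual_observation(2)[OF u_control f])
  then have "norm \<Sigma> \<le> norm (f (input (\<lambda>t. u (T - t)))) + e"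
    using norm_triangle_sub[of \<Sigma> "f (input (\<lambda>t. u (T - t)))"] by simp
  then have "ennreal (norm \<Sigma>) \<le> ennreal (norm (f (input (\<lambda>t. u (T - t)))) + e)" by (rule ennreal_leI)
  also have "\<dots> = ennreal (norm (f (input (\<lambda>t. u (T - t))))) + ennreal e"
    using e by (intro ennreal_plus) auto
  also have "\<dots> \<le> dual_norm f + ennreal e"
    by (intro add_right_mono dual_norm_ge control_reverse u_control control_norm_le u(2))
  finally show "ennreal (norm (\<Sum>N\<in>\<P>. observation_measure S B f N (w N))) \<le> dual_norm f + ennreal e"
    by (simp add: \<Sigma>_def)
qed

lemma dual_norm_eq_semivariation:
  "f \<in> circ_dual scaleX \<tau>X \<Longrightarrow> dual_norm f = semivariation T (observation_measure S B f)"
  by (intro antisym dual_norm_le_semivariation semivariation_le_dual_norm)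

end

end

theorem theorem5p18:
  fixes scaleX :: "'k::real_or_complex \<Rightarrow> 'x::banach \<Rightarrow> 'x"
    and scaleU :: "'k \<Rightarrow> 'u::banach \<Rightarrow> 'u"
    and \<tau>X :: "'x topology" and \<tau>U :: "'u topology"
    and P :: "('x \<Rightarrow> real) set"
    and S :: "real \<Rightarrow> 'x \<Rightarrow> 'x" and B :: "'u \<Rightarrow> 'x"
    and A :: "'x \<Rightarrow> 'x" and D :: "'x set"
    and A' :: "('x \<Rightarrow> 'k) \<Rightarrow> 'x \<Rightarrow> 'k" and D' :: "('x \<Rightarrow> 'k) set"
    and T :: real
  assumes "saks_space scaleX \<tau>X"
    and "sequentially_complete (mixed_topology scaleX \<tau>X)"
    and "C_sequential (mixed_topology scaleX \<tau>X)"
    and "directed_seminorms_inducing scaleX P \<tau>X"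
    and "saks_space scaleU \<tau>U"
    and "locally_bicontinuous scaleX \<tau>X S"
    and "has_generator \<tau>X S A D"
    and "has_dual_generator scaleX \<tau>X S A' D'"
    and "B \<in> bounded_ops scaleU scaleX"
    and "\<And>N. bounded N \<Longrightarrow> continuous_map (subtopology \<tau>U N) \<tau>X B"
    and "T > 0"
  shows "(cost_uniform_approx_null_controllable scaleX \<tau>X P \<tau>U S B T \<longleftrightarrow>
            final_state_observable scaleX \<tau>X \<tau>U S B T) \<and>
         (\<tau>U = euclidean \<longrightarrow>
            (cost_uniform_approx_null_controllable scaleX \<tau>X P \<tau>U S B T \<longleftrightarrow>
               (\<exists>C\<ge>0. \<forall>f\<in>circ_dual scaleX \<tau>X.
                  ennreal (onorm (circ_op (S T) f))
                    \<le> ennreal C * semivariation T (observation_measure S B f))) \<and>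
            (final_state_observable scaleX \<tau>X \<tau>U S B T \<longleftrightarrow>
               (\<exists>C\<ge>0. \<forall>f\<in>circ_dual scaleX \<tau>X.
                  ennreal (onorm (circ_op (S T) f))
                    \<le> ennreal C * semivariation T (observation_measure S B f))))"
proof -
  interpret X: normed_space_over scaleX using assms(1) by (simp add: saks_space_def)
  interpret control_system scaleX P \<tau>X scaleU \<tau>U S B T
    by unfold_locales (use assms in auto)
  have "final_state_observable scaleX \<tau>X \<tau>U S B T \<longleftrightarrow>
      (\<exists>C\<ge>0. \<forall>f\<in>circ_dual scaleX \<tau>X.
         ennreal (onorm (circ_op (S T) f)) \<le> ennreal C * semivariation T (observation_measure S B f))"
    if "\<tau>U = euclidean"
    \<comment> \<open>The equality of the two norms is available for members of
      \<open>circ_dual\<close>, hence the congruence rule for the bounded quantifier.\<close>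
    unfolding final_state_observable_def by (simp add: dual_norm_eq_semivariation[OF that] cong: ball_cong)
  then show ?thesis using controllable_iff_observable by blast
qed

end
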